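(* Let $c\ge0$, $s\in(0,1)$, and let $L$ be the generator of the nonlocal Ornstein–Uhlenbeck semigroup $P_t$ on $C_b(L^2(0,1))$ described in the context. For every $f\in C_b(L^2(0,1))$ and $\lambda>0$, the equation $\lambda u-Lu=f$ has a unique solution $u\in Z^2_b(L^2(0,1))$, and there is $C>0$, independent of $f$, such that $\|u\|_{Z^2_b(L^2(0,1))}\le C\|f\|_\infty$. If in addition $f\in C^\alpha_b(L^2(0,1))$ with $\alpha\in(0,1)$, then $u\in C^{2+\alpha}_b(L^2(0,1))$, and there is $C>0$, independent of $f$, such that $\|u\|_{C^{2+\alpha}_b(L^2(0,1))}\le C\|f\|_{C^\alpha_b(L^2(0,1))}$.
   Context: The operator. $X=L^2(0,1)$ (real, Lebesgue measure), $\Delta$ is the Laplace operator on $L^2(0,1)$ with Dirichlet boundary conditions and $e^{t\Delta}$ its semigroup. For $t\ge0$, $\mu_t$ is the Borel probability measure on $X$ with Fourier transform $$\hat\mu_t(x)=\int_Xe^{i\langle x,y\rangle}\mu_t(dy)=\exp\Big\{-\int_0^t\big(\|e^{r\Delta}x\|^2+c\|e^{r\Delta}x\|^{2s}\big)\,dr\Big\},\quad x\in X$$ (these measures exist, $\mu_0=\delta_0$, and $t\mapsto\mu_t$ is weakly continuous). The semigroup is $P_tf(x)=\int_Xf(e^{t\Delta}x+y)\,\mu_t(dy)$, and its generator $L$ is the unique closed operator in $C_b(X)$ with $R(\lambda,L)f(x)=\int_0^\infty e^{-\lambda t}P_tf(x)\,dt$, $\lambda>0$, $f\in C_b(X)$.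 The solution of $\lambda u-Lu=f$ is $u=R(\lambda,L)f$ (unique in the domain of $L$). Function spaces. $C_b(X)$: bounded continuous functions $X\to\mathbb{R}$, sup norm. $\mathcal{L}^n(X)$: continuous $n$-linear forms on $X^n$ with the usual norm. $C^n_b(X)$: $f\in C_b(X)$ that are $n$ times Gateaux differentiable at every point ($D^kf:X\to\mathcal{L}^k(X)$ being the Gateaux derivative of $D^{k-1}f:X\to\mathcal{L}^{k-1}(X)$) with $x\mapsto D^kf(x)(h_1,\dots,h_k)$ continuous and bounded for all $k\le n$, $h_i\in X$; norm $\|f\|_\infty+\sum_{k=1}^n\sup_x\|D^kf(x)\|_{\mathcal{L}^k(X)}$. For $\alpha\in(0,1)$ and $F$ from $X$ to a Banach space, $[F]_\alpha=\sup_{x,\,h\ne0}\|F(x+h)-F(x)\|/\|h\|^\alpha$; $C^\alpha_b(X)=\{f\in C_b(X):[f]_\alpha<\infty\}$ with norm $\|f\|_\infty+[f]_\alpha$; $C^{2+\alpha}_b(X)=\{f\in C^2_b(X):[D^2f]_\alpha<\infty\}$ with norm $\|f\|_{C^2_b}+[D^2f]_\alpha$. $Z^2_b(X)=\{f\in C^1_b(X):[Df]_{Z^1}<\infty\}$, where $[F]_{Z^1}=\sup_{x,\,h\ne0}\|F(x+2h)-2F(x+h)+F(x)\|/\|h\|$, with norm $\|f\|_{C^1_b}+[Df]_{Z^1}$. *)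

theory Defs
  imports "HOL-Analysis.Analysis"
begin

section \<open>The Hilbert space \<open>L\<^sup>2(0,1)\<close>\<close>

text \<open>Real square-integrable functions on \<open>(0,1)\<close> modulo equality almost everywhere. The
  representatives are functions on the whole line of which only the restriction to \<open>(0,1)\<close>
  matters.\<close>

abbreviation leb01 :: "real measure" where
  "leb01 \<equiv> lebesgue_on {0<..<1}"

definition square_integrable01 :: "(real \<Rightarrow> real) \<Rightarrow> bool" where
  "square_integrable01 f \<longleftrightarrow>
     f \<in> borel_measurable leb01 \<and> integrable leb01 (\<lambda>x. (f x)\<^sup>2)"

definition eq_L2 :: "(real \<Rightarrow> real) \<Rightarrow> (real \<Rightarrow> real) \<Rightarrow> bool" where
  "eq_L2 f g \<longleftrightarrow>
     square_integrable01 f \<and> square_integrable01 g \<and> (AE x in leb01. f x = g x)"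

lemma square_integrable01_mult:
  assumes "square_integrable01 f" "square_integrable01 g"
  shows "integrable leb01 (\<lambda>x. f x * g x)"
proof (rule Bochner_Integration.integrable_bound)
  show "integrable leb01 (\<lambda>x. (f x)\<^sup>2 + (g x)\<^sup>2)"
    using assms by (simp add: square_integrable01_def)
  show "(\<lambda>x. f x * g x) \<in> borel_measurable leb01"
    using assms unfolding square_integrable01_def by (intro borel_measurable_times) simp_all
  have "\<bar>a * b\<bar> \<le> a\<^sup>2 + b\<^sup>2" for a b :: real
  proof -
    have "2 * (\<bar>a\<bar> * \<bar>b\<bar>) \<le> \<bar>a\<bar>\<^sup>2 + \<bar>b\<bar>\<^sup>2"
      using sum_squares_bound[of "\<bar>a\<bar>" "\<bar>b\<bar>"] by (simp add: mult.assoc)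
    moreover have "0 \<le> \<bar>a\<bar> * \<bar>b\<bar>" by simp
    ultimately show ?thesis unfolding abs_mult power2_abs by linarith
  qed
  then show "AE x in leb01. norm (f x * g x) \<le> norm ((f x)\<^sup>2 + (g x)\<^sup>2)"
    by simp
qed

lemma square_integrable01_add:
  assumes "square_integrable01 f" "square_integrable01 g"
  shows "square_integrable01 (\<lambda>x. f x + g x)"
proof -
  have "integrable leb01 (\<lambda>x. (f x)\<^sup>2 + (g x)\<^sup>2 + 2 * (f x * g x))"
    using assms square_integrable01_mult[OF assms]
    by (intro Bochner_Integration.integrable_add integrable_mult_right)
       (simp_all add: square_integrable01_def)
  moreover have "(\<lambda>x. f x + g x) \<in> borel_measurable leb01"
    using assms unfolding square_integrable01_def by (intro borel_measurable_add) simp_all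
  ultimately show ?thesis
    by (simp add: square_integrable01_def power2_sum mult.assoc)
qed

lemma square_integrable01_scale:
  assumes "square_integrable01 f"
  shows "square_integrable01 (\<lambda>x. c * f x)"
proof -
  have "(\<lambda>x. c * f x) \<in> borel_measurable leb01"
    using assms unfolding square_integrable01_def
    by (intro borel_measurable_times borel_measurable_const) simp_all
  then show ?thesis
    using assms by (simp add: square_integrable01_def power_mult_distrib)
qed

lemma square_integrable01_zero: "square_integrable01 (\<lambda>_. 0)"
  by (simp add: square_integrable01_def)

quotient_type L2 = "real \<Rightarrow> real" / partial: eq_L2
proof (rule part_equivpI)
  show "\<exists>f. eq_L2 f f"
    by (rule exI[of _ "\<lambda>_. 0"]) (simp add: eq_L2_def square_integrable01_zero)
  show "symp eq_L2"
    by (simp add: symp_def eq_L2_def eq_commute)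
  show "transp eq_L2"
  proof (rule transpI)
    fix f g h assume fg: "eq_L2 f g" and gh: "eq_L2 g h"
    have "AE x in leb01. f x = g x" "AE x in leb01. g x = h x"
      using fg gh by (auto simp: eq_L2_def)
    then have "AE x in leb01. f x = h x" by eventually_elim simp
    then show "eq_L2 f h" using fg gh by (simp add: eq_L2_def)
  qed
qed

text \<open>The function \<open>f\<close> is a representative of the class \<open>u\<close>.\<close>

definition represents :: "(real \<Rightarrow> real) \<Rightarrow> L2 \<Rightarrow> bool" where
  "represents f u \<longleftrightarrow> square_integrable01 f \<and> abs_L2 f = u"

instantiation L2 :: real_vector
begin

lift_definition zero_L2 :: L2 is "\<lambda>_. 0"
  by (simp add: eq_L2_def square_integrable01_zero)

lift_definition plus_L2 :: "L2 \<Rightarrow> L2 \<Rightarrow> L2" is "\<lambda>f g x. f x + g x"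
proof -
  fix f f' g g' assume *: "eq_L2 f f'" "eq_L2 g g'"
  have "AE x in leb01. f x = f' x" "AE x in leb01. g x = g' x"
    using * by (auto simp: eq_L2_def)
  then have "AE x in leb01. f x + g x = f' x + g' x" by eventually_elim simp
  then show "eq_L2 (\<lambda>x. f x + g x) (\<lambda>x. f' x + g' x)"
    using * by (simp add: eq_L2_def square_integrable01_add)
qed

lift_definition scaleR_L2 :: "real \<Rightarrow> L2 \<Rightarrow> L2" is "\<lambda>c f x. c * f x"
proof -
  fix c f f' assume *: "eq_L2 f f'"
  then have "AE x in leb01. f x = f' x" by (simp add: eq_L2_def)
  then have "AE x in leb01. c * f x = c * f' x" by eventually_elim simp
  then show "eq_L2 (\<lambda>x. c * f x) (\<lambda>x. c * f' x)"
    using * by (simp add: eq_L2_def square_integrable01_scale)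
qed

definition uminus_L2 :: "L2 \<Rightarrow> L2" where "uminus_L2 u = (- 1) *\<^sub>R u"
definition minus_L2 :: "L2 \<Rightarrow> L2 \<Rightarrow> L2" where "minus_L2 u v = u + (- v)"

instance
proof
  fix a b :: real and u v w :: L2
  show "u + v + w = u + (v + w)"
    by transfer (auto simp: eq_L2_def add.assoc intro!: square_integrable01_add)
  show "u + v = v + u"
    by transfer (auto simp: eq_L2_def add.commute intro!: square_integrable01_add)
  show "0 + u = u"
    by transfer (auto simp: eq_L2_def)
  show "- u + u = 0"
    unfolding uminus_L2_def
    by transfer (auto simp: eq_L2_def square_integrable01_zero)
  show "u - v = u + - v" by (rule minus_L2_def)
  show "a *\<^sub>R (u + v) = a *\<^sub>R u + a *\<^sub>R v"
    by transfer (auto simp: eq_L2_def distrib_left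
        intro!: square_integrable01_add square_integrable01_scale)
  show "(a + b) *\<^sub>R u = a *\<^sub>R u + b *\<^sub>R u"
    by transfer (auto simp: eq_L2_def distrib_right
        intro!: square_integrable01_add square_integrable01_scale)
  show "a *\<^sub>R b *\<^sub>R u = (a * b) *\<^sub>R u"
    by transfer (auto simp: eq_L2_def mult.assoc intro!: square_integrable01_scale)
  show "1 *\<^sub>R u = u"
    by transfer (auto simp: eq_L2_def)
qed

end

instantiation L2 :: real_inner
begin

lift_definition inner_L2 :: "L2 \<Rightarrow> L2 \<Rightarrow> real" is "\<lambda>f g. \<integral>x. f x * g x \<partial>leb01"
proof -
  fix f f' g g' assume *: "eq_L2 f f'" "eq_L2 g g'"
  have "AE x in leb01. f x = f' x" "AE x in leb01. g x = g' x"
    using * by (auto simp: eq_L2_def)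
  then have "AE x in leb01. f x * g x = f' x * g' x" by eventually_elim simp
  then show "(\<integral>x. f x * g x \<partial>leb01) = (\<integral>x. f' x * g' x \<partial>leb01)"
    using * square_integrable01_mult unfolding eq_L2_def
    by (intro integral_cong_AE borel_measurable_integrable) simp_all
qed

definition norm_L2 :: "L2 \<Rightarrow> real" where "norm_L2 u = sqrt (inner u u)"
definition sgn_L2 :: "L2 \<Rightarrow> L2" where "sgn_L2 u = u /\<^sub>R norm u"
definition dist_L2 :: "L2 \<Rightarrow> L2 \<Rightarrow> real" where "dist_L2 u v = norm (u - v)"
definition uniformity_L2 :: "(L2 \<times> L2) filter" where
  "uniformity_L2 = (INF e\<in>{0<..}. principal {(u, v). dist u v < e})"
definition open_L2 :: "L2 set \<Rightarrow> bool" where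
  "open_L2 U = (\<forall>u\<in>U. eventually (\<lambda>(u', v). u' = u \<longrightarrow> v \<in> U) uniformity)"

instance
proof
  fix r :: real and u v w :: L2 and U :: "L2 set"
  show "dist u v = norm (u - v)" by (rule dist_L2_def)
  show "sgn u = u /\<^sub>R norm u" by (rule sgn_L2_def)
  show "uniformity = (INF e\<in>{0<..}. principal {(u :: L2, v). dist u v < e})"
    by (rule uniformity_L2_def)
  show "open U = (\<forall>u\<in>U. eventually (\<lambda>(u', v). u' = u \<longrightarrow> v \<in> U) uniformity)"
    by (rule open_L2_def)
  show "norm u = sqrt (inner u u)" by (rule norm_L2_def)
  show "inner u v = inner v u"
    by transfer (simp add: mult.commute)
  show "inner (u + v) w = inner u w + inner v w"
    by transfer (simp add: eq_L2_def distrib_right square_integrable01_mult)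
  show "inner (r *\<^sub>R u) v = r * inner u v"
    by transfer (simp add: mult.assoc)
  show "0 \<le> inner u u"
    by transfer simp
  show "(inner u u = 0) = (u = 0)"
  proof (transfer, goal_cases)
    case (1 f)
    then have f: "square_integrable01 f" by (simp add: eq_L2_def)
    have "(\<integral>x. f x * f x \<partial>leb01) = 0 \<longleftrightarrow> (AE x in leb01. f x * f x = 0)"
      by (intro integral_nonneg_eq_0_iff_AE square_integrable01_mult f) simp
    then show ?case
      using f by (simp add: eq_L2_def square_integrable01_zero)
  qed
qed

end

section \<open>Linear operators, resolvents and semigroups\<close>

text \<open>A (possibly unbounded) operator \<open>A\<close> is identified with its graph: \<open>(u, v) \<in> A\<close> means
  that \<open>u\<close> lies in the domain of \<open>A\<close> and \<open>A u = v\<close>.\<close>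

type_synonym 'a operator = "('a \<times> 'a) set"

definition closed_operator :: "'a::real_normed_vector operator \<Rightarrow> bool" where
  "closed_operator A \<longleftrightarrow> subspace A \<and> single_valued A \<and> closed A"

text \<open>\<open>u\<close> lies in the domain of \<open>A\<close> and \<open>lam u - A u = f\<close>.\<close>

definition solves :: "'a::real_vector operator \<Rightarrow> real \<Rightarrow> 'a \<Rightarrow> 'a \<Rightarrow> bool" where
  "solves A lam f u \<longleftrightarrow> (\<exists>v. (u, v) \<in> A \<and> lam *\<^sub>R u - v = f)"

text \<open>For a closed operator in a Banach space, the inverse of a bijective \<open>lam - A\<close> is
  automatically bounded.\<close>

definition resolvent_set :: "'a::real_vector operator \<Rightarrow> real set" where
  "resolvent_set A = {lam. \<forall>f. \<exists>!u. solves A lam f u}"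

definition resolvent :: "real \<Rightarrow> 'a::real_vector operator \<Rightarrow> 'a \<Rightarrow> 'a" where
  "resolvent lam A f = (THE u. solves A lam f u)"

definition C0_semigroup :: "(real \<Rightarrow> 'a::real_normed_vector \<Rightarrow>\<^sub>L 'a) \<Rightarrow> bool" where
  "C0_semigroup S \<longleftrightarrow>
     S 0 = id_blinfun \<and>
     (\<forall>s\<ge>0. \<forall>t\<ge>0. S (s + t) = S s o\<^sub>L S t) \<and>
     (\<forall>x. ((\<lambda>t. S t x) \<longlongrightarrow> x) (at_right 0))"

definition infinitesimal_generator ::
    "(real \<Rightarrow> 'a::real_normed_vector \<Rightarrow>\<^sub>L 'a) \<Rightarrow> 'a operator" where
  "infinitesimal_generator S = {(x, y). ((\<lambda>t. (S t x - x) /\<^sub>R t) \<longlongrightarrow> y) (at_right 0)}"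

text \<open>The Dirichlet Laplacian on \<open>(0,1)\<close>, with domain \<open>H\<^sup>2 \<inter> H\<^sup>1\<^sub>0\<close>. A class belongs to this domain
  iff it has a representative \<open>F\<close> vanishing at \<open>0\<close> and \<open>1\<close> which is a primitive of a function \<open>G\<close>
  that is in turn absolutely continuous with square-integrable derivative \<open>W\<close>; the class of \<open>W\<close>
  is then the (weak) second derivative.\<close>

definition dirichlet_laplacian :: "L2 operator" where
  "dirichlet_laplacian = {(u, w). \<exists>F G W. represents F u \<and> represents W w \<and>
     F 0 = 0 \<and> F 1 = 0 \<and>
     (\<forall>x\<in>{0..1}. F x = F 0 + (LINT y:{0<..<x}|lebesgue. G y)) \<and>
     (\<forall>x\<in>{0..1}. G x = G 0 + (LINT y:{0<..<x}|lebesgue. W y))}"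

section \<open>Spaces of smooth functions\<close>

text \<open>\<open>C\<^sub>b(X)\<close> with the sup norm is the library type of bounded continuous functions. Bilinear
  forms are curried: the space of continuous bilinear forms with its usual norm is
  \<open>X \<Rightarrow>\<^sub>L (X \<Rightarrow>\<^sub>L real)\<close>. Norms and seminorms of functions take values in the extended
  nonnegative reals, so that the suprema involved are always meaningful.\<close>

definition has_gateaux_derivative ::
    "('a::real_normed_vector \<Rightarrow> 'b::real_normed_vector) \<Rightarrow> ('a \<Rightarrow>\<^sub>L 'b) \<Rightarrow> 'a \<Rightarrow> bool" where
  "has_gateaux_derivative F D x \<longleftrightarrow>
     (\<forall>h. ((\<lambda>t. (F (x + t *\<^sub>R h) - F x) /\<^sub>R t) \<longlongrightarrow> D h) (at 0))"

definition gateaux_differentiable ::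
    "('a::real_normed_vector \<Rightarrow> 'b::real_normed_vector) \<Rightarrow> 'a \<Rightarrow> bool" where
  "gateaux_differentiable F x \<longleftrightarrow> (\<exists>D. has_gateaux_derivative F D x)"

definition gateaux_deriv ::
    "('a::real_normed_vector \<Rightarrow> 'b::real_normed_vector) \<Rightarrow> 'a \<Rightarrow> 'a \<Rightarrow>\<^sub>L 'b" where
  "gateaux_deriv F x = (THE D. has_gateaux_derivative F D x)"

definition D1 :: "('a::real_normed_vector \<Rightarrow>\<^sub>C real) \<Rightarrow> 'a \<Rightarrow> 'a \<Rightarrow>\<^sub>L real" where
  "D1 f = gateaux_deriv (apply_bcontfun f)"

definition D2 :: "('a::real_normed_vector \<Rightarrow>\<^sub>C real) \<Rightarrow> 'a \<Rightarrow> 'a \<Rightarrow>\<^sub>L 'a \<Rightarrow>\<^sub>L real" where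
  "D2 f = gateaux_deriv (D1 f)"

definition Cb1 :: "('a::real_normed_vector \<Rightarrow>\<^sub>C real) set" where
  "Cb1 = {f. (\<forall>x. gateaux_differentiable (apply_bcontfun f) x) \<and>
             (\<forall>h. continuous_on UNIV (\<lambda>x. D1 f x h) \<and> bounded (range (\<lambda>x. D1 f x h)))}"

definition Cb2 :: "('a::real_normed_vector \<Rightarrow>\<^sub>C real) set" where
  "Cb2 = {f \<in> Cb1. (\<forall>x. gateaux_differentiable (D1 f) x) \<and>
             (\<forall>h k. continuous_on UNIV (\<lambda>x. D2 f x h k) \<and> bounded (range (\<lambda>x. D2 f x h k)))}"

definition norm_Cb1 :: "('a::real_normed_vector \<Rightarrow>\<^sub>C real) \<Rightarrow> ennreal" where
  "norm_Cb1 f = ennreal (norm f) + (SUP x. ennreal (norm (D1 f x)))"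

definition norm_Cb2 :: "('a::real_normed_vector \<Rightarrow>\<^sub>C real) \<Rightarrow> ennreal" where
  "norm_Cb2 f = norm_Cb1 f + (SUP x. ennreal (norm (D2 f x)))"

definition hoelder_seminorm ::
    "real \<Rightarrow> ('a::real_normed_vector \<Rightarrow> 'b::real_normed_vector) \<Rightarrow> ennreal" where
  "hoelder_seminorm \<alpha> F =
     (SUP x. SUP h\<in>- {0}. ennreal (norm (F (x + h) - F x) / norm h powr \<alpha>))"

definition zygmund_seminorm ::
    "('a::real_normed_vector \<Rightarrow> 'b::real_normed_vector) \<Rightarrow> ennreal" where
  "zygmund_seminorm F =
     (SUP x. SUP h\<in>- {0}. ennreal (norm (F (x + 2 *\<^sub>R h) - 2 *\<^sub>R F (x + h) + F x) / norm h))"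

definition Cb_hoelder :: "real \<Rightarrow> ('a::real_normed_vector \<Rightarrow>\<^sub>C real) set" where
  "Cb_hoelder \<alpha> = {f. hoelder_seminorm \<alpha> (apply_bcontfun f) < \<infinity>}"

definition norm_Cb_hoelder :: "real \<Rightarrow> ('a::real_normed_vector \<Rightarrow>\<^sub>C real) \<Rightarrow> ennreal" where
  "norm_Cb_hoelder \<alpha> f = ennreal (norm f) + hoelder_seminorm \<alpha> (apply_bcontfun f)"

definition Cb2_hoelder :: "real \<Rightarrow> ('a::real_normed_vector \<Rightarrow>\<^sub>C real) set" where
  "Cb2_hoelder \<alpha> = {f \<in> Cb2. hoelder_seminorm \<alpha> (D2 f) < \<infinity>}"

definition norm_Cb2_hoelder :: "real \<Rightarrow> ('a::real_normed_vector \<Rightarrow>\<^sub>C real) \<Rightarrow> ennreal" where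
  "norm_Cb2_hoelder \<alpha> f = norm_Cb2 f + hoelder_seminorm \<alpha> (D2 f)"

definition Zb2 :: "('a::real_normed_vector \<Rightarrow>\<^sub>C real) set" where
  "Zb2 = {f \<in> Cb1. zygmund_seminorm (D1 f) < \<infinity>}"

definition norm_Zb2 :: "('a::real_normed_vector \<Rightarrow>\<^sub>C real) \<Rightarrow> ennreal" where
  "norm_Zb2 f = norm_Cb1 f + zygmund_seminorm (D1 f)"

section \<open>The nonlocal Ornstein--Uhlenbeck semigroup and its generator\<close>

text \<open>\<open>S t\<close> plays the role of \<open>e\<^sup>t\<^sup>\<Delta>\<close>. The conditions determine \<open>\<mu> t\<close> uniquely for each \<open>t \<ge> 0\<close>.\<close>

definition OU_measures ::
    "real \<Rightarrow> real \<Rightarrow> (real \<Rightarrow> 'a::real_inner \<Rightarrow>\<^sub>L 'a) \<Rightarrow> (real \<Rightarrow> 'a measure) \<Rightarrow> bool" where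
  "OU_measures c s S \<mu> \<longleftrightarrow> (\<forall>t\<ge>0.
     sets (\<mu> t) = sets borel \<and> emeasure (\<mu> t) (space (\<mu> t)) = 1 \<and>
     (\<forall>x. (\<integral>y. exp (\<i> * complex_of_real (inner x y)) \<partial>\<mu> t) =
          complex_of_real (exp (- (LINT r:{0..t}|lborel.
            (norm (S r x))\<^sup>2 + c * norm (S r x) powr (2 * s))))))"

definition OU_semigroup ::
    "(real \<Rightarrow> 'a::real_normed_vector \<Rightarrow>\<^sub>L 'a) \<Rightarrow> (real \<Rightarrow> 'a measure) \<Rightarrow>
     real \<Rightarrow> ('a \<Rightarrow>\<^sub>C real) \<Rightarrow> 'a \<Rightarrow> real" where
  "OU_semigroup S \<mu> t f x = (\<integral>y. f (S t x + y) \<partial>\<mu> t)"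

text \<open>\<open>L\<close> is the closed operator in \<open>C\<^sub>b(X)\<close> whose resolvent is the Laplace transform of the
  semigroup. (The semigroup need not be strongly continuous on \<open>C\<^sub>b(X)\<close>, so \<open>L\<close> is not its
  infinitesimal generator in the above sense.)\<close>

definition OU_generator ::
    "(real \<Rightarrow> 'a::real_normed_vector \<Rightarrow>\<^sub>L 'a) \<Rightarrow> (real \<Rightarrow> 'a measure) \<Rightarrow>
     ('a \<Rightarrow>\<^sub>C real) operator \<Rightarrow> bool" where
  "OU_generator S \<mu> L \<longleftrightarrow> closed_operator L \<and> (\<forall>lam>0. lam \<in> resolvent_set L \<and>
     (\<forall>f x. resolvent lam L f x = (LINT t:{0..}|lborel. exp (- lam * t) * OU_semigroup S \<mu> t f x)))"

end

theory Submission
  imports Defs "HOL-Probability.Probability"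
begin

text \<open>Of \<open>S\<^sub>t = e\<^sup>t\<^sup>\<Delta>\<close> only self-adjointness and contractivity are used. They give
  \<open>t \<langle>S\<^sub>t h, x\<rangle>\<^sup>2 \<le> \<integral>\<^sub>0\<^sup>t \<parallel>S\<^sub>r x\<parallel>\<^sup>2 dr\<close> for \<open>\<parallel>h\<parallel> \<le> 1\<close>, so that, in every finite dimensional projection,
  \<open>\<mu>\<^sub>t\<close> has a one-dimensional Gaussian factor of variance \<open>t\<close> in the direction \<open>S\<^sub>t h\<close>. The rest of the
  factorization exists because convolving many rescaled copies of \<open>\<mu>\<^sub>t\<close> reproduces its \<open>2s\<close>-stable part
  with an arbitrarily small Gaussian part. Smoothing along that factor yields
  \<open>\<parallel>D P\<^sub>t f\<parallel> \<le> t\<^sup>-\<^sup>1\<^sup>/\<^sup>2 \<parallel>f\<parallel>\<close>, the bound \<open>\<parallel>D P\<^sub>t f\<parallel> \<le> 2 t\<^sup>(\<^sup>\<alpha>\<^sup>-\<^sup>1\<^sup>)\<^sup>/\<^sup>2 [f]\<^sub>\<alpha>\<close> for Hoelder \<open>f\<close>, and a first order Taylor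
  remainder of order \<open>\<parallel>h\<parallel>\<^sup>2 / t\<close>. Since \<open>D\<^sub>h P\<^sub>t\<^sub>+\<^sub>r f = P\<^sub>t (D\<^bsub>S\<^sub>t h\<^esub> P\<^sub>r f)\<close>, the same estimates apply once more to the
  first derivatives. In the Laplace transform \<open>\<integral> e\<^sup>-\<^sup>\<lambda>\<^sup>t P\<^sub>t f dt\<close>, bounding increments in \<open>h\<close> by the sup norm for
  \<open>t \<le> \<parallel>h\<parallel>\<^sup>2\<close> and by the Taylor remainder for \<open>t > \<parallel>h\<parallel>\<^sup>2\<close> gives the Zygmund and Hoelder bounds.\<close>

section \<open>Orthogonal projections and trigonometric polynomials\<close>

text \<open>Splitting a rank-one Gaussian off \<open>\<mu> t\<close> itself would require a measure
  on the Hilbert space with a prescribed characteristic functional. In a finite dimensional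
  projection the missing Gaussian factor can be built one coordinate at a time, so the split is made
  there. All bounds obtained from it are free of the dimension, and compactness yields a directional
  derivative in the limit. This is why derivatives are handled as inequalities with a quadratic
  remainder: such inequalities survive limits and integration, and they still determine the
  derivative. The exponents explain the two estimates. Halving the time turns a gradient rate
  t^(-\<gamma>) into a rate t^(-\<gamma>-1/2) for the second derivative. For bounded data \<gamma> =
  1/2 gives t^(-1), which is not integrable at 0, so only second differences of the gradient are
  controlled: the Zygmund class. For \<alpha>-Hoelder data the rate is t^(-1+\<alpha>/2), which is
  integrable, and the resolvent has a second derivative.\<close>

definition orthonormal :: "'a::real_inner set \<Rightarrow> bool" where
  "orthonormal E \<longleftrightarrow> finite E \<and> (\<forall>e\<in>E. \<forall>e'\<in>E. inner e e' = (if e = e' then 1 else 0))"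

definition orth_proj :: "'a::real_inner set \<Rightarrow> 'a \<Rightarrow> 'a" where
  "orth_proj E x = (\<Sum>e\<in>E. inner e x *\<^sub>R e)"

lemma orthonormal_finite: "orthonormal E \<Longrightarrow> finite E"
  by (simp add: orthonormal_def)

lemma inner_orthonormal_sum:
  assumes "orthonormal E" "e \<in> E"
  shows "inner e (\<Sum>e'\<in>E. s e' *\<^sub>R e') = s e"
proof -
  have "inner e (\<Sum>e'\<in>E. s e' *\<^sub>R e') = (\<Sum>e'\<in>E. if e = e' then s e' else 0)"
    unfolding inner_sum_right
    using assms by (intro sum.cong) (auto simp: orthonormal_def)
  also have "\<dots> = s e" using assms by (simp add: orthonormal_def)
  finally show ?thesis .
qed

lemma inner_orth_proj:
  assumes "orthonormal E" "e \<in> E"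
  shows "inner e (orth_proj E x) = inner e x"
  unfolding orth_proj_def by (rule inner_orthonormal_sum[OF assms])

lemma orth_proj_inner_commute: "inner (orth_proj E x) y = inner x (orth_proj E y)"
  by (simp add: orth_proj_def inner_sum_left inner_sum_right inner_commute mult.commute)

lemma linear_orth_proj: "linear (orth_proj E)"
  by (rule linearI)
    (simp_all add: orth_proj_def inner_add_right scaleR_add_left sum.distrib scaleR_sum_right)

lemmas orth_proj_add = linear_add[OF linear_orth_proj]
  and orth_proj_scaleR = linear_scale[OF linear_orth_proj]
  and orth_proj_diff = linear_diff[OF linear_orth_proj]

lemma continuous_orth_proj: "continuous_on A (orth_proj E)"
  unfolding orth_proj_def by (intro continuous_intros)

lemma orth_proj_idem:
  assumes "orthonormal E"
  shows "orth_proj E (orth_proj E x) = orth_proj E x"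
proof -
  have "orth_proj E (orth_proj E x) = (\<Sum>e\<in>E. inner e (orth_proj E x) *\<^sub>R e)"
    by (rule orth_proj_def)
  also have "\<dots> = (\<Sum>e\<in>E. inner e x *\<^sub>R e)"
    using inner_orth_proj[OF assms] by (intro sum.cong) auto
  finally show ?thesis by (simp add: orth_proj_def)
qed

lemma orth_proj_span:
  assumes E: "orthonormal E" and "x \<in> span E"
  shows "orth_proj E x = x"
  using assms(2)
proof (induction rule: span_induct_alt)
  case base
  show ?case by (simp add: orth_proj_def)
next
  case (step c x y)
  have "orth_proj E x = (\<Sum>e\<in>E. if e = x then e else 0)"
    unfolding orth_proj_def using E step by (intro sum.cong) (auto simp: orthonormal_def)
  also have "\<dots> = x" using E step by (simp add: orthonormal_def)
  finally show ?case using step by (simp add: orth_proj_add orth_proj_scaleR)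
qed

lemma orth_proj_orthogonal:
  assumes E: "orthonormal E"
  shows "inner (x - orth_proj E x) (orth_proj E y) = 0"
  using orth_proj_inner_commute[of E "x - orth_proj E x" y]
  by (simp add: orth_proj_diff orth_proj_idem[OF E])

lemma norm_orth_proj_le:
  assumes E: "orthonormal E"
  shows "norm (orth_proj E x) \<le> norm x"
proof -
  have "(norm x)\<^sup>2 = (norm (x - orth_proj E x))\<^sup>2 + (norm (orth_proj E x))\<^sup>2"
    using norm_add_Pythagorean[of "x - orth_proj E x" "orth_proj E x"] orth_proj_orthogonal[OF E, of x x]
    by (simp add: orthogonal_def)
  then have "(norm (orth_proj E x))\<^sup>2 \<le> (norm x)\<^sup>2" by simp
  then show ?thesis by (rule power2_le_imp_le) simp
qed

lemma orth_proj_best: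
  assumes E: "orthonormal E" and y: "y \<in> span E"
  shows "norm (x - orth_proj E x) \<le> norm (x - y)"
proof -
  have "orth_proj E x - y = orth_proj E (x - y)"
    using orth_proj_span[OF E y] by (simp add: orth_proj_diff)
  then have "inner (x - orth_proj E x) (orth_proj E x - y) = 0"
    using orth_proj_orthogonal[OF E] by simp
  then have "(norm (x - y))\<^sup>2 = (norm (x - orth_proj E x))\<^sup>2 + (norm (orth_proj E x - y))\<^sup>2"
    using norm_add_Pythagorean[of "x - orth_proj E x" "orth_proj E x - y"]
    unfolding orthogonal_def by simp
  then have "(norm (x - orth_proj E x))\<^sup>2 \<le> (norm (x - y))\<^sup>2" by simp
  then show ?thesis by (rule power2_le_imp_le) simp
qed

lemma orthonormal_basis_exists:
  fixes B :: "'a::real_inner set"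
  assumes "finite B"
  shows "\<exists>E. orthonormal E \<and> span E = span B"
proof -
  obtain C where C: "finite C" "span C = span B" "pairwise orthogonal C"
    using basis_orthogonal[OF assms] by auto
  define E where "E = (\<lambda>c. c /\<^sub>R norm c) ` (C - {0})"
  have "inner (c /\<^sub>R norm c) (d /\<^sub>R norm d) = (if c /\<^sub>R norm c = d /\<^sub>R norm d then 1 else 0)"
    if cd: "c \<in> C - {0}" "d \<in> C - {0}" for c d
  proof (cases "c = d")
    case True
    then show ?thesis using cd by (simp add: dot_square_norm power2_eq_square)
  next
    case False
    then have 0: "inner (c /\<^sub>R norm c) (d /\<^sub>R norm d) = 0"
      using C(3) cd by (auto simp: pairwise_def orthogonal_def)
    have "inner (c /\<^sub>R norm c) (c /\<^sub>R norm c) = 1"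
      using cd by (simp add: dot_square_norm power2_eq_square)
    then show ?thesis using 0 by metis
  qed
  then have on: "orthonormal E" using C(1) by (auto simp: orthonormal_def E_def)
  have "span E = span C"
  proof (rule span_eq[THEN iffD2], safe)
    fix e assume "e \<in> E"
    then obtain c where "c \<in> C" "e = c /\<^sub>R norm c" by (auto simp: E_def)
    then show "e \<in> span C" by (simp add: span_base span_scale)
  next
    fix c assume c: "c \<in> C"
    show "c \<in> span E"
    proof (cases "c = 0")
      case True then show ?thesis by (simp add: span_zero)
    next
      case False
      then have "c /\<^sub>R norm c \<in> span E" using c by (intro span_base) (auto simp: E_def)
      then have "norm c *\<^sub>R (c /\<^sub>R norm c) \<in> span E" by (rule span_scale)
      then show ?thesis using False by simp
    qed
  qed
  then show ?thesis using on C by auto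
qed

text \<open>The spans of the first points of a countable dense set increase and come arbitrarily
  close to every point; \<open>orth_proj_best\<close> turns closeness of the span into convergence
  of the projections.\<close>

lemma orth_proj_sequence:
  obtains E :: "nat \<Rightarrow> 'a::{real_inner, second_countable_topology} set"
  where "\<And>n. orthonormal (E n)" "\<And>x. (\<lambda>n. orth_proj (E n) x) \<longlonglongrightarrow> x"
proof -
  obtain D :: "'a set" where D: "countable D" "\<And>X. open X \<Longrightarrow> X \<noteq> {} \<Longrightarrow> \<exists>d\<in>D. d \<in> X"
    using countable_dense_exists by metis
  have "D \<noteq> {}" using D(2)[of UNIV] by auto
  define B where "B n = from_nat_into D ` {..n}" for n
  have "\<forall>n. \<exists>E. orthonormal E \<and> span E = span (B n)"
    by (auto simp: B_def intro!: orthonormal_basis_exists)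
  then obtain E where E: "\<And>n. orthonormal (E n)" "\<And>n. span (E n) = span (B n)" by metis
  have "(\<lambda>n. orth_proj (E n) x) \<longlonglongrightarrow> x" for x
  proof (rule metric_LIMSEQ_I)
    fix r :: real assume "r > 0"
    then obtain d where d: "d \<in> D" "d \<in> ball x r"
      using D(2)[of "ball x r"] by auto
    obtain m where m: "from_nat_into D m = d"
      using from_nat_into_surj[OF D(1) d(1)] by auto
    have "dist (orth_proj (E n) x) x < r" if "n \<ge> m" for n
    proof -
      have "d \<in> span (E n)" unfolding E(2) using m that by (intro span_base) (auto simp: B_def)
      then have "norm (x - orth_proj (E n) x) \<le> norm (x - d)" by (rule orth_proj_best[OF E(1)])
      then show ?thesis using d(2) by (simp add: dist_norm norm_minus_commute)
    qed
    then show "\<exists>no. \<forall>n\<ge>no. dist (orth_proj (E n) x) x < r" by blast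
  qed
  then show ?thesis using that E(1) by blast
qed

text \<open>The addition formulas make this class an algebra, as Stone-Weierstrass demands, and the
  integral of each member is a linear combination of real and imaginary parts of the characteristic
  function.\<close>

inductive trig_poly :: "('a::real_inner \<Rightarrow> real) \<Rightarrow> bool" where
  cos: "trig_poly (\<lambda>y. cos (inner x y))"
| sin: "trig_poly (\<lambda>y. sin (inner x y))"
| add: "trig_poly f \<Longrightarrow> trig_poly g \<Longrightarrow> trig_poly (\<lambda>y. f y + g y)"
| scale: "trig_poly f \<Longrightarrow> trig_poly (\<lambda>y. c * f y)"

lemma trig_poly_const: "trig_poly (\<lambda>_. c)"
  using trig_poly.scale[OF trig_poly.cos[of 0], of c] by simp

lemma trig_poly_mult_cos: "trig_poly g \<Longrightarrow> trig_poly (\<lambda>y. cos (inner x y) * g y)"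
proof (induction rule: trig_poly.induct)
  case (cos z)
  have "trig_poly (\<lambda>y. (1/2) * cos (inner (x - z) y) + (1/2) * cos (inner (x + z) y))"
    by (intro trig_poly.intros)
  then show ?case by (simp add: cos_times_cos inner_diff_left inner_add_left add_divide_distrib)
next
  case (sin z)
  have "trig_poly (\<lambda>y. (1/2) * sin (inner (x + z) y) + (-1/2) * sin (inner (x - z) y))"
    by (intro trig_poly.intros)
  then show ?case by (simp add: cos_times_sin inner_diff_left inner_add_left diff_divide_distrib)
next
  case (add f g)
  then show ?case using trig_poly.add by (simp only: distrib_left)
next
  case (scale f c)
  then show ?case using trig_poly.scale[OF scale.IH, of c] by (simp only: mult.left_commute)
qed

lemma trig_poly_mult_sin: "trig_poly g \<Longrightarrow> trig_poly (\<lambda>y. sin (inner x y) * g y)"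
proof (induction rule: trig_poly.induct)
  case (cos z)
  have "trig_poly (\<lambda>y. (1/2) * sin (inner (x + z) y) + (1/2) * sin (inner (x - z) y))"
    by (intro trig_poly.intros)
  then show ?case by (simp only: sin_times_cos inner_diff_left inner_add_left) (simp add: add_divide_distrib)
next
  case (sin z)
  have "trig_poly (\<lambda>y. (1/2) * cos (inner (x - z) y) + (-1/2) * cos (inner (x + z) y))"
    by (intro trig_poly.intros)
  then show ?case by (simp add: sin_times_sin inner_diff_left inner_add_left diff_divide_distrib)
next
  case (add f g)
  then show ?case using trig_poly.add by (simp only: distrib_left)
next
  case (scale f c)
  then show ?case using trig_poly.scale[OF scale.IH, of c] by (simp only: mult.left_commute)
qed

lemma trig_poly_mult: "trig_poly f \<Longrightarrow> trig_poly g \<Longrightarrow> trig_poly (\<lambda>y. f y * g y)"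
proof (induction rule: trig_poly.induct)
  case (add f h)
  then show ?case using trig_poly.add[OF add.IH] by (simp add: distrib_right)
next
  case (scale f c)
  then show ?case using trig_poly.scale[OF scale.IH, of c] by (simp only: mult.assoc)
qed (auto intro: trig_poly_mult_cos trig_poly_mult_sin)

text \<open>Supplies the compact domain for Stone-Weierstrass, because sines of coordinates take
  values in this cube. One coordinate is added at a time, as a continuous image of a product of
  compact sets.\<close>

lemma compact_finite_cube:
  assumes "finite E"
  shows "compact ((\<lambda>s. \<Sum>e\<in>E. s e *\<^sub>R (e::'a::real_normed_vector)) ` (E \<rightarrow> {-1..1::real}))"
  using assms
proof (induction E)
  case empty
  show ?case by (rule finite_imp_compact) (simp add: image_constant_conv)
next
  case (insert e E)
  let ?K = "(\<lambda>s. \<Sum>e\<in>E. s e *\<^sub>R e) ` (E \<rightarrow> {-1..1::real})"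
  have "compact ((\<lambda>(r, x). r *\<^sub>R e + x) ` ({-1..1::real} \<times> ?K))"
    by (intro compact_continuous_image compact_Times insert compact_Icc)
       (auto simp: split_beta' intro!: continuous_intros)
  also have "(\<lambda>(r, x). r *\<^sub>R e + x) ` ({-1..1::real} \<times> ?K) =
     (\<lambda>s. \<Sum>e\<in>insert e E. s e *\<^sub>R e) ` (insert e E \<rightarrow> {-1..1})" (is "?L = ?R")
  proof safe
    fix r :: real and s assume r: "r \<in> {-1..1}" and s: "s \<in> E \<rightarrow> {-1..1::real}"
    show "r *\<^sub>R e + (\<Sum>e\<in>E. s e *\<^sub>R e) \<in> ?R"
    proof (rule image_eqI[of _ _ "s(e := r)"])
      have "(\<Sum>x\<in>E. (s(e := r)) x *\<^sub>R x) = (\<Sum>e\<in>E. s e *\<^sub>R e)"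
        using insert by (intro sum.cong) auto
      then show "r *\<^sub>R e + (\<Sum>e\<in>E. s e *\<^sub>R e) = (\<Sum>x\<in>insert e E. (s(e := r)) x *\<^sub>R x)"
        using insert by simp
      show "s(e := r) \<in> insert e E \<rightarrow> {-1..1}" using r s by auto
    qed
  next
    fix s assume s: "s \<in> insert e E \<rightarrow> {-1..1::real}"
    show "(\<Sum>e\<in>insert e E. s e *\<^sub>R e) \<in> ?L"
      using insert s by (intro image_eqI[of _ _ "(s e, \<Sum>e\<in>E. s e *\<^sub>R e)"]) auto
  qed
  finally show ?case .
qed

text \<open>A bounded continuous \<open>f\<close> is reached from trigonometric polynomials by three limits: on a finite
  dimensional subspace \<open>f\<close> is the limit of \<open>f\<close> composed with \<open>N sin (\<sqdot> / N)\<close> in each coordinate, and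
  these are uniform limits of polynomials in sines since the coordinates range over a cube.\<close>

lemma trig_monotone_class:
  fixes f :: "'a::{real_inner, second_countable_topology} \<Rightarrow> real"
  assumes trig: "\<And>g. trig_poly g \<Longrightarrow> \<Phi> g"
    and lim: "\<And>g h B. (\<And>n::nat. \<Phi> (g n)) \<Longrightarrow> (\<And>n y. \<bar>g n y\<bar> \<le> B) \<Longrightarrow>
       (\<And>y. (\<lambda>n. g n y) \<longlonglongrightarrow> h y) \<Longrightarrow> \<Phi> h"
    and f: "continuous_on UNIV f" "\<And>y. \<bar>f y\<bar> \<le> B"
  shows "\<Phi> f"
proof -
  have lim_f: "(\<lambda>n. f (X n)) \<longlonglongrightarrow> f x" if "X \<longlonglongrightarrow> x" for X x
    by (rule continuous_on_tendsto_compose[OF f(1) that]) auto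
  have step1: "\<Phi> (\<lambda>y. f (N *\<^sub>R (\<Sum>e\<in>E. sin (inner e y / N) *\<^sub>R e)))"
    if E: "orthonormal E" and N: "N > 0" for E and N :: real
  proof -
    define T where "T y = (\<Sum>e\<in>E. sin (inner e y / N) *\<^sub>R e)" for y
    define K where "K = (\<lambda>s. \<Sum>e\<in>E. s e *\<^sub>R e) ` (E \<rightarrow> {-1..1::real})"
    \<comment> \<open>Functions on the cube whose composition with \<open>T\<close> is a
      trigonometric polynomial. The coordinate functionals become sines under \<open>T\<close>, so
      they belong to \<open>R\<close> and separate the points of the cube.\<close>
    define R where "R = {g. continuous_on K g \<and> trig_poly (\<lambda>y. g (T y))}"
    have T: "T y \<in> K" for y by (auto simp: T_def K_def)
    interpret function_ring_on R K
    proof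
      show "compact K" unfolding K_def by (rule compact_finite_cube[OF orthonormal_finite[OF E]])
      fix x y assume xy: "x \<in> K" "y \<in> K" "x \<noteq> y"
      obtain s r where s: "x = (\<Sum>e\<in>E. s e *\<^sub>R e)" "y = (\<Sum>e\<in>E. r e *\<^sub>R e)"
        using xy by (auto simp: K_def)
      obtain e where e: "e \<in> E" "s e \<noteq> r e"
      proof -
        have "x = y" if "\<forall>e\<in>E. s e = r e" using that s by simp
        then show ?thesis using that xy(3) by blast
      qed
      have "inner e x \<noteq> inner e y" using e s by (simp add: inner_orthonormal_sum[OF E])
      moreover have "inner e (T y) = sin (inner (e /\<^sub>R N) y)" for y
        unfolding T_def by (simp add: inner_orthonormal_sum[OF E e(1)] divide_inverse mult.commute)
      then have "trig_poly (\<lambda>y. inner e (T y))" using trig_poly.sin[of "e /\<^sub>R N"] by simp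
      then have "inner e \<in> R" by (auto simp: R_def intro!: continuous_intros)
      ultimately show "\<exists>f\<in>R. f x \<noteq> f y" by blast
    qed (auto simp: R_def intro!: trig_poly.intros trig_poly_mult trig_poly_const continuous_intros)
    have cf: "continuous_on K (\<lambda>x. f (N *\<^sub>R x))"
      by (rule continuous_on_compose2[OF f(1)]) (auto intro!: continuous_intros)
    have "\<exists>g\<in>R. \<forall>x\<in>K. \<bar>f (N *\<^sub>R x) - g x\<bar> < 1 / Suc n" for n
      using Stone_Weierstrass_basic[OF cf, of "1 / Suc n"] by simp
    then obtain g where g: "\<And>n. g n \<in> R" "\<And>n x. x \<in> K \<Longrightarrow> \<bar>f (N *\<^sub>R x) - g n x\<bar> < 1 / Suc n"
      by metis
    show ?thesis
      unfolding T_def[symmetric]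
    \<comment> \<open>The approximation errors 1/(n+1) are at most 1, hence the common bound
      \<open>B + 1\<close>.\<close>
    proof (rule lim[where g = "\<lambda>n y. g n (T y)" and B = "B + 1"])
      show "\<Phi> (\<lambda>y. g n (T y))" for n using g(1)[of n] by (intro trig) (simp add: R_def)
      show "\<bar>g n (T y)\<bar> \<le> B + 1" for n y
      proof -
        have "1 / real (Suc n) \<le> 1" by simp
        then show ?thesis
          using g(2)[OF T[of y], of n] f(2)[of "N *\<^sub>R T y"] by linarith
      qed
      show "(\<lambda>n. g n (T y)) \<longlonglongrightarrow> f (N *\<^sub>R T y)" for y
      proof (rule LIM_zero_cancel, rule Lim_null_comparison)
        show "(\<lambda>n. 1 / real (Suc n)) \<longlonglongrightarrow> 0" by (rule LIMSEQ_Suc[OF lim_1_over_n])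
        show "\<forall>\<^sub>F n in sequentially. norm (g n (T y) - f (N *\<^sub>R T y)) \<le> 1 / real (Suc n)"
          using g(2)[OF T[of y]]
          by (intro always_eventually allI) (simp add: abs_minus_commute less_imp_le)
      qed
    qed
  qed
  have step2: "\<Phi> (\<lambda>y. f (orth_proj E y))" if E: "orthonormal E" for E
  proof (rule lim)
    show "\<Phi> (\<lambda>y. f (real (Suc n) *\<^sub>R (\<Sum>e\<in>E. sin (inner e y / real (Suc n)) *\<^sub>R e)))" for n
      by (rule step1[OF E]) simp
    have *: "(\<lambda>n. real (Suc n) * sin (a / real (Suc n))) \<longlonglongrightarrow> a" for a :: real
    proof (cases "a = 0")
      case False
      have "(\<lambda>n. a / real (Suc n)) \<longlonglongrightarrow> 0"
        by (rule LIMSEQ_Suc[of "\<lambda>n. a / real n"]) (rule lim_const_over_n)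
      then have "filterlim (\<lambda>n. a / real (Suc n)) (at 0) sequentially"
        using False by (auto simp: filterlim_at)
      then have "(\<lambda>n. sin (a / real (Suc n)) / (a / real (Suc n))) \<longlonglongrightarrow> 1"
        by (rule filterlim_compose[rotated]) (rule sinc_at_0)
      then have "(\<lambda>n. a * (sin (a / real (Suc n)) / (a / real (Suc n)))) \<longlonglongrightarrow> a * 1"
        by (intro tendsto_intros)
      then show ?thesis using False by (simp add: mult.commute)
    qed simp
    show "(\<lambda>n. f (real (Suc n) *\<^sub>R (\<Sum>e\<in>E. sin (inner e y / real (Suc n)) *\<^sub>R e))) \<longlonglongrightarrow> f (orth_proj E y)" for y
      unfolding orth_proj_def scaleR_sum_right scaleR_scaleR
      by (intro lim_f tendsto_sum tendsto_scaleR tendsto_const *)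
  qed (rule f(2))
  obtain E :: "nat \<Rightarrow> 'a set" where E: "\<And>n. orthonormal (E n)" "\<And>x. (\<lambda>n. orth_proj (E n) x) \<longlonglongrightarrow> x"
    by (rule orth_proj_sequence) blast
  show ?thesis
    by (rule lim[OF step2[OF E(1)]]) (auto intro: f(2) lim_f E(2))
qed

section \<open>Characteristic functions and Gaussian components\<close>

definition prob_borel :: "'a::topological_space measure \<Rightarrow> bool" where
  "prob_borel M \<longleftrightarrow> prob_space M \<and> sets M = sets borel"

definition char_fun :: "'a::real_inner measure \<Rightarrow> 'a \<Rightarrow> complex" where
  "char_fun M x = (\<integral>y. iexp (inner x y) \<partial>M)"

lemma prob_borelD:
  assumes "prob_borel M"
  shows "prob_space M" "sets M = sets borel" "space M = UNIV" "finite_measure M" "sigma_finite_measure M"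
proof -
  show 1: "prob_space M" and 2: "sets M = sets borel" using assms by (auto simp: prob_borel_def)
  show "space M = UNIV" using sets_eq_imp_space_eq[OF 2] by simp
  interpret prob_space M by fact
  show "finite_measure M" "sigma_finite_measure M" by unfold_locales
qed

lemma prob_borel_integrable:
  fixes f :: "'a::topological_space \<Rightarrow> 'b::{banach, second_countable_topology}"
  assumes M: "prob_borel M" and f: "f \<in> borel_measurable borel" "\<And>y. norm (f y) \<le> B"
  shows "integrable M f"
proof -
  interpret prob_space M using prob_borelD[OF M] by simp
  show ?thesis
    using f prob_borelD(2)[OF M]
    by (intro integrable_const_bound[of _ B]) (auto cong: measurable_cong_sets)
qed

lemma prob_borel_integral_le:
  assumes M: "prob_borel M" and "\<And>y. \<bar>f y\<bar> \<le> (B::real)"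
  shows "\<bar>\<integral>y. f y \<partial>M\<bar> \<le> B"
proof -
  interpret prob_space M using prob_borelD[OF M] by simp
  have B: "0 \<le> B" using assms(2)[of undefined] by linarith
  show ?thesis
  proof (cases "integrable M f")
    case True
    then have "\<bar>\<integral>y. f y \<partial>M\<bar> \<le> (\<integral>y. \<bar>f y\<bar> \<partial>M)"
      using integral_norm_bound[of M f] by simp
    also have "\<dots> \<le> (\<integral>y. B \<partial>M)"
      using True assms(2) by (intro integral_mono) auto
    finally show ?thesis by (simp add: prob_space)
  next
    case False
    then show ?thesis using B by (simp add: not_integrable_integral_eq)
  qed
qed

lemma prob_borel_distr:
  assumes "prob_space M" "T \<in> borel_measurable M"
  shows "prob_borel (distr M borel T)"
  using assms prob_space.prob_space_distr[of M T borel] by (simp add: prob_borel_def)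

lemma integral_distr_borel:
  fixes f :: "'b::topological_space \<Rightarrow> 'c::{banach, second_countable_topology}"
  assumes "prob_borel M" "T \<in> borel_measurable borel" "f \<in> borel_measurable borel"
  shows "(\<integral>y. f y \<partial>distr M borel T) = (\<integral>y. f (T y) \<partial>M)"
  using assms prob_borelD(2)[OF assms(1)]
  by (intro integral_distr) (auto cong: measurable_cong_sets)

lemma iexp_inner_measurable [measurable]:
  "(\<lambda>y::'a::{real_inner, second_countable_topology}. iexp (inner x y)) \<in> borel_measurable borel"
  by (intro borel_measurable_continuous_onI continuous_intros)

lemma char_fun_integrable:
  fixes M :: "'a::{real_inner, second_countable_topology} measure"
  assumes M: "prob_borel M"
  shows "integrable M (\<lambda>y. iexp (inner x y))"
  by (rule prob_borel_integrable[OF M iexp_inner_measurable, of _ 1]) simp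

lemma trig_poly_continuous: "trig_poly f \<Longrightarrow> continuous_on A f"
  by (induction rule: trig_poly.induct) (auto intro!: continuous_intros)

lemma trig_poly_bounded: "trig_poly f \<Longrightarrow> \<exists>B. \<forall>y. \<bar>f y\<bar> \<le> B"
proof (induction rule: trig_poly.induct)
  case (cos x) then show ?case by (intro exI[of _ 1]) simp
next
  case (sin x) then show ?case by (intro exI[of _ 1]) simp
next
  case (add f g)
  then obtain B C where "\<And>y. \<bar>f y\<bar> \<le> B" "\<And>y. \<bar>g y\<bar> \<le> C" by blast
  then have "\<bar>f y + g y\<bar> \<le> B + C" for y by (meson abs_triangle_ineq add_mono order_trans)
  then show ?case by blast
next
  case (scale f c)
  then obtain B where "\<And>y. \<bar>f y\<bar> \<le> B" by blast
  then have "\<bar>c * f y\<bar> \<le> \<bar>c\<bar> * B" for y by (simp add: abs_mult mult_left_mono)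
  then show ?case by blast
qed

lemma trig_poly_integrable:
  fixes M :: "'a::{real_inner, second_countable_topology} measure"
  assumes M: "prob_borel M" and f: "trig_poly f"
  shows "integrable M f"
proof -
  obtain B where "\<And>y. \<bar>f y\<bar> \<le> B" using trig_poly_bounded[OF f] by blast
  then show ?thesis
    by (intro prob_borel_integrable[OF M, of _ B] borel_measurable_continuous_onI trig_poly_continuous f) simp
qed

lemma integral_cos_char_fun:
  fixes M :: "'a::{real_inner, second_countable_topology} measure"
  assumes M: "prob_borel M"
  shows "(\<integral>y. cos (inner x y) \<partial>M) = Re (char_fun M x)" "(\<integral>y. sin (inner x y) \<partial>M) = Im (char_fun M x)"
  using char_fun_integrable[OF M, of x]
  by (simp_all add: char_fun_def flip: integral_Re integral_Im)
     (simp_all add: Re_exp Im_exp)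

text \<open>For cosines and sines the integral is the real or imaginary part of the characteristic
  function, and measurability in the parameter passes to linear combinations and, by dominated
  convergence, to bounded limits. Nothing is assumed about the dependence of \<open>K t\<close> on t
  except through its characteristic function.\<close>

lemma kernel_integral_measurable:
  fixes K :: "'b \<Rightarrow> 'a::{real_inner, second_countable_topology} measure" and f :: "'a \<Rightarrow> real"
  assumes K: "\<And>t. t \<in> space N \<Longrightarrow> prob_borel (K t)"
    and char: "\<And>x. (\<lambda>t. char_fun (K t) x) \<in> borel_measurable N"
    and f: "continuous_on UNIV f" "\<And>y. \<bar>f y\<bar> \<le> B"
  shows "(\<lambda>t. \<integral>y. f y \<partial>K t) \<in> borel_measurable N"
proof -
  \<comment> \<open>Borel measurability of \<open>g\<close> is carried along because dominated
    convergence asks for it at each limit.\<close>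
  let ?\<Phi> = "\<lambda>g. g \<in> borel_measurable borel \<and> (\<lambda>t. \<integral>y. g y \<partial>K t) \<in> borel_measurable N"
  have "?\<Phi> f"
  proof (rule trig_monotone_class[where \<Phi> = ?\<Phi>, OF _ _ f])
    fix g :: "'a \<Rightarrow> real" assume "trig_poly g"
    then have "(\<lambda>t. \<integral>y. g y \<partial>K t) \<in> borel_measurable N"
    proof (induction rule: trig_poly.induct)
      case (cos x)
      have "(\<lambda>t. Re (char_fun (K t) x)) \<in> borel_measurable N" using char[of x] by measurable
      then show ?case using integral_cos_char_fun[OF K] by (subst measurable_cong) auto
    next
      case (sin x)
      have "(\<lambda>t. Im (char_fun (K t) x)) \<in> borel_measurable N" using char[of x] by measurable
      then show ?case using integral_cos_char_fun[OF K] by (subst measurable_cong) auto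
    next
      case (add f g)
      have "(\<lambda>t. (\<integral>y. f y \<partial>K t) + (\<integral>y. g y \<partial>K t)) \<in> borel_measurable N"
        using add.IH by measurable
      then show ?case
        using trig_poly_integrable[OF K] add.hyps by (subst measurable_cong) auto
    next
      case (scale f c)
      then show ?case by simp
    qed
    moreover have "g \<in> borel_measurable borel"
      using trig_poly_continuous[OF \<open>trig_poly g\<close>] by (rule borel_measurable_continuous_onI)
    ultimately show "?\<Phi> g" by blast
  next
    fix g :: "nat \<Rightarrow> 'a \<Rightarrow> real" and h :: "'a \<Rightarrow> real" and B
    assume g: "\<And>n. ?\<Phi> (g n)" "\<And>n y. \<bar>g n y\<bar> \<le> B" "\<And>y. (\<lambda>n. g n y) \<longlonglongrightarrow> h y"
    have h: "h \<in> borel_measurable borel"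
      by (rule borel_measurable_LIMSEQ_real[where u = g]) (use g in auto)
    have "(\<lambda>n. \<integral>y. g n y \<partial>K t) \<longlonglongrightarrow> (\<integral>y. h y \<partial>K t)" if t: "t \<in> space N" for t
    proof -
      note K' = K[OF t]
      interpret prob_space "K t" using prob_borelD[OF K'] by simp
      show ?thesis
        using g h prob_borelD(2)[OF K']
        by (intro integral_dominated_convergence[where w = "\<lambda>_. B"]) (auto cong: measurable_cong_sets)
    qed
    then have "(\<lambda>t. \<integral>y. h y \<partial>K t) \<in> borel_measurable N"
      by (rule borel_measurable_LIMSEQ_real) (use g(1) in auto)
    then show "?\<Phi> h" using h by blast
  qed
  then show ?thesis by blast
qed

text \<open>The two measures form a kernel over the two-point space with trivial sigma-algebra, and a
  function that is measurable there is constant.\<close>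

lemma char_fun_unique:
  fixes M :: "'a::{real_inner, second_countable_topology} measure" and f :: "'a \<Rightarrow> real"
  assumes M: "prob_borel M" and N: "prob_borel N" and char: "\<And>x. char_fun M x = char_fun N x"
    and f: "continuous_on UNIV f" "\<And>y. \<bar>f y\<bar> \<le> B"
  shows "(\<integral>y. f y \<partial>M) = (\<integral>y. f y \<partial>N)"
proof -
  define T where "T = sigma (UNIV :: bool set) {}"
  define K where "K b = (if b then M else N)" for b
  have "(\<lambda>b. \<integral>y. f y \<partial>K b) \<in> borel_measurable T"
  proof (rule kernel_integral_measurable[OF _ _ f])
    show "prob_borel (K b)" for b using M N by (simp add: K_def)
    have "(\<lambda>b. char_fun (K b) x) = (\<lambda>_. char_fun M x)" for x by (auto simp: K_def char)
    then show "(\<lambda>b. char_fun (K b) x) \<in> borel_measurable T" for x by simp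
  qed
  then have "(\<lambda>b. \<integral>y. f y \<partial>K b) -` {\<integral>y. f y \<partial>M} \<inter> space T \<in> sets T"
    by (rule measurable_sets) simp
  moreover have "sets T = {{}, UNIV}" by (simp add: T_def sigma_sets_empty_eq)
  moreover have "True \<in> (\<lambda>b. \<integral>y. f y \<partial>K b) -` {\<integral>y. f y \<partial>M} \<inter> space T"
    by (simp add: K_def T_def)
  ultimately have "False \<in> (\<lambda>b. \<integral>y. f y \<partial>K b) -` {\<integral>y. f y \<partial>M}" by auto
  then show ?thesis by (simp add: K_def)
qed

section \<open>Convolutions and finite dimensional Gaussian measures\<close>

definition sum_law :: "'a::{real_inner, second_countable_topology} measure \<Rightarrow> 'a measure \<Rightarrow> 'a measure" where
  "sum_law M N = distr (M \<Otimes>\<^sub>M N) borel (\<lambda>(x, y). x + y)"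

lemma sum_law:
  fixes M N :: "'a::{real_inner, second_countable_topology} measure"
    and f :: "'a \<Rightarrow> 'b::{banach, second_countable_topology}"
  assumes M: "prob_borel M" and N: "prob_borel N"
  shows prob_borel_sum_law: "prob_borel (sum_law M N)"
    and integral_sum_law: "f \<in> borel_measurable borel \<Longrightarrow> (\<And>y. norm (f y) \<le> B) \<Longrightarrow>
      (\<integral>z. f z \<partial>sum_law M N) = (\<integral>x. \<integral>y. f (x + y) \<partial>N \<partial>M)"
proof -
  note [measurable_cong] = prob_borelD(2)[OF M] prob_borelD(2)[OF N]
  interpret M: prob_space M using prob_borelD[OF M] by simp
  interpret N: prob_space N using prob_borelD[OF N] by simp
  interpret P: pair_prob_space M N ..
  have [measurable]: "(\<lambda>(x, y). x + y) \<in> borel_measurable (M \<Otimes>\<^sub>M N)" by measurable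
  show "prob_borel (sum_law M N)"
    unfolding sum_law_def by (rule prob_borel_distr) (auto intro: P.prob_space_axioms)
  assume [measurable]: "f \<in> borel_measurable borel" and B: "\<And>y. norm (f y) \<le> B"
  have "integrable (M \<Otimes>\<^sub>M N) (\<lambda>(x, y). f (x + y))"
    by (rule P.integrable_const_bound[of _ B]) (auto simp: B)
  then have "(\<integral>x. \<integral>y. f (x + y) \<partial>N \<partial>M) = (\<integral>z. (case z of (x, y) \<Rightarrow> f (x + y)) \<partial>(M \<Otimes>\<^sub>M N))"
    by (rule P.integral_fst)
  also have "\<dots> = (\<integral>z. f z \<partial>sum_law M N)"
    unfolding sum_law_def by (subst integral_distr) (auto simp: split_beta')
  finally show "(\<integral>z. f z \<partial>sum_law M N) = (\<integral>x. \<integral>y. f (x + y) \<partial>N \<partial>M)" by simp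
qed

lemma char_fun_sum_law:
  fixes M N :: "'a::{real_inner, second_countable_topology} measure"
  assumes M: "prob_borel M" and N: "prob_borel N"
  shows "char_fun (sum_law M N) x = char_fun M x * char_fun N x"
proof -
  have "char_fun (sum_law M N) x = (\<integral>y. \<integral>z. iexp (inner x (y + z)) \<partial>N \<partial>M)"
    unfolding char_fun_def by (rule integral_sum_law[OF M N, of _ 1]) auto
  also have "\<dots> = (\<integral>y. iexp (inner x y) * char_fun N x \<partial>M)"
    by (simp add: inner_add_right distrib_left exp_add char_fun_def)
  finally show ?thesis by (simp add: char_fun_def)
qed

lemma char_fun_distr:
  fixes M :: "'a::{real_inner, second_countable_topology} measure"
    and T :: "'a \<Rightarrow> 'b::{real_inner, second_countable_topology}"
  assumes M: "prob_borel M" and T: "continuous_on UNIV T" "\<And>y. inner x (T y) = inner x' y"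
  shows "char_fun (distr M borel T) x = char_fun M x'"
  unfolding char_fun_def
  by (subst integral_distr_borel[OF M borel_measurable_continuous_onI[OF T(1)]]) (auto simp: T(2))

lemma prob_borel_std_normal: "prob_borel std_normal_distribution"
  using real_dist_normal_dist by (auto simp: prob_borel_def real_distribution_def)

definition normal_along :: "'a::real_normed_vector \<Rightarrow> 'a measure" where
  "normal_along l = distr std_normal_distribution borel (\<lambda>z. z *\<^sub>R l)"

lemma prob_borel_normal_along:
  "prob_borel (normal_along (l::'a::{real_normed_vector, second_countable_topology}))"
  unfolding normal_along_def
  by (rule prob_borel_distr) (use prob_borel_std_normal in \<open>auto simp: prob_borel_def\<close>)

lemma char_fun_normal_along:
  fixes l :: "'a::{real_inner, second_countable_topology}"
  shows "char_fun (normal_along l) x = of_real (exp (- (inner x l)\<^sup>2 / 2))"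
proof -
  have "char_fun (normal_along l) x = char std_normal_distribution (inner x l)"
    unfolding char_fun_def normal_along_def char_def
    by (subst integral_distr_borel[OF prob_borel_std_normal])
       (auto simp: mult.commute intro!: borel_measurable_continuous_onI continuous_intros)
  then show ?thesis by (simp add: char_std_normal_distribution)
qed

definition psd_form :: "('a::real_vector \<Rightarrow> 'a \<Rightarrow> real) \<Rightarrow> bool" where
  "psd_form Q \<longleftrightarrow> (\<forall>y. linear (\<lambda>x. Q x y)) \<and> (\<forall>x y. Q x y = Q y x) \<and> (\<forall>x. 0 \<le> Q x x)"

lemma psd_formD:
  assumes "psd_form Q"
  shows "Q (x + y) z = Q x z + Q y z" "Q (r *\<^sub>R x) z = r * Q x z"
    "Q z (x + y) = Q z x + Q z y" "Q z (r *\<^sub>R x) = r * Q z x" "Q x y = Q y x" "0 \<le> Q x x"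
proof -
  have sym: "Q x y = Q y x" for x y using assms by (auto simp: psd_form_def)
  have lin: "linear (\<lambda>x. Q x y)" for y using assms by (auto simp: psd_form_def)
  show 1: "Q (x + y) z = Q x z + Q y z" for x y z using linear_add[OF lin[of z]] by simp
  show 2: "Q (r *\<^sub>R x) z = r * Q x z" for r x z using linear_scale[OF lin[of z]] by simp
  show "Q z (x + y) = Q z x + Q z y" "Q z (r *\<^sub>R x) = r * Q z x"
    using 1[of x y z] 2[of r x z] sym by metis+
  show "Q x y = Q y x" by (rule sym)
  show "0 \<le> Q x x" using assms by (auto simp: psd_form_def)
qed

lemma psd_form_cauchy:
  assumes Q: "psd_form Q"
  shows "(Q x y)\<^sup>2 \<le> Q x x * Q y y"
proof -
  have exp: "0 \<le> Q x x + 2 * r * Q x y + r\<^sup>2 * Q y y" for r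
  proof -
    have "0 \<le> Q (x + r *\<^sub>R y) (x + r *\<^sub>R y)" by (rule psd_formD(6)[OF Q])
    then show ?thesis
      using psd_formD(5)[OF Q, of y x]
      by (simp add: psd_formD(1-4)[OF Q] power2_eq_square algebra_simps)
  qed
  show ?thesis
  proof (cases "Q y y = 0")
    case True
    have "Q x y = 0"
    proof (rule ccontr)
      assume "Q x y \<noteq> 0"
      \<comment> \<open>This value of \<open>r\<close> makes the expression bounded below in
        \<open>exp\<close> equal to -1.\<close>
      then show False using exp[of "- (Q x x + 1) / (2 * Q x y)"] True by (simp add: field_simps)
    qed
    then show ?thesis using True by simp
  next
    case False
    then have pos: "Q y y > 0" using psd_formD(6)[OF Q, of y] by simp
    have "0 \<le> Q x x - (Q x y)\<^sup>2 / Q y y"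
      using exp[of "- Q x y / Q y y"] pos by (simp add: power2_eq_square field_simps)
    then show ?thesis using pos by (simp add: field_simps)
  qed
qed

lemma orth_proj_insert:
  assumes "orthonormal (insert e E)" "e \<notin> E"
  shows "orth_proj (insert e E) x = inner e x *\<^sub>R e + orth_proj E x"
  using assms orthonormal_finite[OF assms(1)] by (simp add: orth_proj_def)

text \<open>Completing the square in the direction \<open>e\<close> leaves a form which does not see \<open>e\<close>. If
  \<open>Q e e = 0\<close> then \<open>Q _ e = 0\<close>, and division by zero makes the subtracted square vanish.\<close>

lemma gaussian_measure_exists:
  fixes Q :: "'a::{real_inner, second_countable_topology} \<Rightarrow> 'a \<Rightarrow> real"
  assumes "orthonormal E" "psd_form Q"
  shows "\<exists>G. prob_borel G \<and> (\<forall>x. char_fun G x = of_real (exp (- Q (orth_proj E x) (orth_proj E x))))"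
  using orthonormal_finite[OF assms(1)] assms
proof (induction E arbitrary: Q)
  case empty
  have "Q 0 0 = 0" using psd_formD(2)[OF empty(2), of 0 0] by simp
  then show ?case
    using prob_borel_normal_along[of 0] char_fun_normal_along[of 0]
    by (intro exI[of _ "normal_along 0"]) (auto simp: orth_proj_def)
next
  case (insert e E)
  note Q = insert.prems(2)
  have E: "orthonormal E" using insert.prems(1) by (auto simp: orthonormal_def)
  let ?P = "orth_proj (insert e E)"
  let ?d = "Q e e"
  define Q' where "Q' x y = Q x y - Q x e * Q y e / ?d" for x y
  have d0: "Q x e = 0" if "?d = 0" for x
    using psd_form_cauchy[OF Q, of x e] that by simp
  have "psd_form Q'"
    unfolding psd_form_def
  proof safe
    fix x y show "linear (\<lambda>x. Q' x y)"
      by (rule linearI) (auto simp: Q'_def psd_formD(1-4)[OF Q] algebra_simps add_divide_distrib)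
    show "Q' x y = Q' y x" using psd_formD(5)[OF Q, of x y] by (simp add: Q'_def)
    have "Q x e * Q x e / ?d \<le> Q x x"
    proof (cases "?d = 0")
      case True then show ?thesis using psd_formD(6)[OF Q, of x] by simp
    next
      case False
      then have "?d > 0" using psd_formD(6)[OF Q, of e] by simp
      then show ?thesis using psd_form_cauchy[OF Q, of x e] by (simp add: power2_eq_square field_simps)
    qed
    then show "0 \<le> Q' x x" by (simp add: Q'_def)
  qed
  note Q' = this
  have Q'e: "Q' e y = 0" for y
    using d0 psd_formD(5)[OF Q, of e y] by (cases "?d = 0") (auto simp: Q'_def)
  obtain G' where G': "prob_borel G'"
    "\<And>x. char_fun G' x = of_real (exp (- Q' (orth_proj E x) (orth_proj E x)))"
    using insert.IH[OF E Q'] by blast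
  \<comment> \<open>The factor sqrt (2 / d), with d = \<open>Q e e\<close>, makes the exponent
    \<open>(inner x l)\<^sup>2 / 2\<close> of \<open>normal_along l\<close> equal to the square
    removed from \<open>Q\<close> in \<open>Q'\<close>. Taking \<open>l\<close> in the span of
    \<open>insert e E\<close> makes it depend on the projection of \<open>x\<close> only.\<close>
  define l where "l = (\<Sum>b\<in>insert e E. (sqrt (2 / ?d) * Q b e) *\<^sub>R b)"
  have l: "inner x l = sqrt (2 / ?d) * Q (?P x) e" for x
  proof -
    have lin: "linear (\<lambda>x. Q x e)" using Q by (simp add: psd_form_def)
    have "Q (?P x) e = (\<Sum>b\<in>insert e E. inner b x * Q b e)"
      unfolding orth_proj_def linear_sum[OF lin] linear_scale[OF lin] by simp
    then show ?thesis
      by (simp add: l_def inner_sum_right sum_distrib_left inner_commute mult_ac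
               del: sum.insert sum.insert_if)
  qed
  have Q'P: "Q' (orth_proj E x) (orth_proj E x) = Q' (?P x) (?P x)" for x
    using Q'e psd_formD(1-4)[OF Q'] psd_formD(5)[OF Q', of _ e]
    by (simp add: orth_proj_insert[OF insert.prems(1) insert.hyps(2)])
  have char: "char_fun (sum_law G' (normal_along l)) x = of_real (exp (- Q (?P x) (?P x)))" for x
  proof -
    have "(inner x l)\<^sup>2 / 2 = Q (?P x) e * Q (?P x) e / ?d"
    proof -
      have "(sqrt (2 / ?d))\<^sup>2 = 2 / ?d" using psd_formD(6)[OF Q, of e] by simp
      then show ?thesis unfolding l power_mult_distrib by (simp add: power2_eq_square)
    qed
    then have "Q' (?P x) (?P x) + (inner x l)\<^sup>2 / 2 = Q (?P x) (?P x)" by (simp add: Q'_def)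
    then have "exp (- Q' (?P x) (?P x)) * exp (- (inner x l)\<^sup>2 / 2) = exp (- Q (?P x) (?P x))"
      by (simp flip: exp_add)
    then show ?thesis
      by (simp only: char_fun_sum_law[OF G'(1) prob_borel_normal_along] G'(2) Q'P
          char_fun_normal_along flip: of_real_mult)
  qed
  then show ?case using prob_borel_sum_law[OF G'(1) prob_borel_normal_along] by blast
qed

section \<open>Splitting off a one-dimensional Gaussian\<close>

lemma convolution_power_exists:
  fixes M :: "'a::{real_inner, second_countable_topology} measure"
  assumes M: "prob_borel M"
  shows "\<exists>N. prob_borel N \<and> (\<forall>x. char_fun N x = char_fun M x ^ n)"
proof (induction n)
  case 0
  then show ?case
    using prob_borel_normal_along[of 0] char_fun_normal_along[of 0]
    by (intro exI[of _ "normal_along 0"]) auto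
next
  case (Suc n)
  then obtain N where N: "prob_borel N" "\<And>x. char_fun N x = char_fun M x ^ n" by blast
  then show ?case
    using prob_borel_sum_law[OF M N(1)] char_fun_sum_law[OF M N(1)] by auto
qed

text \<open>The \<open>n\<close>-fold convolution of the image of \<open>M\<close> under \<open>x \<mapsto> n powr (- 1 / (2 * s)) *\<^sub>R x\<close> keeps the
  \<open>2s\<close>-homogeneous part of the exponent and shrinks the quadratic part by \<open>n powr (1 - 1 / s)\<close>. This isolates
  the Gaussian part of \<open>M\<close> although no independent construction of the stable part is available.\<close>

lemma small_gaussian_part:
  fixes M :: "'a::{real_inner, second_countable_topology} measure"
  assumes M: "prob_borel M" and s: "0 < s" "s < 1"
    and char: "\<And>x. char_fun M x = of_real (exp (- (q x + g x)))"
    and q: "\<And>a x. q (a *\<^sub>R x) = a\<^sup>2 * q x"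
    and g: "\<And>a x. 0 < a \<Longrightarrow> g (a *\<^sub>R x) = a powr (2 * s) * g x"
  obtains \<epsilon> N where "0 \<le> \<epsilon>" "\<epsilon> \<le> 1/2" "prob_borel N"
    "\<And>x. char_fun N x = of_real (exp (- (\<epsilon> * q x + g x)))"
proof -
  \<comment> \<open>The exponent 1 - 1/s is negative since s < 1, so high convolution powers leave
    as small a multiple of \<open>q\<close> as desired; one half suffices.\<close>
  have "((\<lambda>n. real n powr (1 - 1 / s)) \<longlongrightarrow> 0) sequentially"
    using s by (intro tendsto_neg_powr filterlim_real_sequentially) (simp add: field_simps)
  then have "\<forall>\<^sub>F n in sequentially. real n powr (1 - 1 / s) < 1/2"
    by (rule order_tendstoD) simp
  then have "\<forall>\<^sub>F n in sequentially. real n powr (1 - 1 / s) < 1/2 \<and> n \<ge> 1"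
    by (intro eventually_conj eventually_ge_at_top)
  then obtain n where n: "real n powr (1 - 1 / s) < 1/2" "n \<ge> 1"
    by (auto dest!: eventually_happens)
  define a where "a = real n powr (- 1 / (2 * s))"
  have a: "a > 0" using n by (simp add: a_def)
  have a1: "real n * a\<^sup>2 = real n powr (1 - 1 / s)"
  proof -
    have "a\<^sup>2 = real n powr (- 1 / s)"
      using n(2) s by (simp add: a_def power2_eq_square flip: powr_add)
    then show ?thesis using n(2) by (simp add: powr_diff powr_minus_divide)
  qed
  have a2: "real n * a powr (2 * s) = 1"
  proof -
    have "a powr (2 * s) = real n powr (- 1)" unfolding a_def powr_powr using s by simp
    then show ?thesis using n(2) by (simp add: powr_minus_divide)
  qed
  let ?M = "distr M borel (\<lambda>y. a *\<^sub>R y)"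
  have M': "prob_borel ?M"
    using prob_borelD[OF M] by (intro prob_borel_distr) (auto cong: measurable_cong_sets)
  have char': "char_fun ?M x = char_fun M (a *\<^sub>R x)" for x
    by (rule char_fun_distr[OF M]) (auto intro!: continuous_intros)
  obtain N where N: "prob_borel N" "\<And>x. char_fun N x = char_fun ?M x ^ n"
    using convolution_power_exists[OF M'] by blast
  have "char_fun N x = of_real (exp (- (real n powr (1 - 1 / s) * q x + g x)))" for x
  proof -
    have "real n * (q (a *\<^sub>R x) + g (a *\<^sub>R x)) = (real n * a\<^sup>2) * q x + (real n * a powr (2 * s)) * g x"
      unfolding q g[OF a] by (simp add: algebra_simps)
    also have "\<dots> = real n powr (1 - 1 / s) * q x + g x" by (simp add: a1 a2)
    finally have "exp (- (q (a *\<^sub>R x) + g (a *\<^sub>R x))) ^ n = exp (- (real n powr (1 - 1 / s) * q x + g x))"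
      by (simp only: exp_of_nat_mult[symmetric] mult_minus_right)
    then show ?thesis by (simp only: N(2) char' char flip: of_real_power)
  qed
  then show ?thesis using that[of "real n powr (1 - 1 / s)" N] n N(1) by simp
qed

text \<open>On the projection, the exponent of \<open>M\<close> is the sum of \<epsilon> Q + g, of a
  nonnegative form \<open>R\<close>, and of the exponent of a normal law along the projection of
  \<tau> k. Each summand belongs to a probability measure, so the laws agree by uniqueness of
  characteristic functions; \<rho> collects the first two.\<close>

lemma gaussian_direction_split:
  fixes M :: "'a::{real_inner, second_countable_topology} measure"
  assumes M: "prob_borel M" and s: "0 < s" "s < 1"
    and char: "\<And>x. char_fun M x = of_real (exp (- (Q x x + g x)))"
    and Q: "psd_form Q"
    and g: "\<And>a x. 0 < a \<Longrightarrow> g (a *\<^sub>R x) = a powr (2 * s) * g x"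
    and k: "\<And>x. \<tau>\<^sup>2 * (inner k x)\<^sup>2 \<le> Q x x"
    and E: "orthonormal E"
  obtains \<rho> where "prob_borel \<rho>" "\<And>f B. continuous_on UNIV f \<Longrightarrow> (\<And>y. \<bar>f y\<bar> \<le> (B::real)) \<Longrightarrow>
     (\<integral>y. f (orth_proj E y) \<partial>M) =
     (\<integral>y. \<integral>z. f (y + (\<tau> * z) *\<^sub>R orth_proj E k) \<partial>std_normal_distribution \<partial>\<rho>)"
proof -
  let ?P = "orth_proj E"
  have hom: "Q (a *\<^sub>R x) (a *\<^sub>R x) = a\<^sup>2 * Q x x" for a x
    by (simp add: psd_formD(2,4)[OF Q] power2_eq_square)
  obtain \<epsilon> N where \<epsilon>: "0 \<le> \<epsilon>" "\<epsilon> \<le> 1/2" and N: "prob_borel N"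
    "\<And>x. char_fun N x = of_real (exp (- (\<epsilon> * Q x x + g x)))"
    using small_gaussian_part[OF M s char hom g] by blast
  \<comment> \<open>As \<epsilon> is at most 1/2, at least half of \<open>Q\<close> remains to pay
    for the rank-one term. That term also carries 1/2, since a normal law of variance \<tau>^2 has
    exponent \<tau>^2/2, so the bound on \<open>k\<close> is exactly what makes \<open>R\<close>
    nonnegative.\<close>
  define R where "R x y = (1 - \<epsilon>) * Q x y - (\<tau>\<^sup>2 / 2) * (inner k x * inner k y)" for x y
  have R: "psd_form R"
    unfolding psd_form_def
  proof safe
    fix x y show "linear (\<lambda>x. R x y)"
      by (rule linearI) (simp_all add: R_def psd_formD(1-4)[OF Q] inner_add_right algebra_simps)
    show "R x y = R y x" using psd_formD(5)[OF Q, of x y] by (simp add: R_def)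
    have "(1/2) * (\<tau>\<^sup>2 * (inner k x)\<^sup>2) \<le> (1 - \<epsilon>) * Q x x"
      using \<epsilon> k[of x] by (intro mult_mono) auto
    then show "0 \<le> R x x" by (simp add: R_def power2_eq_square)
  qed
  obtain G where G: "prob_borel G" "\<And>x. char_fun G x = of_real (exp (- R (?P x) (?P x)))"
    using gaussian_measure_exists[OF E R] by blast
  have dist: "prob_borel (distr L borel ?P)" "char_fun (distr L borel ?P) x = char_fun L (?P x)"
    if "prob_borel L" for L :: "'a measure" and x
    using that prob_borelD[OF that]
    by (auto intro!: prob_borel_distr char_fun_distr borel_measurable_continuous_onI
        continuous_orth_proj simp: orth_proj_inner_commute cong: measurable_cong_sets)
  define \<rho> where "\<rho> = sum_law (distr N borel ?P) G"
  have \<rho>: "prob_borel \<rho>" unfolding \<rho>_def by (intro prob_borel_sum_law dist N G)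
  have char_\<rho>: "char_fun \<rho> x = char_fun N (?P x) * char_fun G x" for x
    unfolding \<rho>_def char_fun_sum_law[OF dist(1)[OF N(1)] G(1)] dist(2)[OF N(1)] ..
  note na = prob_borel_normal_along[of "\<tau> *\<^sub>R ?P k"]
  have eq: "char_fun (distr M borel ?P) x = char_fun (sum_law \<rho> (normal_along (\<tau> *\<^sub>R ?P k))) x" for x
  proof -
    have "inner x (\<tau> *\<^sub>R ?P k) = \<tau> * inner k (?P x)"
      by (simp add: inner_commute[of x] orth_proj_inner_commute)
    then have "(inner x (\<tau> *\<^sub>R ?P k))\<^sup>2 = \<tau>\<^sup>2 * (inner k (?P x))\<^sup>2" by (simp only: power_mult_distrib)
    then have "Q (?P x) (?P x) + g (?P x) =
        (\<epsilon> * Q (?P x) (?P x) + g (?P x)) + R (?P x) (?P x) + (inner x (\<tau> *\<^sub>R ?P k))\<^sup>2 / 2"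
      by (simp only: R_def) (simp add: power2_eq_square algebra_simps)
    then have "exp (- (Q (?P x) (?P x) + g (?P x))) =
        exp (- (\<epsilon> * Q (?P x) (?P x) + g (?P x))) * exp (- R (?P x) (?P x))
          * exp (- (inner x (\<tau> *\<^sub>R ?P k))\<^sup>2 / 2)"
      by (simp flip: exp_add)
    then show ?thesis
      by (simp only: dist(2)[OF M] char char_fun_sum_law[OF \<rho> na] char_\<rho> N(2) G(2) char_fun_normal_along
          flip: of_real_mult)
  qed
  show ?thesis
  proof (rule that[OF \<rho>])
    fix f :: "'a \<Rightarrow> real" and B assume f: "continuous_on UNIV f" "\<And>y. \<bar>f y\<bar> \<le> B"
    have [measurable]: "f \<in> borel_measurable borel" using f(1) by (rule borel_measurable_continuous_onI)
    have cont: "continuous_on UNIV (\<lambda>y. f (x + y))" for x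
      by (rule continuous_on_compose2[OF f(1)]) (auto intro!: continuous_intros)
    have "(\<integral>y. f (?P y) \<partial>M) = (\<integral>y. f y \<partial>distr M borel ?P)"
      by (rule integral_distr_borel[OF M, symmetric])
         (auto intro!: borel_measurable_continuous_onI continuous_orth_proj)
    also have "\<dots> = (\<integral>y. f y \<partial>sum_law \<rho> (normal_along (\<tau> *\<^sub>R ?P k)))"
      by (rule char_fun_unique[OF dist(1)[OF M] prob_borel_sum_law[OF \<rho> na] eq f])
    also have "\<dots> = (\<integral>y. \<integral>z. f (y + z) \<partial>normal_along (\<tau> *\<^sub>R ?P k) \<partial>\<rho>)"
      by (rule integral_sum_law[OF \<rho> na]) (use f in auto)
    also have "\<dots> = (\<integral>y. \<integral>z. f (y + (\<tau> * z) *\<^sub>R ?P k) \<partial>std_normal_distribution \<partial>\<rho>)"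
      unfolding normal_along_def
      by (subst integral_distr_borel[OF prob_borel_std_normal])
         (auto intro!: borel_measurable_continuous_onI continuous_intros cont simp: mult.commute)
    finally show "(\<integral>y. f (?P y) \<partial>M) =
      (\<integral>y. \<integral>z. f (y + (\<tau> * z) *\<^sub>R ?P k) \<partial>std_normal_distribution \<partial>\<rho>)" .
  qed
qed

section \<open>Smoothing by a one-dimensional Gaussian\<close>

abbreviation std_normal where "std_normal \<equiv> std_normal_distribution"

lemma std_normal_moments:
  "integrable std_normal (\<lambda>z. z)" "integrable std_normal (\<lambda>z. z\<^sup>2)"
  "(\<integral>z. z \<partial>std_normal) = 0" "(\<integral>z. z\<^sup>2 \<partial>std_normal) = 1"
  using integrable_std_normal_distribution_moment[of 1] integrable_std_normal_distribution_moment[of 2]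
    integral_std_normal_distribution_moment_odd[of 1] std_normal_distribution_even_moments(1)[of 1]
  by simp_all

lemma std_normal_const:
  "integrable std_normal (\<lambda>z. c::real)" "(\<integral>z. c \<partial>std_normal) = (c::real)"
  "measure std_normal UNIV = 1"
proof -
  interpret prob_space std_normal using prob_borelD[OF prob_borel_std_normal] by simp
  show "measure std_normal UNIV = 1" using prob_space by simp
  then show "integrable std_normal (\<lambda>z. c::real)" "(\<integral>z. c \<partial>std_normal) = (c::real)"
    by simp_all
qed

text \<open>The one-dimensional Cameron-Martin formula: the translate by \<delta> of the standard
  normal law has density exp (\<delta> z - \<delta>^2/2) with respect to it, by completing the
  square in the exponent.\<close>

lemma std_normal_shift:
  fixes g :: "real \<Rightarrow> real"
  assumes [measurable]: "g \<in> borel_measurable borel"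
  shows "integrable std_normal (\<lambda>z. g z * exp (\<delta> * z - \<delta>\<^sup>2 / 2)) \<longleftrightarrow>
      integrable std_normal (\<lambda>z. g (z + \<delta>))" (is ?A)
    and "(\<integral>z. g z * exp (\<delta> * z - \<delta>\<^sup>2 / 2) \<partial>std_normal) = (\<integral>z. g (z + \<delta>) \<partial>std_normal)" (is ?B)
proof -
  define F where "F z = std_normal_density z * (g z * exp (\<delta> * z - \<delta>\<^sup>2 / 2))" for z
  have F: "F (\<delta> + 1 * z) = std_normal_density z * g (z + \<delta>)" for z
  proof -
    have "- (\<delta> + z)\<^sup>2 / 2 + (\<delta> * (\<delta> + z) - \<delta>\<^sup>2 / 2) = - z\<^sup>2 / 2"
      by (simp add: power2_eq_square field_simps)
    then have "exp (- (\<delta> + z)\<^sup>2 / 2) * exp (\<delta> * (\<delta> + z) - \<delta>\<^sup>2 / 2) = exp (- z\<^sup>2 / 2)"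
      by (simp only: flip: exp_add)
    then show ?thesis by (simp add: F_def std_normal_density_def add.commute mult.left_commute)
  qed
  have [measurable]: "F \<in> borel_measurable borel" unfolding F_def by measurable
  have "integrable lborel F \<longleftrightarrow> integrable lborel (\<lambda>z. F (\<delta> + 1 * z))"
    using lborel_integrable_real_affine_iff[of 1 F \<delta>] by simp
  moreover have "(\<integral>z. F z \<partial>lborel) = (\<integral>z. F (\<delta> + 1 * z) \<partial>lborel)"
    using lborel_integral_real_affine[of 1 F \<delta>] by simp
  ultimately show ?A ?B
    unfolding F by (simp_all add: F_def[abs_def] integrable_density integral_density)
qed

text \<open>All six follow from \<open>std_normal_shift\<close> applied to the constant 1, the
  identity and \<open>w \<delta>\<close> itself; the last case uses that shifting
  \<open>w \<delta>\<close> by \<delta> multiplies it by exp (\<delta>^2).\<close>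

lemma std_normal_exp_moments:
  defines "w \<equiv> \<lambda>\<delta> z::real. exp (\<delta> * z - \<delta>\<^sup>2 / 2)"
  shows "integrable std_normal (w \<delta>)" "(\<integral>z. w \<delta> z \<partial>std_normal) = 1"
    "integrable std_normal (\<lambda>z. z * w \<delta> z)" "(\<integral>z. z * w \<delta> z \<partial>std_normal) = \<delta>"
    "integrable std_normal (\<lambda>z. w \<delta> z * w \<delta> z)" "(\<integral>z. w \<delta> z * w \<delta> z \<partial>std_normal) = exp (\<delta>\<^sup>2)"
proof -
  show 1: "integrable std_normal (w \<delta>)" and 2: "(\<integral>z. w \<delta> z \<partial>std_normal) = 1"
    using std_normal_shift[of "\<lambda>_. 1" \<delta>] std_normal_const(1,2)[of 1] by (simp_all add: w_def)
  have m0: "(\<lambda>z::real. z) \<in> borel_measurable borel" by simp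
  have i: "integrable std_normal (\<lambda>z. z + \<delta>)"
    by (intro Bochner_Integration.integrable_add std_normal_moments std_normal_const)
  have "(\<integral>z. z + \<delta> \<partial>std_normal) = \<delta>"
    by (subst Bochner_Integration.integral_add) (simp_all add: std_normal_moments std_normal_const)
  then show "integrable std_normal (\<lambda>z. z * w \<delta> z)" "(\<integral>z. z * w \<delta> z \<partial>std_normal) = \<delta>"
    unfolding w_def using std_normal_shift[OF m0, of \<delta>] i by (simp_all only:)
  have "\<delta> * (z + \<delta>) - \<delta>\<^sup>2 / 2 = \<delta>\<^sup>2 + (\<delta> * z - \<delta>\<^sup>2 / 2)" for z
    by (simp add: power2_eq_square distrib_left)
  then have w_exp: "exp (\<delta> * z - \<delta>\<^sup>2 / 2) = w \<delta> z"
    and w_shift: "w \<delta> (z + \<delta>) = exp (\<delta>\<^sup>2) * w \<delta> z" for z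
    by (simp_all only: w_def exp_add)
  have m: "w \<delta> \<in> borel_measurable borel" unfolding w_def by measurable
  have "integrable std_normal (\<lambda>z. w \<delta> (z + \<delta>))" "(\<integral>z. w \<delta> (z + \<delta>) \<partial>std_normal) = exp (\<delta>\<^sup>2)"
    unfolding w_shift using 1 2 by simp_all
  then show "integrable std_normal (\<lambda>z. w \<delta> z * w \<delta> z)" "(\<integral>z. w \<delta> z * w \<delta> z \<partial>std_normal) = exp (\<delta>\<^sup>2)"
    using std_normal_shift[OF m, of \<delta>] by (simp_all only: w_exp)
qed

lemma std_normal_abs_moment: "integrable std_normal (\<lambda>z. \<bar>z\<bar>)" "(\<integral>z. \<bar>z\<bar> \<partial>std_normal) \<le> 1"
proof -
  show i: "integrable std_normal (\<lambda>z. \<bar>z\<bar>)" using std_normal_moments(1) by simp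
  have "\<bar>z\<bar> \<le> (1 + z\<^sup>2) / 2" for z :: real
    using sum_squares_bound[of 1 "\<bar>z\<bar>"] by simp
  then have "(\<integral>z. \<bar>z\<bar> \<partial>std_normal) \<le> (\<integral>z. (1 + z\<^sup>2) / 2 \<partial>std_normal)"
    by (intro integral_mono i) (auto intro!: std_normal_moments std_normal_const)
  also have "\<dots> = 1" using std_normal_moments std_normal_const by simp
  finally show "(\<integral>z. \<bar>z\<bar> \<partial>std_normal) \<le> 1" .
qed

text \<open>For small \<open>\<delta>\<close> the \<open>L\<^sup>2\<close>-norm of the remainder is \<open>sqrt (exp \<delta>\<^sup>2 - 1 - \<delta>\<^sup>2) \<le> \<delta>\<^sup>2\<close>.\<close>

lemma std_normal_density_remainder:
  "integrable std_normal (\<lambda>z. \<bar>exp (\<delta> * z - \<delta>\<^sup>2 / 2) - 1 - \<delta> * z\<bar>)" (is ?A)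
  "(\<integral>z. \<bar>exp (\<delta> * z - \<delta>\<^sup>2 / 2) - 1 - \<delta> * z\<bar> \<partial>std_normal) \<le> 3 * \<delta>\<^sup>2" (is ?B)
proof -
  define w where "w z = exp (\<delta> * z - \<delta>\<^sup>2 / 2)" for z
  note w = std_normal_exp_moments[of \<delta>, folded w_def] and m = std_normal_moments std_normal_const
  define X where "X z = w z - 1 - \<delta> * z" for z
  have iX: "integrable std_normal X" unfolding X_def using w m by simp
  then show ?A using integrable_abs[OF iX] by (simp add: X_def w_def)
  have "(\<integral>z. \<bar>X z\<bar> \<partial>std_normal) \<le> 3 * \<delta>\<^sup>2"
  proof (cases "\<bar>\<delta>\<bar> \<le> 1")
    case True
    have X2: "(X z)\<^sup>2 = w z * w z + 1 + \<delta>\<^sup>2 * z\<^sup>2 - 2 * w z - 2 * \<delta> * (z * w z) + 2 * \<delta> * z" for z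
      by (simp add: X_def power2_eq_square algebra_simps)
    have iX2: "integrable std_normal (\<lambda>z. (X z)\<^sup>2)" unfolding X2 using w m by simp
    have "(\<integral>z. (X z)\<^sup>2 \<partial>std_normal) = exp (\<delta>\<^sup>2) - 1 - \<delta>\<^sup>2"
      unfolding X2 using w m by (simp add: power2_eq_square)
    also have "\<dots> \<le> (\<delta>\<^sup>2)\<^sup>2"
      using exp_bound[of "\<delta>\<^sup>2"] True by (simp add: abs_square_le_1)
    finally have EX2: "(\<integral>z. (X z)\<^sup>2 \<partial>std_normal) \<le> (\<delta>\<^sup>2)\<^sup>2" .
    show ?thesis
    proof (cases "\<delta> = 0")
      case True
      then show ?thesis by (simp add: X_def w_def)
    next
      case False
      \<comment> \<open>The weight \<delta>^2 in the arithmetic-geometric mean inequality converts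
        the second moment bound \<delta>^4 into a first moment bound of order \<delta>^2.\<close>
      have "\<bar>X z\<bar> \<le> ((X z)\<^sup>2 / \<delta>\<^sup>2 + \<delta>\<^sup>2) / 2" for z
      proof -
        have "2 * (\<bar>X z\<bar> / \<bar>\<delta>\<bar>) * \<bar>\<delta>\<bar> \<le> (\<bar>X z\<bar> / \<bar>\<delta>\<bar>)\<^sup>2 + \<bar>\<delta>\<bar>\<^sup>2" by (rule sum_squares_bound)
        then show ?thesis using False by (simp add: power_divide)
      qed
      then have "(\<integral>z. \<bar>X z\<bar> \<partial>std_normal) \<le> (\<integral>z. ((X z)\<^sup>2 / \<delta>\<^sup>2 + \<delta>\<^sup>2) / 2 \<partial>std_normal)"
        using iX iX2 m by (intro integral_mono) auto
      also have "\<dots> = ((\<integral>z. (X z)\<^sup>2 \<partial>std_normal) / \<delta>\<^sup>2 + \<delta>\<^sup>2) / 2" using iX2 m by simp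
      also have "\<dots> \<le> ((\<delta>\<^sup>2)\<^sup>2 / \<delta>\<^sup>2 + \<delta>\<^sup>2) / 2"
        using EX2 by (intro divide_right_mono add_right_mono) auto
      also have "\<dots> = \<delta>\<^sup>2" by (simp add: power2_eq_square)
      finally show ?thesis using zero_le_power2[of \<delta>] by linarith
    qed
  next
    case False
    \<comment> \<open>For large \<delta> the three terms are estimated separately, and 2 +
      \<bar>\<delta>\<bar> \<le> 3 \<delta>^2. This case fixes the constant 3.\<close>
    have "\<bar>X z\<bar> \<le> w z + 1 + \<bar>\<delta>\<bar> * \<bar>z\<bar>" for z
    proof -
      have "w z > 0" by (simp add: w_def)
      then show ?thesis unfolding X_def abs_mult[symmetric] by linarith
    qed
    then have "(\<integral>z. \<bar>X z\<bar> \<partial>std_normal) \<le> (\<integral>z. w z + 1 + \<bar>\<delta>\<bar> * \<bar>z\<bar> \<partial>std_normal)"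
      using iX w m std_normal_abs_moment by (intro integral_mono) auto
    also have "\<dots> = 2 + \<bar>\<delta>\<bar> * (\<integral>z. \<bar>z\<bar> \<partial>std_normal)"
      using w m std_normal_abs_moment by simp
    also have "\<dots> \<le> 2 + \<bar>\<delta>\<bar> * 1"
      by (intro add_left_mono mult_left_mono std_normal_abs_moment) auto
    also have "\<dots> \<le> 3 * \<delta>\<^sup>2"
    proof -
      have "\<bar>\<delta>\<bar> * 1 \<le> \<bar>\<delta>\<bar> * \<bar>\<delta>\<bar>" using False by (intro mult_left_mono) auto
      then show ?thesis using False by (simp add: power2_eq_square)
    qed
    finally show ?thesis .
  qed
  then show ?B by (simp add: X_def w_def)
qed

lemma std_normal_bounded_integrable:
  fixes g :: "real \<Rightarrow> real"
  assumes [measurable]: "g \<in> borel_measurable borel" and B: "\<And>z. \<bar>g z\<bar> \<le> B"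
    and h: "integrable std_normal h"
  shows "integrable std_normal (\<lambda>z. g z * h z)"
proof (rule Bochner_Integration.integrable_bound)
  show "integrable std_normal (\<lambda>z. B * h z)" using h by simp
  show "(\<lambda>z. g z * h z) \<in> borel_measurable std_normal"
    using borel_measurable_integrable[OF h] by measurable
  show "AE z in std_normal. norm (g z * h z) \<le> norm (B * h z)"
  proof (intro always_eventually allI)
    fix z
    have "0 \<le> B" using B[of 0] by linarith
    then show "norm (g z * h z) \<le> norm (B * h z)"
      using B[of z] by (simp add: abs_mult mult_right_mono)
  qed
qed

text \<open>After the shift is moved into the density, the Taylor expansion is that of the density
  alone: the remainder is \<open>g\<close> integrated against \<open>w z - 1 - \<delta> * z\<close>,
  whose first absolute moment is at most 3 \<delta>^2. The derivative at 0 is the integral of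
  \<open>g z * z\<close>.\<close>

lemma gaussian_smoothing_remainder:
  fixes g :: "real \<Rightarrow> real"
  assumes [measurable]: "g \<in> borel_measurable borel" and B: "\<And>z. \<bar>g z\<bar> \<le> B"
  shows "\<bar>(\<integral>z. g (z + \<delta>) \<partial>std_normal) - (\<integral>z. g z \<partial>std_normal) - \<delta> * (\<integral>z. g z * z \<partial>std_normal)\<bar>
     \<le> 3 * B * \<delta>\<^sup>2"
proof -
  define w where "w z = exp (\<delta> * z - \<delta>\<^sup>2 / 2)" for z
  have w: "integrable std_normal w" using std_normal_exp_moments(1)[of \<delta>] by (simp add: w_def[abs_def])
  have B0: "0 \<le> B" using B[of 0] by linarith
  have i1: "integrable std_normal (\<lambda>z. g z * w z)"
    by (rule std_normal_bounded_integrable[OF _ B w]) simp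
  have i2: "integrable std_normal g"
    using std_normal_bounded_integrable[OF assms std_normal_const(1)[of 1]] by simp
  have i3: "integrable std_normal (\<lambda>z. g z * z)"
    by (rule std_normal_bounded_integrable[OF _ B std_normal_moments(1)]) simp
  have "(\<integral>z. g (z + \<delta>) \<partial>std_normal) = (\<integral>z. g z * w z \<partial>std_normal)"
    using std_normal_shift(2)[of g \<delta>] by (simp add: w_def)
  then have "\<bar>(\<integral>z. g (z + \<delta>) \<partial>std_normal) - (\<integral>z. g z \<partial>std_normal) - \<delta> * (\<integral>z. g z * z \<partial>std_normal)\<bar>
     = \<bar>\<integral>z. g z * w z - g z - \<delta> * (g z * z) \<partial>std_normal\<bar>"
    using i1 i2 i3 by simp
  also have "(\<lambda>z. g z * w z - g z - \<delta> * (g z * z)) = (\<lambda>z. g z * (w z - 1 - \<delta> * z))"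
    by (simp add: fun_eq_iff algebra_simps)
  also have "\<bar>\<integral>z. g z * (w z - 1 - \<delta> * z) \<partial>std_normal\<bar> \<le> (\<integral>z. \<bar>g z * (w z - 1 - \<delta> * z)\<bar> \<partial>std_normal)"
    using integral_norm_bound[of std_normal "\<lambda>z. g z * (w z - 1 - \<delta> * z)"] by simp
  also have "\<dots> \<le> (\<integral>z. B * \<bar>w z - 1 - \<delta> * z\<bar> \<partial>std_normal)"
  proof (rule integral_mono)
    show "integrable std_normal (\<lambda>z. \<bar>g z * (w z - 1 - \<delta> * z)\<bar>)"
    proof -
      have "integrable std_normal (\<lambda>z. w z - 1 - \<delta> * z)"
        by (intro Bochner_Integration.integrable_diff w std_normal_const integrable_mult_right std_normal_moments)
      then show ?thesis by (intro integrable_abs std_normal_bounded_integrable[OF _ B]) simp_all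
    qed
    show "integrable std_normal (\<lambda>z. B * \<bar>w z - 1 - \<delta> * z\<bar>)"
      using std_normal_density_remainder(1)[of \<delta>] by (simp add: w_def)
  qed (use B in \<open>auto simp: abs_mult mult_right_mono\<close>)
  also have "\<dots> \<le> B * (3 * \<delta>\<^sup>2)"
    using std_normal_density_remainder(2)[of \<delta>] B0 by (simp add: w_def mult_left_mono)
  finally show ?thesis by (simp add: mult_ac)
qed

lemma gaussian_smoothing_derivative_bound:
  fixes g :: "real \<Rightarrow> real"
  assumes [measurable]: "g \<in> borel_measurable borel" and B: "\<And>z. \<bar>g z\<bar> \<le> B"
  shows "\<bar>\<integral>z. g z * z \<partial>std_normal\<bar> \<le> B"
proof -
  have B0: "0 \<le> B" using B[of 0] by linarith
  have "\<bar>\<integral>z. g z * z \<partial>std_normal\<bar> \<le> (\<integral>z. \<bar>g z * z\<bar> \<partial>std_normal)"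
    using integral_norm_bound[of std_normal "\<lambda>z. g z * z"] by simp
  also have "\<dots> \<le> (\<integral>z. B * \<bar>z\<bar> \<partial>std_normal)"
    using B std_normal_abs_moment
    by (intro integral_mono integrable_abs std_normal_bounded_integrable[OF _ B] std_normal_moments)
       (auto simp: abs_mult mult_right_mono)
  also have "\<dots> = B * (\<integral>z. \<bar>z\<bar> \<partial>std_normal)" by simp
  also have "\<dots> \<le> B * 1" by (rule mult_left_mono[OF std_normal_abs_moment(2) B0])
  finally show ?thesis by simp
qed

text \<open>Since the normal distribution is centered, \<open>g 0\<close> may be subtracted from \<open>g\<close>.\<close>

lemma gaussian_smoothing_derivative_bound_hoelder:
  fixes g :: "real \<Rightarrow> real"
  assumes [measurable]: "g \<in> borel_measurable borel" and B: "\<And>z. \<bar>g z\<bar> \<le> B"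
    and H: "0 \<le> H" "\<And>z. \<bar>g z - g 0\<bar> \<le> H * \<bar>z\<bar> powr \<alpha>" and \<alpha>: "0 < \<alpha>" "\<alpha> < 1"
  shows "\<bar>\<integral>z. g z * z \<partial>std_normal\<bar> \<le> 2 * H"
proof -
  have i: "integrable std_normal (\<lambda>z. g z * z)"
    by (rule std_normal_bounded_integrable[OF _ B std_normal_moments(1)]) simp
  have "(\<integral>z. g z * z \<partial>std_normal) = (\<integral>z. g z * z - g 0 * z \<partial>std_normal)"
    using i std_normal_moments by simp
  also have "\<bar>\<dots>\<bar> \<le> (\<integral>z. \<bar>g z * z - g 0 * z\<bar> \<partial>std_normal)"
    using integral_norm_bound[of std_normal "\<lambda>z. g z * z - g 0 * z"] by simp
  also have "\<dots> \<le> (\<integral>z. H * (1 + z\<^sup>2) \<partial>std_normal)"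
  proof (rule integral_mono)
    show "integrable std_normal (\<lambda>z. \<bar>g z * z - g 0 * z\<bar>)"
      using i std_normal_moments by simp
    show "integrable std_normal (\<lambda>z. H * (1 + z\<^sup>2))"
      using std_normal_moments std_normal_const by simp
    fix z :: real
    have "\<bar>g z * z - g 0 * z\<bar> = \<bar>g z - g 0\<bar> * \<bar>z\<bar>" by (simp add: left_diff_distrib flip: abs_mult)
    also have "\<dots> \<le> H * \<bar>z\<bar> powr \<alpha> * \<bar>z\<bar>" by (intro mult_right_mono H) auto
    \<comment> \<open>A majorant that does not depend on \<alpha>; its mean is 2, which is the
      constant of the conclusion.\<close>
    also have "\<bar>z\<bar> powr \<alpha> * \<bar>z\<bar> \<le> 1 + z\<^sup>2"
    proof (cases "\<bar>z\<bar> \<le> 1")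
      case True
      then have "\<bar>z\<bar> powr \<alpha> * \<bar>z\<bar> \<le> 1 * 1" using \<alpha> by (intro mult_mono powr_le1) auto
      then show ?thesis using zero_le_power2[of z] by linarith
    next
      case False
      then have "\<bar>z\<bar> powr \<alpha> \<le> \<bar>z\<bar> powr 1" using \<alpha> by (intro powr_mono) auto
      then have "\<bar>z\<bar> powr \<alpha> * \<bar>z\<bar> \<le> \<bar>z\<bar> * \<bar>z\<bar>" by (intro mult_right_mono) auto
      then show ?thesis by (simp add: power2_eq_square)
    qed
    then have "H * \<bar>z\<bar> powr \<alpha> * \<bar>z\<bar> \<le> H * (1 + z\<^sup>2)" using H(1) by (simp add: mult_left_mono mult.assoc)
    finally show "\<bar>g z * z - g 0 * z\<bar> \<le> H * (1 + z\<^sup>2)" .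
  qed
  also have "\<dots> = 2 * H" using std_normal_moments std_normal_const by simp
  finally show ?thesis .
qed

text \<open>In each projection the Gaussian factor produces a derivative with bounds independent of
  the dimension. These derivatives lie in a compact interval, and along a convergent subsequence the
  inequalities, valid for each fixed \<open>b\<close>, pass to the limit by dominated
  convergence.\<close>

lemma gaussian_direction_derivative:
  fixes M :: "'a::{real_inner, second_countable_topology} measure" and f :: "'a \<Rightarrow> real"
  assumes M: "prob_borel M" and s: "0 < s" "s < 1"
    and char: "\<And>x. char_fun M x = of_real (exp (- (Q x x + g x)))"
    and Q: "psd_form Q"
    and g: "\<And>a x. 0 < a \<Longrightarrow> g (a *\<^sub>R x) = a powr (2 * s) * g x"
    and k: "\<And>x. \<tau>\<^sup>2 * (inner k x)\<^sup>2 \<le> Q x x" and \<tau>: "\<tau> > 0" and k1: "norm k \<le> 1"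
    and f: "continuous_on UNIV f" "\<And>y. \<bar>f y\<bar> \<le> B"
  obtains D where "\<bar>D\<bar> \<le> B / \<tau>"
    "\<And>b. \<bar>(\<integral>y. f (y + b *\<^sub>R k) \<partial>M) - (\<integral>y. f y \<partial>M) - b * D\<bar> \<le> 3 * B * b\<^sup>2 / \<tau>\<^sup>2"
    "\<And>H \<alpha>. 0 < \<alpha> \<Longrightarrow> \<alpha> < 1 \<Longrightarrow> 0 \<le> H \<Longrightarrow> (\<And>x y. \<bar>f x - f y\<bar> \<le> H * norm (x - y) powr \<alpha>) \<Longrightarrow>
      \<bar>D\<bar> \<le> 2 * H * \<tau> powr (\<alpha> - 1)"
proof -
  have [measurable]: "f \<in> borel_measurable borel" using f(1) by (rule borel_measurable_continuous_onI)
  have B0: "0 \<le> B" using f(2)[of 0] by linarith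
  obtain E :: "nat \<Rightarrow> 'a set" where E: "\<And>n. orthonormal (E n)" "\<And>x. (\<lambda>n. orth_proj (E n) x) \<longlonglongrightarrow> x"
    by (rule orth_proj_sequence) blast
  define I where "I n b = (\<integral>y. f (orth_proj (E n) (y + b *\<^sub>R k)) \<partial>M)" for n b
  have step: "\<exists>D. \<bar>D\<bar> \<le> B / \<tau> \<and> (\<forall>b. \<bar>I n b - I n 0 - b * D\<bar> \<le> 3 * B * b\<^sup>2 / \<tau>\<^sup>2) \<and>
    (\<forall>H \<alpha>. 0 < \<alpha> \<longrightarrow> \<alpha> < 1 \<longrightarrow> 0 \<le> H \<longrightarrow> (\<forall>x y. \<bar>f x - f y\<bar> \<le> H * norm (x - y) powr \<alpha>) \<longrightarrow>
      \<bar>D\<bar> \<le> 2 * H * \<tau> powr (\<alpha> - 1))" for n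
  proof -
    let ?P = "orth_proj (E n)"
    obtain \<rho> where \<rho>: "prob_borel \<rho>" "\<And>f B. continuous_on UNIV f \<Longrightarrow> (\<And>y. \<bar>f y\<bar> \<le> (B::real)) \<Longrightarrow>
     (\<integral>y. f (?P y) \<partial>M) = (\<integral>y. \<integral>z. f (y + (\<tau> * z) *\<^sub>R ?P k) \<partial>std_normal \<partial>\<rho>)"
      by (rule gaussian_direction_split[OF M s char Q g k E(1)]) blast+
    define G where "G y z = f (y + (\<tau> * z) *\<^sub>R ?P k)" for y z
    have GB: "\<bar>G y z\<bar> \<le> B" for y z using f(2) by (simp add: G_def)
    have Gm [measurable]: "G y \<in> borel_measurable borel" for y unfolding G_def by measurable
    have \<tau>': "\<tau> * z + b = \<tau> * (z + b / \<tau>)" for z b using \<tau> by (simp add: field_simps)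
    \<comment> \<open>Moving the argument by \<open>b\<close> along the projected \<open>k\<close>
      amounts to moving the normal variable by b / \<tau>. This is the origin of the powers of 1 /
      \<tau> in all bounds.\<close>
    have I: "I n b = (\<integral>y. \<integral>z. G y (z + b / \<tau>) \<partial>std_normal \<partial>\<rho>)" for b
    proof -
      have "I n b = (\<integral>y. (\<lambda>w. f (w + b *\<^sub>R ?P k)) (?P y) \<partial>M)"
        by (simp add: I_def orth_proj_add orth_proj_scaleR)
      also have "\<dots> = (\<integral>y. \<integral>z. (\<lambda>w. f (w + b *\<^sub>R ?P k)) (y + (\<tau> * z) *\<^sub>R ?P k) \<partial>std_normal \<partial>\<rho>)"
        by (rule \<rho>(2)[of _ B]) (auto intro!: continuous_on_compose2[OF f(1)] continuous_intros f(2))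
      also have "\<dots> = (\<integral>y. \<integral>z. G y (z + b / \<tau>) \<partial>std_normal \<partial>\<rho>)"
        by (simp add: G_def add.assoc scaleR_add_left[symmetric] \<tau>')
      finally show ?thesis .
    qed
    interpret N: prob_space std_normal using prob_borelD[OF prob_borel_std_normal] by simp
    have mG: "(\<lambda>y. \<integral>z. G y (z + b) * h z \<partial>std_normal) \<in> borel_measurable borel"
      if [measurable]: "h \<in> borel_measurable borel" for h b
      unfolding G_def by measurable
    define J where "J y = (\<integral>z. G y z * z \<partial>std_normal)" for y
    have J: "\<bar>J y\<bar> \<le> B" for y unfolding J_def by (rule gaussian_smoothing_derivative_bound) (auto simp: GB)
    define A where "A b y = (\<integral>z. G y (z + b) \<partial>std_normal)" for b y
    have A: "\<bar>A b y\<bar> \<le> B" for b y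
      unfolding A_def by (rule prob_borel_integral_le[OF prob_borel_std_normal]) (rule GB)
    have iA: "integrable \<rho> (A b)" for b
      using mG[of "\<lambda>_. 1" b] A by (intro prob_borel_integrable[OF \<rho>(1), of _ B]) (auto simp: A_def[abs_def])
    have iJ: "integrable \<rho> J"
      using mG[of "\<lambda>z. z" 0] J by (intro prob_borel_integrable[OF \<rho>(1), of _ B]) (auto simp: J_def[abs_def])
    define D where "D = (\<integral>y. J y \<partial>\<rho>) / \<tau>"
    show ?thesis
    proof (intro exI[of _ D] conjI allI impI)
      show "\<bar>D\<bar> \<le> B / \<tau>"
        using prob_borel_integral_le[OF \<rho>(1), of J B] J \<tau> by (simp add: D_def divide_right_mono)
      fix b
      have "I n b - I n 0 - b * D = (\<integral>y. A (b / \<tau>) y - A 0 y - b / \<tau> * J y \<partial>\<rho>)"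
        using iA iJ \<tau> unfolding I D_def A_def[symmetric] by (simp add: A_def[symmetric])
      also have "\<bar>\<dots>\<bar> \<le> 3 * B * (b / \<tau>)\<^sup>2"
      proof (rule prob_borel_integral_le[OF \<rho>(1)])
        show "\<bar>A (b / \<tau>) y - A 0 y - b / \<tau> * J y\<bar> \<le> 3 * B * (b / \<tau>)\<^sup>2" for y
          using gaussian_smoothing_remainder[OF Gm GB, of y "b / \<tau>"] by (simp add: A_def J_def)
      qed
      finally show "\<bar>I n b - I n 0 - b * D\<bar> \<le> 3 * B * b\<^sup>2 / \<tau>\<^sup>2" by (simp add: power_divide)
    next
      fix H \<alpha> assume \<alpha>: "0 < \<alpha>" "\<alpha> < 1" and H: "0 \<le> H" and fH: "\<forall>x y. \<bar>f x - f y\<bar> \<le> H * norm (x - y) powr \<alpha>"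
      have "\<bar>J y\<bar> \<le> 2 * (H * \<tau> powr \<alpha>)" for y
        unfolding J_def
      proof (rule gaussian_smoothing_derivative_bound_hoelder[OF Gm GB _ _ \<alpha>])
        show "0 \<le> H * \<tau> powr \<alpha>" using H by simp
        fix z
        have "norm (?P k) \<le> 1" using norm_orth_proj_le[OF E(1), of n k] k1 by linarith
        then have "\<tau> * \<bar>z\<bar> * norm (?P k) \<le> \<tau> * \<bar>z\<bar> * 1" using \<tau> by (intro mult_left_mono) auto
        then have "norm ((\<tau> * z) *\<^sub>R ?P k) powr \<alpha> \<le> (\<tau> * \<bar>z\<bar>) powr \<alpha>"
          using \<alpha> \<tau> by (intro powr_mono2) (auto simp: abs_mult)
        also have "\<dots> = \<tau> powr \<alpha> * \<bar>z\<bar> powr \<alpha>" using \<tau> by (simp add: powr_mult)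
        finally have "H * norm ((\<tau> * z) *\<^sub>R ?P k) powr \<alpha> \<le> H * (\<tau> powr \<alpha> * \<bar>z\<bar> powr \<alpha>)"
          using H by (rule mult_left_mono)
        then show "\<bar>G y z - G y 0\<bar> \<le> H * \<tau> powr \<alpha> * \<bar>z\<bar> powr \<alpha>"
          using fH[rule_format, of "y + (\<tau> * z) *\<^sub>R ?P k" y] by (simp add: G_def mult.assoc)
      qed
      then have "\<bar>\<integral>y. J y \<partial>\<rho>\<bar> \<le> 2 * (H * \<tau> powr \<alpha>)" by (rule prob_borel_integral_le[OF \<rho>(1)])
      then have "\<bar>D\<bar> \<le> 2 * (H * \<tau> powr \<alpha>) / \<tau>" using \<tau> by (simp add: D_def divide_right_mono)
      then show "\<bar>D\<bar> \<le> 2 * H * \<tau> powr (\<alpha> - 1)" using \<tau> by (simp add: powr_diff mult.assoc)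
    qed
  qed
  then obtain D where D: "\<And>n. \<bar>D n\<bar> \<le> B / \<tau>"
    "\<And>n b. \<bar>I n b - I n 0 - b * D n\<bar> \<le> 3 * B * b\<^sup>2 / \<tau>\<^sup>2"
    "\<And>n H \<alpha>. 0 < \<alpha> \<Longrightarrow> \<alpha> < 1 \<Longrightarrow> 0 \<le> H \<Longrightarrow> (\<And>x y. \<bar>f x - f y\<bar> \<le> H * norm (x - y) powr \<alpha>) \<Longrightarrow>
      \<bar>D n\<bar> \<le> 2 * H * \<tau> powr (\<alpha> - 1)" by metis
  \<comment> \<open>One subsequence serves all \<open>b\<close> and all Hoelder bounds
    simultaneously, so the limit \<open>D'\<close> inherits the three properties together.\<close>
  have "seq_compact {- (B / \<tau>)..B / \<tau>}" by (rule compact_imp_seq_compact) simp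
  moreover have "\<forall>n. D n \<in> {- (B / \<tau>)..B / \<tau>}" using D(1) by (auto simp: abs_le_iff minus_le_iff)
  ultimately obtain D' r where r: "D' \<in> {- (B / \<tau>)..B / \<tau>}" "strict_mono (r :: nat \<Rightarrow> nat)" "(D \<circ> r) \<longlonglongrightarrow> D'"
    unfolding seq_compact_def by metis
  have I_lim: "(\<lambda>n. I n b) \<longlonglongrightarrow> (\<integral>y. f (y + b *\<^sub>R k) \<partial>M)" for b
    unfolding I_def
  proof (rule integral_dominated_convergence[where w = "\<lambda>_. B"])
    show "(\<lambda>y. f (y + b *\<^sub>R k)) \<in> borel_measurable M"
      using prob_borelD(2)[OF M] by (simp cong: measurable_cong_sets)
    show "(\<lambda>y. f (orth_proj (E n) (y + b *\<^sub>R k))) \<in> borel_measurable M" for n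
    proof -
      have "continuous_on UNIV (\<lambda>y. f (orth_proj (E n) (y + b *\<^sub>R k)))"
        by (intro continuous_on_compose2[OF f(1)] continuous_on_compose2[OF continuous_orth_proj]
            continuous_intros) auto
      then show ?thesis
        using prob_borelD(2)[OF M] borel_measurable_continuous_onI by (simp cong: measurable_cong_sets)
    qed
    show "AE y in M. (\<lambda>n. f (orth_proj (E n) (y + b *\<^sub>R k))) \<longlonglongrightarrow> f (y + b *\<^sub>R k)"
      by (intro always_eventually allI continuous_on_tendsto_compose[OF f(1) E(2)]) auto
    show "integrable M (\<lambda>_. B)" by (rule prob_borel_integrable[OF M, of _ B]) (auto simp: B0)
  qed (auto simp: f(2))
  have I_lim': "(\<lambda>n. I (r n) b) \<longlonglongrightarrow> (\<integral>y. f (y + b *\<^sub>R k) \<partial>M)" for b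
    using LIMSEQ_subseq_LIMSEQ[OF I_lim r(2)] by (simp add: o_def)
  have D_lim: "(\<lambda>n. D (r n)) \<longlonglongrightarrow> D'" using r(3) by (simp add: o_def)
  show ?thesis
  proof (rule that[of D'])
    show "\<bar>D'\<bar> \<le> B / \<tau>" using r(1) by auto
    show "\<bar>(\<integral>y. f (y + b *\<^sub>R k) \<partial>M) - (\<integral>y. f y \<partial>M) - b * D'\<bar> \<le> 3 * B * b\<^sup>2 / \<tau>\<^sup>2" for b
    proof (rule LIMSEQ_le_const2)
      show "(\<lambda>n. \<bar>I (r n) b - I (r n) 0 - b * D (r n)\<bar>) \<longlonglongrightarrow>
          \<bar>(\<integral>y. f (y + b *\<^sub>R k) \<partial>M) - (\<integral>y. f y \<partial>M) - b * D'\<bar>"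
        using I_lim'[of 0] by (intro tendsto_intros I_lim' D_lim) simp
    qed (use D(2) in blast)
    fix H \<alpha> assume *: "0 < \<alpha>" "\<alpha> < 1" "0 \<le> H" "\<And>x y. \<bar>f x - f y\<bar> \<le> H * norm (x - y) powr \<alpha>"
    show "\<bar>D'\<bar> \<le> 2 * H * \<tau> powr (\<alpha> - 1)"
      by (rule LIMSEQ_le_const2[OF tendsto_rabs[OF D_lim]]) (use D(3)[OF *] in blast)
  qed
qed

section \<open>Derivatives with quadratic remainder\<close>

text \<open>Stronger than Frechet differentiability at \<open>x\<close>: the bound holds for every
  \<open>h\<close>, not only small ones. An explicit inequality of this kind can be integrated
  against a probability measure and used with a constant uniform in \<open>x\<close>.\<close>

definition quad_deriv :: "('a::real_normed_vector \<Rightarrow> real) \<Rightarrow> ('a \<Rightarrow>\<^sub>L real) \<Rightarrow> 'a \<Rightarrow> real \<Rightarrow> bool" where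
  "quad_deriv G D x K \<longleftrightarrow> (\<forall>h. \<bar>G (x + h) - G x - D h\<bar> \<le> K * (norm h)\<^sup>2)"

lemma quad_derivD: "quad_deriv G D x K \<Longrightarrow> \<bar>G (x + h) - G x - D h\<bar> \<le> K * (norm h)\<^sup>2"
  by (simp add: quad_deriv_def)

text \<open>A linear term dominated by a quadratic one vanishes. Identities between derivatives,
  such as uniqueness, additivity and the semigroup rule, are reduced to this.\<close>

lemma linear_quadratic_zero:
  fixes a C :: real
  assumes "\<And>b. 0 < b \<Longrightarrow> \<bar>a * b\<bar> \<le> C * b\<^sup>2"
  shows "a = 0"
proof (rule ccontr)
  assume a: "a \<noteq> 0"
  have C: "0 < C" using assms[of 1] a by auto
  have "\<bar>a * (\<bar>a\<bar> / (2 * C))\<bar> \<le> C * (\<bar>a\<bar> / (2 * C))\<^sup>2" using a C by (intro assms) auto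
  then have "\<bar>a\<bar> * \<bar>a\<bar> / (2 * C) \<le> \<bar>a\<bar> * \<bar>a\<bar> / (4 * C)"
    using C by (simp add: abs_mult power2_eq_square)
  moreover have "0 < \<bar>a\<bar> * \<bar>a\<bar>" using a by (intro mult_pos_pos) auto
  ultimately show False using C by (simp add: field_simps)
qed

lemma quad_deriv_unique:
  assumes "quad_deriv G D x K" "quad_deriv G D' x K'"
  shows "D = D'"
proof (rule blinfun_eqI)
  fix h
  have "D h - D' h = 0"
  proof (rule linear_quadratic_zero)
    fix b :: real assume "0 < b"
    show "\<bar>(D h - D' h) * b\<bar> \<le> (K + K') * (norm h)\<^sup>2 * b\<^sup>2"
      using quad_derivD[OF assms(1), of "b *\<^sub>R h"] quad_derivD[OF assms(2), of "b *\<^sub>R h"]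
      by (simp add: blinfun.scaleR_right power_mult_distrib algebra_simps abs_le_iff)
  qed
  then show "D h = D' h" by simp
qed

lemma norm_blinfun_bound_sphere:
  fixes D :: "'a::real_normed_vector \<Rightarrow>\<^sub>L 'b::real_normed_vector"
  assumes "r > 0" "0 \<le> C" "\<And>h. norm h = r \<Longrightarrow> norm (D h) \<le> C * r"
  shows "norm D \<le> C"
proof (rule norm_blinfun_bound)
  fix h show "norm (D h) \<le> C * norm h"
  proof (cases "h = 0")
    case False
    have "norm (D ((r / norm h) *\<^sub>R h)) \<le> C * r" using False assms(1) by (intro assms(3)) simp
    then show ?thesis using False assms(1) by (simp add: blinfun.scaleR_right field_simps)
  qed simp
qed (rule assms(2))

text \<open>For \<parallel>h\<parallel> = r = \<parallel>y - x\<parallel> the increment from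
  \<open>y\<close> to \<open>y + h\<close> is expanded at \<open>y\<close> and also at
  \<open>x\<close>. The remainders cost K r^2 at \<open>y\<close>, and 4 K r^2 and K r^2 at
  \<open>x\<close> for the endpoints \<open>y + h\<close> and \<open>y\<close>, which explains the
  6.\<close>

lemma quad_deriv_lipschitz:
  assumes x: "quad_deriv G D x K" and y: "quad_deriv G D' y K" and K: "0 \<le> K"
  shows "norm (D' - D) \<le> 6 * K * norm (y - x)"
proof (cases "y = x")
  case True
  then show ?thesis using quad_deriv_unique[of G D x K D' K] x y by simp
next
  case False
  let ?r = "norm (y - x)"
  show ?thesis
  proof (rule norm_blinfun_bound_sphere[of ?r])
    fix h :: 'a assume h: "norm h = ?r"
    have "norm (y - x + h) \<le> 2 * ?r" using norm_triangle_ineq[of "y - x" h] h by simp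
    then have "(norm (y - x + h))\<^sup>2 \<le> (2 * ?r)\<^sup>2" by (intro power_mono) auto
    then have "K * (norm (y - x + h))\<^sup>2 \<le> K * (4 * ?r\<^sup>2)" using K by (intro mult_left_mono) (auto simp: power_mult_distrib)
    then have "\<bar>G (y + h) - G x - D (y - x + h)\<bar> \<le> 4 * K * ?r\<^sup>2"
      using quad_derivD[OF x, of "y - x + h"] by (simp add: mult_ac algebra_simps)
    moreover have "\<bar>G y - G x - D (y - x)\<bar> \<le> K * ?r\<^sup>2" using quad_derivD[OF x, of "y - x"] by simp
    moreover have "\<bar>G (y + h) - G y - D' h\<bar> \<le> K * ?r\<^sup>2" using quad_derivD[OF y, of h] h by simp
    ultimately have "\<bar>D' h - D h\<bar> \<le> 6 * K * ?r\<^sup>2" by (simp add: blinfun.add_right)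
    then show "norm ((D' - D) h) \<le> 6 * K * ?r * ?r"
      by (simp add: blinfun.diff_left power2_eq_square mult.assoc)
  qed (use False K in auto)
qed

text \<open>Additivity of the directional derivatives at \<open>x\<close> follows by comparing \<open>x + a h\<close> and
  \<open>x + a k\<close> with their midpoint, at which the first order terms cancel.\<close>

lemma quad_deriv_of_directional:
  fixes G :: "'a::real_normed_vector \<Rightarrow> real"
  assumes dir: "\<And>x u. norm u = 1 \<Longrightarrow> \<exists>D. \<bar>D\<bar> \<le> M \<and> (\<forall>b. \<bar>G (x + b *\<^sub>R u) - G x - b * D\<bar> \<le> K * b\<^sup>2)"
    and M: "0 \<le> M" and K: "0 \<le> K"
  shows "\<exists>L. norm L \<le> M \<and> quad_deriv G L x K"
proof -
  have "\<exists>D. \<bar>D\<bar> \<le> M * norm h \<and> (\<forall>b. \<bar>G (x + b *\<^sub>R h) - G x - b * D\<bar> \<le> K * (norm h)\<^sup>2 * b\<^sup>2)" for x h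
  proof (cases "h = 0")
    case False
    then obtain D where D: "\<bar>D\<bar> \<le> M"
      "\<And>b. \<bar>G (x + b *\<^sub>R (h /\<^sub>R norm h)) - G x - b * D\<bar> \<le> K * b\<^sup>2"
      using dir[of "h /\<^sub>R norm h" x] by auto
    show ?thesis
    proof (intro exI[of _ "norm h * D"] conjI allI)
      show "\<bar>norm h * D\<bar> \<le> M * norm h" using D(1) by (simp add: abs_mult mult_right_mono mult.commute)
      show "\<bar>G (x + b *\<^sub>R h) - G x - b * (norm h * D)\<bar> \<le> K * (norm h)\<^sup>2 * b\<^sup>2" for b
        using D(2)[of "b * norm h"] False by (simp add: power_mult_distrib mult_ac)
    qed
  qed (intro exI[of _ 0], simp)
  then have "\<forall>x h. \<exists>D. \<bar>D\<bar> \<le> M * norm h \<and>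
    (\<forall>b. \<bar>G (x + b *\<^sub>R h) - G x - b * D\<bar> \<le> K * (norm h)\<^sup>2 * b\<^sup>2)" by blast
  then obtain D where D': "\<forall>x h. \<bar>D x h\<bar> \<le> M * norm h \<and>
    (\<forall>b. \<bar>G (x + b *\<^sub>R h) - G x - b * D x h\<bar> \<le> K * (norm h)\<^sup>2 * b\<^sup>2)"
    unfolding choice_iff by blast
  have D: "\<And>x h. \<bar>D x h\<bar> \<le> M * norm h"
    "\<And>x h b. \<bar>G (x + b *\<^sub>R h) - G x - b * D x h\<bar> \<le> K * (norm h)\<^sup>2 * b\<^sup>2" using D' by auto
  have scale: "D x (r *\<^sub>R h) = r * D x h" for x r h
  proof -
    have "D x (r *\<^sub>R h) - r * D x h = 0"
    proof (rule linear_quadratic_zero)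
      fix b :: real assume "0 < b"
      show "\<bar>(D x (r *\<^sub>R h) - r * D x h) * b\<bar> \<le> (2 * K * (norm h)\<^sup>2 * r\<^sup>2) * b\<^sup>2"
        using D(2)[of x "b * r" h] D(2)[of x b "r *\<^sub>R h"]
        by (simp add: power_mult_distrib algebra_simps abs_le_iff)
    qed
    then show ?thesis by simp
  qed
  have add: "D x (h + k) = D x h + D x k" for x h k
  proof -
    have "D x h + D x k - D x (h + k) = 0"
    proof (rule linear_quadratic_zero)
      fix b :: real assume "0 < b"
      define m where "m = x + b *\<^sub>R ((1/2) *\<^sub>R (h + k))"
      have m1: "m + b *\<^sub>R ((1/2) *\<^sub>R (h - k)) = x + b *\<^sub>R h" 
        by (simp add: m_def algebra_simps flip: scaleR_add_left)
      have m2: "m + (- b) *\<^sub>R ((1/2) *\<^sub>R (h - k)) = x + b *\<^sub>R k"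
        by (simp add: m_def algebra_simps flip: scaleR_add_left)
      have 1: "\<bar>G (x + b *\<^sub>R h) - G m - b * D m ((1/2) *\<^sub>R (h - k))\<bar> \<le> K * (norm ((1/2) *\<^sub>R (h - k)))\<^sup>2 * b\<^sup>2"
        using D(2)[of m b "(1/2) *\<^sub>R (h - k)"] m1 by simp
      have 2: "\<bar>G (x + b *\<^sub>R k) - G m + b * D m ((1/2) *\<^sub>R (h - k))\<bar> \<le> K * (norm ((1/2) *\<^sub>R (h - k)))\<^sup>2 * b\<^sup>2"
        using D(2)[of m "- b" "(1/2) *\<^sub>R (h - k)"] m2 by simp
      have 3: "\<bar>G m - G x - b * ((1/2) * D x (h + k))\<bar> \<le> K * (norm ((1/2) *\<^sub>R (h + k)))\<^sup>2 * b\<^sup>2"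
        using D(2)[of x b "(1/2) *\<^sub>R (h + k)"] by (simp only: m_def scale)
      note 4 = D(2)[of x b h] D(2)[of x b k]
      have "\<bar>(D x h + D x k - D x (h + k)) * b\<bar> \<le> 2 * (K * (norm ((1/2) *\<^sub>R (h - k)))\<^sup>2 * b\<^sup>2)
          + 2 * (K * (norm ((1/2) *\<^sub>R (h + k)))\<^sup>2 * b\<^sup>2) + K * (norm h)\<^sup>2 * b\<^sup>2 + K * (norm k)\<^sup>2 * b\<^sup>2"
      proof -
        have lin: "(D x h + D x k - D x (h + k)) * b =
            b * D x h + b * D x k - 2 * (b * ((1/2) * D x (h + k)))" by (simp add: algebra_simps)
        show ?thesis unfolding lin using 1 2 3 4 by linarith
      qed
      then show "\<bar>(D x h + D x k - D x (h + k)) * b\<bar> \<le>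
         (2 * (K * (norm ((1/2) *\<^sub>R (h - k)))\<^sup>2) + 2 * (K * (norm ((1/2) *\<^sub>R (h + k)))\<^sup>2)
           + K * (norm h)\<^sup>2 + K * (norm k)\<^sup>2) * b\<^sup>2"
        by (simp only: distrib_right mult.assoc)
    qed
    then show ?thesis by simp
  qed
  have bl: "bounded_linear (D x)"
    by (rule bounded_linear_intro[of _ M]) (use add scale D(1) in \<open>auto simp: mult.commute\<close>)
  show ?thesis
  proof (intro exI[of _ "Blinfun (D x)"] conjI)
    show "norm (Blinfun (D x)) \<le> M"
      using D(1) M by (intro norm_blinfun_bound) (auto simp: bounded_linear_Blinfun_apply[OF bl])
    show "quad_deriv G (Blinfun (D x)) x K"
      using D(2)[of x 1] by (simp add: quad_deriv_def bounded_linear_Blinfun_apply[OF bl])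
  qed
qed

abbreviation apply2 ::
    "('a::real_normed_vector \<Rightarrow>\<^sub>L 'b::real_normed_vector \<Rightarrow>\<^sub>L 'c::real_normed_vector) \<Rightarrow> 'a \<Rightarrow> 'b \<Rightarrow> 'c" where
  "apply2 L k h \<equiv> (blinfun_apply :: ('b \<Rightarrow>\<^sub>L 'c) \<Rightarrow> 'b \<Rightarrow> 'c) (blinfun_apply L k) h"

lemma bilinear_blinfun_exists:
  fixes T :: "'a::real_normed_vector \<Rightarrow> 'a \<Rightarrow> real"
  assumes add: "\<And>k k' h. T (k + k') h = T k h + T k' h" "\<And>k h h'. T k (h + h') = T k h + T k h'"
    and scale: "\<And>r k h. T (r *\<^sub>R k) h = r * T k h" "\<And>r k h. T k (r *\<^sub>R h) = r * T k h"
    and C: "0 \<le> C" "\<And>k h. \<bar>T k h\<bar> \<le> C * norm k * norm h"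
  shows "\<exists>L :: 'a \<Rightarrow>\<^sub>L 'a \<Rightarrow>\<^sub>L real. norm L \<le> C \<and> (\<forall>k h. apply2 L k h = T k h)"
proof -
  have bl1: "bounded_linear (T k)" for k
  proof (rule bounded_linear_intro)
    show "norm (T k h) \<le> norm h * (C * norm k)" for h using C(2)[of k h] by (simp add: mult_ac)
  qed (simp_all add: add scale)
  define E where "E k = Blinfun (T k)" for k
  have E: "blinfun_apply (E k) h = T k h" for k h
    by (simp add: E_def bounded_linear_Blinfun_apply[OF bl1])
  have nE: "norm (E k) \<le> C * norm k" for k
    using C by (intro norm_blinfun_bound) (auto simp: E)
  have bl2: "bounded_linear E"
    by (rule bounded_linear_intro[of _ C])
       (use nE in \<open>auto intro!: blinfun_eqI simp: E assms blinfun.add_left blinfun.scaleR_left mult.commute\<close>)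
  have EE: "blinfun_apply (Blinfun E) k = E k" for k by (simp add: bounded_linear_Blinfun_apply[OF bl2])
  have "norm (Blinfun E) \<le> C"
    by (rule norm_blinfun_bound) (use C nE in \<open>auto simp: EE\<close>)
  then show ?thesis using E EE by metis
qed

section \<open>The Ornstein--Uhlenbeck semigroup\<close>

definition bdd_cont :: "('a::topological_space \<Rightarrow> real) \<Rightarrow> real \<Rightarrow> bool" where
  "bdd_cont f B \<longleftrightarrow> continuous_on UNIV f \<and> (\<forall>x. \<bar>f x\<bar> \<le> B)"

lemma bdd_contD:
  assumes "bdd_cont f B"
  shows "continuous_on UNIV f" "\<bar>f x\<bar> \<le> B" "f \<in> borel_measurable borel" "0 \<le> B"
proof -
  show "continuous_on UNIV f" "\<bar>f x\<bar> \<le> B" using assms by (auto simp: bdd_cont_def)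
  then show "f \<in> borel_measurable borel" by (intro borel_measurable_continuous_onI)
  have "0 \<le> \<bar>f x\<bar>" by simp
  then show "0 \<le> B" using assms by (metis bdd_cont_def order_trans)
qed

lemma bdd_cont_affine:
  fixes f :: "'a::real_normed_vector \<Rightarrow> real" and T :: "'a \<Rightarrow>\<^sub>L 'a"
  assumes "bdd_cont f B"
  shows "bdd_cont (\<lambda>y. f (x + y)) B" "bdd_cont (\<lambda>x. f (T x + y)) B" "bdd_cont (\<lambda>y. f (x + T y)) B"
  using assms
  by (auto simp: bdd_cont_def intro!: continuous_on_compose2[of UNIV f] continuous_intros)

lemma prob_borel_bdd_cont_integrable:
  "prob_borel M \<Longrightarrow> bdd_cont f B \<Longrightarrow> integrable M f"
  by (rule prob_borel_integrable[of M f B]) (auto dest: bdd_contD)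

locale ou_semigroup =
  fixes c s :: real
    and S :: "real \<Rightarrow> 'a::{real_inner, second_countable_topology} \<Rightarrow>\<^sub>L 'a"
    and \<mu> :: "real \<Rightarrow> 'a measure"
  assumes c: "0 \<le> c" and s: "0 < s" "s < 1"
    and S_add: "\<And>r t. 0 \<le> r \<Longrightarrow> 0 \<le> t \<Longrightarrow> S (r + t) = S r o\<^sub>L S t"
    and S_contr: "\<And>t x. 0 \<le> t \<Longrightarrow> norm (S t x) \<le> norm x"
    and S_self: "\<And>t x y. 0 \<le> t \<Longrightarrow> inner (S t x) y = inner x (S t y)"
    and S_cont: "\<And>x. continuous_on {0..} (\<lambda>t. S t x)"
    and mu: "OU_measures c s S \<mu>"
begin

definition \<psi> where "\<psi> r x = (norm (S r x))\<^sup>2 + c * norm (S r x) powr (2 * s)"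

lemma S_cont': "A \<subseteq> {0..} \<Longrightarrow> continuous_on A (\<lambda>t. S t x)"
  by (rule continuous_on_subset[OF S_cont])

lemma norm_powr_cont: "A \<subseteq> {0..} \<Longrightarrow> continuous_on A (\<lambda>t. c * norm (S t x) powr (2 * s))"
  using s by (intro continuous_intros continuous_on_powr' S_cont') auto

lemma \<psi>_cont: "A \<subseteq> {0..} \<Longrightarrow> continuous_on A (\<lambda>t. \<psi> t x)"
  unfolding \<psi>_def by (intro continuous_on_add norm_powr_cont continuous_intros S_cont')

lemma \<psi>_nonneg: "0 \<le> \<psi> r x"
  using c by (simp add: \<psi>_def)

definition F where "F t x = (LINT r:{0..t}|lborel. \<psi> r x)"

lemma F_eq_integral: "F t x = integral {0..t} (\<lambda>r. \<psi> r x)"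
  unfolding F_def by (rule set_borel_integral_eq_integral) (intro borel_integrable_atLeastAtMost' \<psi>_cont; auto)

lemma mu_prob: "0 \<le> t \<Longrightarrow> prob_borel (\<mu> t)"
  using mu by (auto simp: OU_measures_def prob_borel_def intro: prob_spaceI)

lemma mu_char: "0 \<le> t \<Longrightarrow> char_fun (\<mu> t) x = of_real (exp (- F t x))"
  using mu by (simp add: OU_measures_def char_fun_def F_def \<psi>_def)

text \<open>The interval is split at \<open>r\<close> and the second piece shifted back, which
  replaces \<open>x\<close> by \<open>S r x\<close>. This cocycle identity is what makes
  \<open>P\<close> a semigroup.\<close>

lemma F_add:
  assumes "0 \<le> r" "0 \<le> t"
  shows "F (r + t) x = F r x + F t (S r x)"
proof -
  have shift: "\<psi> (u + r) x = \<psi> u (S r x)" if "0 \<le> u" for u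
    using S_add[OF that assms(1)] by (simp add: \<psi>_def)
  have "integral {0..r} (\<lambda>u. \<psi> u x) + integral {r..r + t} (\<lambda>u. \<psi> u x) = integral {0..r + t} (\<lambda>u. \<psi> u x)"
    using assms by (intro Henstock_Kurzweil_Integration.integral_combine integrable_continuous_interval \<psi>_cont) auto
  moreover have "integral {r..r + t} (\<lambda>u. \<psi> u x) = integral {0..t} (\<lambda>u. \<psi> (u + r) x)"
    using integral_shift_Icc_real[of 0 t "\<lambda>u. \<psi> u x" r] by (simp add: o_def add.commute)
  moreover have "integral {0..t} (\<lambda>u. \<psi> (u + r) x) = integral {0..t} (\<lambda>u. \<psi> u (S r x))"
    by (rule Henstock_Kurzweil_Integration.integral_cong) (use shift in auto)
  ultimately show ?thesis by (simp add: F_eq_integral)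
qed

lemma F_nonneg: "0 \<le> F t x"
  unfolding F_def set_lebesgue_integral_def by (intro integral_nonneg_AE) (auto simp: \<psi>_nonneg)

text \<open>By \<open>F_add\<close> the function increases in t, as the added term is nonnegative,
  and monotone functions are Borel. Freezing negative times at 0 makes it monotone on the whole
  line.\<close>

lemma F_measurable: "(\<lambda>t. F t x) \<in> borel_measurable (restrict_space borel {0..})"
proof -
  have "mono (\<lambda>t. F (max 0 t) x)"
  proof (rule monoI)
    fix r t :: real assume "r \<le> t"
    then have "F (max 0 t) x = F (max 0 r) x + F (max 0 t - max 0 r) (S (max 0 r) x)"
      using F_add[of "max 0 r" "max 0 t - max 0 r" x] by simp
    then show "F (max 0 r) x \<le> F (max 0 t) x" using F_nonneg by simp
  qed
  then have "(\<lambda>t. F (max 0 t) x) \<in> borel_measurable (restrict_space borel {0..})"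
    by (intro measurable_restrict_space1 borel_measurable_mono)
  then show ?thesis by (subst measurable_cong) (auto simp: space_restrict_space max_def)
qed

definition P :: "real \<Rightarrow> ('a \<Rightarrow> real) \<Rightarrow> 'a \<Rightarrow> real" where
  "P t f x = (\<integral>y. f (S t x + y) \<partial>\<mu> t)"

lemma P_integrable:
  assumes "0 \<le> t" "bdd_cont f B"
  shows "integrable (\<mu> t) (\<lambda>y. f (S t x + y))"
  by (rule prob_borel_bdd_cont_integrable[OF mu_prob bdd_cont_affine(1)]) fact+

lemma P_bdd_cont:
  assumes t: "0 \<le> t" and f: "bdd_cont f B"
  shows "bdd_cont (P t f) B"
  unfolding bdd_cont_def
proof safe
  interpret prob_space "\<mu> t" using prob_borelD[OF mu_prob[OF t]] by simp
  show "continuous_on UNIV (P t f)"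
    unfolding continuous_on_sequentially o_def P_def
  proof safe
    fix X :: "nat \<Rightarrow> 'a" and x assume X: "X \<longlonglongrightarrow> x"
    show "(\<lambda>n. \<integral>y. f (S t (X n) + y) \<partial>\<mu> t) \<longlonglongrightarrow> (\<integral>y. f (S t x + y) \<partial>\<mu> t)"
    proof (rule integral_dominated_convergence[where w = "\<lambda>_. B"])
      show "AE y in \<mu> t. (\<lambda>n. f (S t (X n) + y)) \<longlonglongrightarrow> f (S t x + y)"
        using X by (intro always_eventually allI continuous_on_tendsto_compose[OF bdd_contD(1)[OF f]]
            tendsto_intros blinfun.tendsto) auto
    qed (use bdd_contD[OF f] P_integrable[OF t f] in auto)
  qed
  show "\<bar>P t f x\<bar> \<le> B" for x
    unfolding P_def by (rule prob_borel_integral_le[OF mu_prob[OF t]]) (rule bdd_contD[OF f])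
qed

text \<open>\<open>P t f x\<close> is the integral of \<open>f\<close> against the translate of
  \<open>\<mu> t\<close> by \<open>S t x\<close>, whose characteristic function is a continuous
  function of t times exp (- F). Joint measurability of the family \<open>\<mu>\<close> is thereby
  bypassed.\<close>

lemma P_measurable:
  assumes f: "bdd_cont f B"
  shows "(\<lambda>t. P t f x) \<in> borel_measurable (restrict_space borel {0..})"
proof -
  let ?N = "restrict_space borel {0::real..}"
  have sp: "t \<in> space ?N \<longleftrightarrow> 0 \<le> t" for t by (simp add: space_restrict_space)
  have shift [measurable]: "(\<lambda>y::'a. S t x + y) \<in> borel_measurable borel" for t by measurable
  define K where "K t = distr (\<mu> t) borel (\<lambda>y. S t x + y)" for t
  have K: "prob_borel (K t)" if "t \<in> space ?N" for t
    unfolding K_def using that mu_prob[of t] prob_borelD[OF mu_prob[of t]]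
    by (intro prob_borel_distr) (auto simp: sp cong: measurable_cong_sets)
  have char: "char_fun (K t) z = iexp (inner z (S t x)) * of_real (exp (- F t z))" if "t \<in> space ?N" for t z
  proof -
    have "char_fun (K t) z = (\<integral>y. iexp (inner z (S t x)) * iexp (inner z y) \<partial>\<mu> t)"
      unfolding char_fun_def K_def using that mu_prob[of t]
      by (subst integral_distr_borel) (auto simp: sp inner_add_right distrib_left exp_add)
    then show ?thesis using mu_char[of t z] that by (simp add: char_fun_def sp)
  qed
  have "(\<lambda>t. \<integral>y. f y \<partial>K t) \<in> borel_measurable ?N"
  proof (rule kernel_integral_measurable[OF K _ bdd_contD(1,2)[OF f]])
    fix z
    have "(\<lambda>t. iexp (inner z (S t x))) \<in> borel_measurable ?N"
      by (intro borel_measurable_continuous_on_restrict continuous_intros S_cont)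
    then have "(\<lambda>t. iexp (inner z (S t x)) * of_real (exp (- F t z))) \<in> borel_measurable ?N"
      using F_measurable[of z] by measurable
    then show "(\<lambda>t. char_fun (K t) z) \<in> borel_measurable ?N"
      by (subst measurable_cong[OF char]) auto
  qed
  moreover have "(\<integral>y. f y \<partial>K t) = P t f x" if "t \<in> space ?N" for t
    unfolding K_def P_def using that mu_prob[of t] bdd_contD(3)[OF f]
    by (subst integral_distr_borel) (auto simp: sp)
  ultimately show ?thesis by (subst measurable_cong) auto
qed

text \<open>The measure at time r + t is the convolution of \<open>\<mu> r\<close> with the image of
  \<open>\<mu> t\<close> under \<open>S r\<close>. Self-adjointness gives that image the exponent
  \<open>F t (S r x)\<close>, so the characteristic functions agree by \<open>F_add\<close>.\<close>

lemma mu_add: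
  assumes r: "0 \<le> r" and t: "0 \<le> t" and f: "bdd_cont f B"
  shows "(\<integral>y. f y \<partial>\<mu> (r + t)) = (\<integral>y. \<integral>z. f (S r y + z) \<partial>\<mu> r \<partial>\<mu> t)"
proof -
  have cS: "continuous_on UNIV (\<lambda>y. S r y)" by (intro continuous_intros)
  have [measurable]: "(\<lambda>y. S r y) \<in> borel_measurable borel" using cS by (rule borel_measurable_continuous_onI)
  let ?M = "distr (\<mu> t) borel (\<lambda>y. S r y)"
  have M: "prob_borel ?M"
    using mu_prob[OF t] prob_borelD[OF mu_prob[OF t]]
    by (intro prob_borel_distr) (auto cong: measurable_cong_sets)
  have charM: "char_fun ?M x = char_fun (\<mu> t) (S r x)" for x
    by (rule char_fun_distr[OF mu_prob[OF t] cS]) (simp add: S_self[OF r])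
  have eq: "char_fun (\<mu> (r + t)) x = char_fun (sum_law ?M (\<mu> r)) x" for x
    unfolding char_fun_sum_law[OF M mu_prob[OF r]] charM using r t
    by (simp add: mu_char F_add exp_diff exp_minus divide_inverse mult.commute)
  have "(\<integral>y. f y \<partial>\<mu> (r + t)) = (\<integral>y. f y \<partial>sum_law ?M (\<mu> r))"
    using r t by (intro char_fun_unique[OF mu_prob prob_borel_sum_law[OF M mu_prob] eq bdd_contD(1,2)[OF f]]) auto
  also have "\<dots> = (\<integral>y. \<integral>z. f (y + z) \<partial>\<mu> r \<partial>?M)"
    by (rule integral_sum_law[OF M mu_prob[OF r] bdd_contD(3)[OF f], of B]) (use bdd_contD[OF f] in auto)
  also have "\<dots> = (\<integral>y. \<integral>z. f (S r y + z) \<partial>\<mu> r \<partial>\<mu> t)"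
  proof (rule integral_distr_borel[OF mu_prob[OF t]])
    have [measurable_cong]: "sets (\<mu> r) = sets borel" using prob_borelD(2)[OF mu_prob[OF r]] .
    interpret sigma_finite_measure "\<mu> r" using prob_borelD(5)[OF mu_prob[OF r]] .
    show "(\<lambda>y. \<integral>z. f (y + z) \<partial>\<mu> r) \<in> borel_measurable borel"
      using bdd_contD(3)[OF f] by measurable
  qed measurable
  finally show ?thesis .
qed

lemma P_add:
  assumes r: "0 \<le> r" and t: "0 \<le> t" and f: "bdd_cont f B"
  shows "P (r + t) f x = P t (P r f) x"
proof -
  have "P (r + t) f x = (\<integral>y. \<integral>z. f (S (r + t) x + (S r y + z)) \<partial>\<mu> r \<partial>\<mu> t)"
    unfolding P_def by (rule mu_add[OF r t bdd_cont_affine(1)[OF f]])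
  also have "\<dots> = P t (P r f) x"
    by (simp add: P_def S_add[OF r t] blinfun.add_right add.assoc)
  finally show ?thesis .
qed

definition Q where "Q t x y = (LINT r:{0..t}|lborel. inner (S r x) (S r y))"

lemma Q_integrable: "set_integrable lborel {0..t} (\<lambda>r. inner (S r x) (S r y))"
  by (intro borel_integrable_atLeastAtMost' continuous_intros S_cont') auto

lemma psd_form_Q: "psd_form (Q t)"
  unfolding psd_form_def
proof safe
  fix x y
  show "linear (\<lambda>x. Q t x y)"
  proof (rule linearI)
    show "Q t (a + b) y = Q t a y + Q t b y" for a b
      unfolding Q_def using set_integral_add(2)[OF Q_integrable Q_integrable, of t a y b y]
      by (simp add: blinfun.add_right inner_add_left)
    show "Q t (r *\<^sub>R a) y = r *\<^sub>R Q t a y" for r a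
      by (simp add: Q_def blinfun.scaleR_right)
  qed
  show "Q t x y = Q t y x" by (simp add: Q_def inner_commute)
  show "0 \<le> Q t x x"
    unfolding Q_def set_lebesgue_integral_def by (intro integral_nonneg_AE) auto
qed

text \<open>Puts the exponent into the form of \<open>gaussian_direction_split\<close>: a quadratic
  form plus a part homogeneous of degree 2s. \<open>Q\<close> enters without the usual 1/2, so the
  Gaussian component of \<open>\<mu> t\<close> has covariance 2 Q.\<close>

lemma F_split: "F t x = Q t x x + (LINT r:{0..t}|lborel. c * norm (S r x) powr (2 * s))"
  unfolding F_def Q_def \<psi>_def dot_square_norm
  by (rule set_integral_add)
     (intro borel_integrable_atLeastAtMost' norm_powr_cont continuous_intros S_cont'; auto)+

text \<open>By contractivity \<open>\<parallel>S t x\<parallel>\<^sup>2\<close> is at most the mean of \<open>\<parallel>S r x\<parallel>\<^sup>2\<close> over \<open>0 \<le> r \<le> t\<close>. This is the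
  smoothing estimate \<open>\<parallel>Q\<^sub>t\<^sup>-\<^sup>1\<^sup>/\<^sup>2 S\<^sub>t\<parallel> \<le> t\<^sup>-\<^sup>1\<^sup>/\<^sup>2\<close>, stated without inverting \<open>Q\<^sub>t\<close>.\<close>

lemma Q_lower:
  assumes t: "0 \<le> t" and h: "norm h \<le> 1"
  shows "t * (inner (S t h) x)\<^sup>2 \<le> Q t x x"
proof -
  have "\<bar>inner (S t h) x\<bar> \<le> norm h * norm (S t x)"
    using Cauchy_Schwarz_ineq2[of h "S t x"] by (simp add: S_self[OF t])
  also have "\<dots> \<le> 1 * norm (S t x)" using h by (intro mult_right_mono) auto
  finally have "(inner (S t h) x)\<^sup>2 \<le> (norm (S t x))\<^sup>2"
    by (metis abs_ge_zero mult_1 power2_abs power_mono)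
  then have "t * (inner (S t h) x)\<^sup>2 \<le> (LINT r:{0..t}|lborel. (norm (S t x))\<^sup>2)"
    using t by (simp add: set_lebesgue_integral_def mult_left_mono)
  also have "\<dots> \<le> Q t x x"
    unfolding Q_def
  proof (rule set_integral_mono)
    show "set_integrable lborel {0..t} (\<lambda>r. (norm (S t x))\<^sup>2)"
      by (intro borel_integrable_atLeastAtMost' continuous_intros)
    show "set_integrable lborel {0..t} (\<lambda>r. inner (S r x) (S r x))" by (rule Q_integrable)
    fix r assume r: "r \<in> {0..t}"
    have "S t x = S (t - r) (S r x)" using S_add[of "t - r" r] r by simp
    then have "norm (S t x) \<le> norm (S r x)" using S_contr[of "t - r" "S r x"] r by simp
    then show "(norm (S t x))\<^sup>2 \<le> inner (S r x) (S r x)" by (simp add: dot_square_norm power_mono)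
  qed
  finally show ?thesis .
qed

definition hoelder :: "real \<Rightarrow> real \<Rightarrow> ('a \<Rightarrow> real) \<Rightarrow> bool" where
  "hoelder \<alpha> H f \<longleftrightarrow> 0 \<le> H \<and> (\<forall>x y. \<bar>f x - f y\<bar> \<le> H * norm (x - y) powr \<alpha>)"

text \<open>Moving \<open>x\<close> by b h moves the integrand by b \<open>S t h\<close>, so the
  Gaussian smoothing is applied along \<open>S t h\<close> with \<tau> = sqrt t;
  \<open>Q_lower\<close> says precisely that this direction is covered.\<close>

lemma P_direction:
  assumes t: "0 < t" and f: "bdd_cont f B" and h: "norm h \<le> 1"
  obtains D where "\<bar>D\<bar> \<le> B / sqrt t"
    "\<And>b. \<bar>P t f (x + b *\<^sub>R h) - P t f x - b * D\<bar> \<le> 3 * B / t * b\<^sup>2"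
    "\<And>H \<alpha>. 0 < \<alpha> \<Longrightarrow> \<alpha> < 1 \<Longrightarrow> hoelder \<alpha> H f \<Longrightarrow> \<bar>D\<bar> \<le> 2 * H * t powr ((\<alpha> - 1) / 2)"
proof -
  let ?f = "\<lambda>y. f (S t x + y)"
  have f': "bdd_cont ?f B" by (rule bdd_cont_affine(1)[OF f])
  obtain D where D: "\<bar>D\<bar> \<le> B / sqrt t"
    "\<And>b. \<bar>(\<integral>y. ?f (y + b *\<^sub>R S t h) \<partial>\<mu> t) - (\<integral>y. ?f y \<partial>\<mu> t) - b * D\<bar> \<le> 3 * B * b\<^sup>2 / (sqrt t)\<^sup>2"
    "\<And>H \<alpha>. 0 < \<alpha> \<Longrightarrow> \<alpha> < 1 \<Longrightarrow> 0 \<le> H \<Longrightarrow> (\<And>x y. \<bar>?f x - ?f y\<bar> \<le> H * norm (x - y) powr \<alpha>) \<Longrightarrow>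
      \<bar>D\<bar> \<le> 2 * H * sqrt t powr (\<alpha> - 1)"
  proof (rule gaussian_direction_derivative[OF mu_prob[of t] s _ psd_form_Q, where k = "S t h" and \<tau> = "sqrt t"
        and g = "\<lambda>x. LINT r:{0..t}|lborel. c * norm (S r x) powr (2 * s)"])
    show "char_fun (\<mu> t) x = of_real (exp (- (Q t x x + (LINT r:{0..t}|lborel. c * norm (S r x) powr (2 * s)))))" for x
      using t by (simp only: mu_char F_split less_imp_le)
    show "(LINT r:{0..t}|lborel. c * norm (S r (a *\<^sub>R x)) powr (2 * s)) =
       a powr (2 * s) * (LINT r:{0..t}|lborel. c * norm (S r x) powr (2 * s))" if "0 < a" for a x
      using that by (simp add: blinfun.scaleR_right powr_mult mult.left_commute[of c] flip: set_integral_mult_right)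
    show "(sqrt t)\<^sup>2 * (inner (S t h) x)\<^sup>2 \<le> Q t x x" for x using Q_lower[of t h x] t h by simp
    show "norm (S t h) \<le> 1" using S_contr[of t h] t h by simp
    show "continuous_on UNIV ?f" "\<And>y. \<bar>?f y\<bar> \<le> B" using bdd_contD[OF f'] by auto
  qed (use t in auto)
  show ?thesis
  proof (rule that[of D])
    show "\<bar>D\<bar> \<le> B / sqrt t" by fact
    show "\<bar>P t f (x + b *\<^sub>R h) - P t f x - b * D\<bar> \<le> 3 * B / t * b\<^sup>2" for b
      using D(2)[of b] t by (simp add: P_def blinfun.add_right blinfun.scaleR_right add.commute add.left_commute)
    fix H \<alpha> assume *: "0 < \<alpha>" "\<alpha> < 1" "hoelder \<alpha> H f"
    have "\<bar>D\<bar> \<le> 2 * H * sqrt t powr (\<alpha> - 1)"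
    proof (rule D(3))
      show "\<bar>f (S t x + y) - f (S t x + z)\<bar> \<le> H * norm (y - z) powr \<alpha>" for y z
        using *(3)[unfolded hoelder_def, THEN conjunct2, rule_format, of "S t x + y" "S t x + z"] by simp
    qed (use * in \<open>auto simp: hoelder_def\<close>)
    then show "\<bar>D\<bar> \<le> 2 * H * t powr ((\<alpha> - 1) / 2)"
      using t by (simp add: powr_half_sqrt[symmetric] powr_powr)
  qed
qed

text \<open>The remainder constant is quantified away, because derivatives with quadratic remainder
  coincide whatever their constants. The value is meaningful for t > 0, where such a derivative
  exists.\<close>

definition DP :: "real \<Rightarrow> ('a \<Rightarrow> real) \<Rightarrow> 'a \<Rightarrow> 'a \<Rightarrow>\<^sub>L real" where
  "DP t f x = (SOME D. \<exists>K. quad_deriv (P t f) D x K)"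

lemma DP_eq: "quad_deriv (P t f) D x K \<Longrightarrow> DP t f x = D"
  unfolding DP_def by (rule some_equality) (blast intro: quad_deriv_unique)+

lemma DP:
  assumes t: "0 < t" and f: "bdd_cont f B"
  shows DP_quad_deriv: "quad_deriv (P t f) (DP t f x) x (3 * B / t)"
    and norm_DP_le: "norm (DP t f x) \<le> B / sqrt t"
    and norm_DP_hoelder_le: "0 < \<alpha> \<Longrightarrow> \<alpha> < 1 \<Longrightarrow> hoelder \<alpha> H f \<Longrightarrow>
      norm (DP t f x) \<le> 2 * H * t powr ((\<alpha> - 1) / 2)"
proof -
  have K: "0 \<le> B / sqrt t" "0 \<le> 3 * B / t" using t bdd_contD(4)[OF f] by auto
  have "\<exists>L. norm L \<le> B / sqrt t \<and> quad_deriv (P t f) L x (3 * B / t)"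
    using K
    by (intro quad_deriv_of_directional) (metis P_direction[OF t f] order_refl)
  then show q: "quad_deriv (P t f) (DP t f x) x (3 * B / t)" and "norm (DP t f x) \<le> B / sqrt t"
    using DP_eq by blast+
  assume \<alpha>: "0 < \<alpha>" "\<alpha> < 1" and H: "hoelder \<alpha> H f"
  show "norm (DP t f x) \<le> 2 * H * t powr ((\<alpha> - 1) / 2)"
  proof (rule norm_blinfun_bound_sphere[of 1])
    fix h :: 'a assume h: "norm h = 1"
    obtain D where D: "\<And>b. \<bar>P t f (x + b *\<^sub>R h) - P t f x - b * D\<bar> \<le> 3 * B / t * b\<^sup>2"
      "\<bar>D\<bar> \<le> 2 * H * t powr ((\<alpha> - 1) / 2)"
      using P_direction[OF t f, of h x] \<alpha> H h by (metis order_refl)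
    \<comment> \<open>The \<open>D\<close> carrying the Hoelder bound was produced by a separate
      choice; both it and \<open>DP t f x h\<close> approximate the same increments up to a
      quadratic error, hence they are equal.\<close>
    have "DP t f x h - D = 0"
    proof (rule linear_quadratic_zero)
      fix b :: real assume "0 < b"
      define K where "K = 3 * B / t"
      show "\<bar>(DP t f x h - D) * b\<bar> \<le> (2 * K) * b\<^sup>2"
        using D(1)[of b, folded K_def] quad_derivD[OF q[folded K_def], of "b *\<^sub>R h"] h
        by (simp add: blinfun.scaleR_right algebra_simps abs_le_iff)
    qed
    then show "norm (DP t f x h) \<le> 2 * H * t powr ((\<alpha> - 1) / 2) * 1" using D(2) by simp
  qed (use H in \<open>auto simp: hoelder_def\<close>)
qed

text \<open>The remainder constant is the same at all points, so the derivative is Lipschitz with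
  constant 18 B / t and \<open>P\<close> may be applied to it. The bound \<open>A\<close> is kept
  free so that the gradient bound for Hoelder data can be inserted as well.\<close>

lemma DP_bdd_cont:
  assumes t: "0 < t" and f: "bdd_cont f B" and A: "\<And>x. norm (DP t f x) \<le> A"
  shows "bdd_cont (\<lambda>x. DP t f x h) (A * norm h)"
  unfolding bdd_cont_def
proof safe
  have K: "0 \<le> 3 * B / t" using t bdd_contD(4)[OF f] by auto
  have "\<bar>DP t f x h - DP t f y h\<bar> \<le> 18 * B / t * norm h * norm (x - y)" for x y
  proof -
    have "\<bar>DP t f x h - DP t f y h\<bar> \<le> norm (DP t f x - DP t f y) * norm h"
      using norm_blinfun[of "DP t f x - DP t f y" h] by (simp add: blinfun.diff_left)
    also have "\<dots> \<le> (6 * (3 * B / t) * norm (x - y)) * norm h"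
      by (intro mult_right_mono quad_deriv_lipschitz[OF DP_quad_deriv[OF t f] DP_quad_deriv[OF t f] K]) auto
    finally show ?thesis by (simp add: mult_ac)
  qed
  then have "(18 * B / t * norm h)-lipschitz_on UNIV (\<lambda>x. DP t f x h)"
    using t bdd_contD(4)[OF f] by (intro lipschitz_onI) (auto simp: dist_norm)
  then show "continuous_on UNIV (\<lambda>x. DP t f x h)" by (rule lipschitz_on_continuous_on)
  show "\<bar>DP t f x h\<bar> \<le> A * norm h" for x
    using norm_blinfun[of "DP t f x" h] mult_right_mono[OF A[of x], of "norm h"] by simp
qed

text \<open>The quadratic remainder of \<open>P r f\<close> is integrated against
  \<open>\<mu> t\<close>. As \<open>S t\<close> is a contraction, the result is still quadratic in
  \<open>h\<close>, so the integrated derivative must be the derivative of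
  \<open>P (r + t) f\<close>.\<close>

lemma DP_add:
  assumes r: "0 < r" and t: "0 < t" and f: "bdd_cont f B"
  shows "DP (r + t) f x h = P t (\<lambda>z. DP r f z (S t h)) x"
proof -
  have bc: "bdd_cont (\<lambda>z. DP r f z (S t h)) (B / sqrt r * norm (S t h))" for h
    by (rule DP_bdd_cont[OF r f norm_DP_le[OF r f]])
  have Pr: "bdd_cont (P r f) B" using P_bdd_cont[OF _ f] r by simp
  have "P (r + t) f y = P t (P r f) y" for y using P_add[OF _ _ f] r t by simp
  then have Peq: "P (r + t) f = P t (P r f)" by blast
  have K: "0 \<le> 3 * B / r" using r bdd_contD(4)[OF f] by auto
  let ?L = "\<lambda>h. P t (\<lambda>z. DP r f z (S t h)) x"
  have "0 < r + t" using r t by simp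
  have "DP (r + t) f x h - ?L h = 0"
  proof (rule linear_quadratic_zero)
    fix b :: real assume b: "0 < b"
    have L: "?L (b *\<^sub>R h) = b * ?L h" by (simp add: P_def blinfun.scaleR_right)
    have "P t (P r f) (x + b *\<^sub>R h) - P t (P r f) x - ?L (b *\<^sub>R h) =
      (\<integral>y. P r f (S t x + y + S t (b *\<^sub>R h)) - P r f (S t x + y) - DP r f (S t x + y) (S t (b *\<^sub>R h)) \<partial>\<mu> t)"
      using P_integrable[OF less_imp_le[OF t] Pr, of "x + b *\<^sub>R h"] P_integrable[OF less_imp_le[OF t] Pr, of x]
        P_integrable[OF less_imp_le[OF t] bc, of x "b *\<^sub>R h"]
      by (simp add: P_def blinfun.add_right add.assoc add.commute[of "S t (b *\<^sub>R h)"])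
    also have "\<bar>\<dots>\<bar> \<le> 3 * B / r * (norm (S t (b *\<^sub>R h)))\<^sup>2"
      by (rule prob_borel_integral_le[OF mu_prob[OF less_imp_le[OF t]]])
         (rule quad_derivD[OF DP_quad_deriv[OF r f]])
    also have "\<dots> \<le> 3 * B / r * (norm (b *\<^sub>R h))\<^sup>2"
      using S_contr[of t "b *\<^sub>R h"] t K by (intro mult_left_mono power_mono) auto
    finally have 1: "\<bar>P (r + t) f (x + b *\<^sub>R h) - P (r + t) f x - b * ?L h\<bar> \<le> 3 * B / r * (norm (b *\<^sub>R h))\<^sup>2"
      by (simp only: Peq L)
    show "\<bar>(DP (r + t) f x h - ?L h) * b\<bar> \<le> (3 * B / r + 3 * B / (r + t)) * (norm h)\<^sup>2 * b\<^sup>2"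
      using 1 quad_derivD[OF DP_quad_deriv[OF \<open>0 < r + t\<close> f], of x "b *\<^sub>R h"]
      by (simp add: blinfun.scaleR_right power_mult_distrib algebra_simps abs_le_iff)
  qed
  then show ?thesis by simp
qed

text \<open>With time halved, \<open>DP t f x h\<close> equals \<open>P (t/2)\<close> applied to a
  bounded continuous function \<open>g h\<close> of size at most A \<parallel>h\<parallel>, and the
  first order results apply to \<open>g h\<close>. Its gradient depends linearly on \<open>h\<close>
  by uniqueness of derivatives. The remainder constant 3 A / (t/2) is 6 A / t, and the Lipschitz
  constant is six times that.\<close>

lemma second_derivative:
  assumes t: "0 < t" and f: "bdd_cont f B" and A: "\<And>x. norm (DP (t / 2) f x) \<le> A"
  shows "\<exists>D2 :: 'a \<Rightarrow> 'a \<Rightarrow>\<^sub>L 'a \<Rightarrow>\<^sub>L real. \<forall>x. norm (D2 x) \<le> A / sqrt (t / 2) \<and>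
      (\<forall>h k. \<bar>DP t f (x + k) h - DP t f x h - apply2 (D2 x) k h\<bar> \<le> 6 * A / t * norm h * (norm k)\<^sup>2) \<and>
      (\<forall>y. norm (D2 y - D2 x) \<le> 36 * A / t * norm (y - x))"
proof -
  let ?r = "t / 2"
  have r: "0 < ?r" using t by simp
  have A0: "0 \<le> A" using order_trans[OF norm_ge_zero A] .
  define g where "g h z = DP ?r f z (S ?r h)" for h z
  have g: "bdd_cont (g h) (A * norm h)" for h
    using DP_bdd_cont[OF r f A, of "S ?r h"] S_contr[of ?r h] A0 t
    unfolding g_def bdd_cont_def by (meson less_imp_le mult_left_mono order_trans r)
  have Pg: "DP t f x h = P ?r (g h) x" for x h
    using DP_add[OF r r f, of x h] by (simp add: g_def[abs_def])
  have q: "quad_deriv (\<lambda>x. DP t f x h) (DP ?r (g h) x) x (6 * A / t * norm h)" for x h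
    using DP_quad_deriv[OF r g, of h x] unfolding Pg by (simp add: mult_ac)
  have n: "norm (DP ?r (g h) x) \<le> A / sqrt ?r * norm h" for x h
    using norm_DP_le[OF r g, of h x] by simp
  have add: "DP ?r (g (h + h')) x = DP ?r (g h) x + DP ?r (g h') x" for h h' x
  proof (rule quad_deriv_unique[OF q])
    show "quad_deriv (\<lambda>x. DP t f x (h + h')) (DP ?r (g h) x + DP ?r (g h') x) x
        (6 * A / t * norm h + 6 * A / t * norm h')"
      unfolding quad_deriv_def
    proof
      fix k
      show "\<bar>DP t f (x + k) (h + h') - DP t f x (h + h') - (DP ?r (g h) x + DP ?r (g h') x) k\<bar>
        \<le> (6 * A / t * norm h + 6 * A / t * norm h') * (norm k)\<^sup>2"
        using quad_derivD[OF q, of x k h] quad_derivD[OF q, of x k h']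
        by (simp only: blinfun.add_right blinfun.add_left distrib_right)
    qed
  qed
  have scale: "DP ?r (g (a *\<^sub>R h)) x = a *\<^sub>R DP ?r (g h) x" for a h x
  proof (rule quad_deriv_unique[OF q])
    show "quad_deriv (\<lambda>x. DP t f x (a *\<^sub>R h)) (a *\<^sub>R DP ?r (g h) x) x (\<bar>a\<bar> * (6 * A / t * norm h))"
      unfolding quad_deriv_def
    proof
      fix k
      have "\<bar>DP t f (x + k) (a *\<^sub>R h) - DP t f x (a *\<^sub>R h) - (a *\<^sub>R DP ?r (g h) x) k\<bar> =
         \<bar>a\<bar> * \<bar>DP t f (x + k) h - DP t f x h - DP ?r (g h) x k\<bar>"
        by (simp add: blinfun.scaleR_right blinfun.scaleR_left right_diff_distrib flip: abs_mult)
      also have "\<dots> \<le> \<bar>a\<bar> * (6 * A / t * norm h * (norm k)\<^sup>2)"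
        by (intro mult_left_mono quad_derivD[OF q]) auto
      finally show "\<bar>DP t f (x + k) (a *\<^sub>R h) - DP t f x (a *\<^sub>R h) - (a *\<^sub>R DP ?r (g h) x) k\<bar>
         \<le> \<bar>a\<bar> * (6 * A / t * norm h) * (norm k)\<^sup>2" by (simp add: mult.assoc)
    qed
  qed
  have nn: "\<bar>DP ?r (g h) x k\<bar> \<le> A / sqrt ?r * norm k * norm h" for x h k
    using norm_blinfun[of "DP ?r (g h) x" k] mult_right_mono[OF n[of h x], of "norm k"]
    by (simp add: mult.commute mult.left_commute)
  have "\<exists>L :: 'a \<Rightarrow>\<^sub>L 'a \<Rightarrow>\<^sub>L real. norm L \<le> A / sqrt ?r \<and>
      (\<forall>k h. apply2 L k h = DP ?r (g h) x k)" for x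
    by (rule bilinear_blinfun_exists)
       (use nn A0 t in \<open>auto simp: add scale blinfun.add_left blinfun.add_right
          blinfun.scaleR_left blinfun.scaleR_right\<close>)
  then obtain D2 :: "'a \<Rightarrow> 'a \<Rightarrow>\<^sub>L 'a \<Rightarrow>\<^sub>L real" where D2: "\<And>x. norm (D2 x) \<le> A / sqrt ?r"
    "\<And>x k h. apply2 (D2 x) k h = DP ?r (g h) x k" by metis
  show ?thesis
  proof (intro exI[of _ D2] allI conjI)
    fix x
    show "norm (D2 x) \<le> A / sqrt ?r"
      by (rule D2(1))
    show "\<bar>DP t f (x + k) h - DP t f x h - apply2 (D2 x) k h\<bar> \<le> 6 * A / t * norm h * (norm k)\<^sup>2" for h k
      unfolding D2(2) by (rule quad_derivD[OF q])
    fix y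
    show "norm (D2 y - D2 x) \<le> 36 * A / t * norm (y - x)"
    proof (rule norm_blinfun_bound)
      show "0 \<le> 36 * A / t * norm (y - x)" using A0 t by simp
      fix k
      show "norm (blinfun_apply (D2 y - D2 x) k) \<le> 36 * A / t * norm (y - x) * norm k"
      proof (rule norm_blinfun_bound)
        show "0 \<le> 36 * A / t * norm (y - x) * norm k" using A0 t by simp
        fix h
        have "norm (DP ?r (g h) y - DP ?r (g h) x) \<le> 6 * (6 * A / t * norm h) * norm (y - x)"
          using A0 t by (intro quad_deriv_lipschitz[OF q q]) simp
        then have "norm (DP ?r (g h) y - DP ?r (g h) x) * norm k \<le> 6 * (6 * A / t * norm h) * norm (y - x) * norm k"
          by (rule mult_right_mono) simp
        then show "norm (apply2 (D2 y - D2 x) k h) \<le> 36 * A / t * norm (y - x) * norm k * norm h"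
          using norm_blinfun[of "DP ?r (g h) y - DP ?r (g h) x" k]
          by (simp add: blinfun.diff_left D2(2) mult_ac)
      qed
    qed
  qed
qed

end

section \<open>Laplace transforms in time\<close>

text \<open>The weight exp (- lam t) dt on the open half-line: Laplace transforms become integrals
  against one finite measure, and t = 0, where no gradient is available, is outside the
  space.\<close>

definition exp_measure :: "real \<Rightarrow> real measure" where
  "exp_measure lam = density (restrict_space lborel {0<..}) (\<lambda>t. ennreal (exp (- lam * t)))"

lemma space_exp_measure: "space (exp_measure lam) = {0<..}"
  by (simp add: exp_measure_def space_restrict_space)

lemma measurable_exp_measure:
  "borel_measurable (exp_measure lam) = borel_measurable (restrict_space borel {0<..})"
  unfolding exp_measure_def by (intro measurable_cong_sets) (simp_all add: sets_restrict_space)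

lemma integral_exp_measure:
  fixes \<phi> :: "real \<Rightarrow> real"
  assumes "\<phi> \<in> borel_measurable (restrict_space borel {0<..})"
  shows "(\<integral>t. \<phi> t \<partial>exp_measure lam) = (LINT t:{0..}|lborel. exp (- lam * t) * \<phi> t)"
proof -
  have m: "\<phi> \<in> borel_measurable (restrict_space lborel {0<..})"
    using assms by (subst measurable_cong_sets[OF _ refl]) (auto simp: sets_restrict_space)
  have "(\<integral>t. \<phi> t \<partial>exp_measure lam) = (\<integral>t. exp (- lam * t) *\<^sub>R \<phi> t \<partial>restrict_space lborel {0<..})"
    unfolding exp_measure_def
    by (rule integral_density[OF m]) (auto intro!: measurable_restrict_space1)
  also have "\<dots> = (LINT t:{0<..}|lborel. exp (- lam * t) * \<phi> t)"
    unfolding set_lebesgue_integral_def by (subst integral_restrict_space) simp_all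
  also have "\<dots> = (LINT t:{0..}|lborel. exp (- lam * t) * \<phi> t)"
  proof (rule set_integral_cong_set)
    show "AE t::real in lborel. (t \<in> {0..}) = (t \<in> {0<..})"
      by (rule AE_mp[OF AE_lborel_singleton[of 0]]) (auto intro!: AE_I2)
    show 1: "set_borel_measurable lborel {0<..} (\<lambda>t. exp (- lam * t) * \<phi> t)"
    proof -
      have "(\<lambda>t. exp (- lam * t) * \<phi> t) \<in> borel_measurable (restrict_space borel {0<..})"
        by (rule borel_measurable_times[OF measurable_restrict_space1 assms]) measurable
      then show ?thesis
        by (simp add: set_borel_measurable_def borel_measurable_restrict_space_iff)
    qed
    \<comment> \<open>The hypothesis says nothing about the value of \<phi> at 0; isolating that
      point shows that the extended integrand is measurable all the same.\<close>
    have "indicator {0..} t *\<^sub>R (exp (- lam * t) * \<phi> t) = indicator {0<..} t *\<^sub>R (exp (- lam * t) * \<phi> t)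
        + indicator {0::real} t *\<^sub>R \<phi> 0" for t
      by (auto simp: indicator_def)
    moreover have "(\<lambda>t. indicator {0<..} t *\<^sub>R (exp (- lam * t) * \<phi> t) + indicator {0::real} t *\<^sub>R \<phi> 0)
        \<in> borel_measurable lborel"
      using 1 by (intro borel_measurable_add) (auto simp: set_borel_measurable_def)
    ultimately show "set_borel_measurable lborel {0..} (\<lambda>t. exp (- lam * t) * \<phi> t)"
      by (simp add: set_borel_measurable_def)
  qed
  finally show ?thesis .
qed

lemma nn_integral_exp_measure:
  assumes g: "g \<in> borel_measurable borel"
  shows "(\<integral>\<^sup>+t. g t \<partial>exp_measure lam) = (\<integral>\<^sup>+t. ennreal (exp (- lam * t)) * g t * indicator {0<..} t \<partial>lborel)"
proof -
  have "(\<integral>\<^sup>+t. g t \<partial>exp_measure lam) = (\<integral>\<^sup>+t. ennreal (exp (- lam * t)) * g t \<partial>restrict_space lborel {0<..})"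
    unfolding exp_measure_def using g
    by (intro nn_integral_density) (auto intro!: measurable_restrict_space1)
  also have "\<dots> = (\<integral>\<^sup>+t. ennreal (exp (- lam * t)) * g t * indicator {0<..} t \<partial>lborel)"
    by (rule nn_integral_restrict_space) simp
  finally show ?thesis .
qed

lemma nn_integral_exp_measure_le:
  assumes lam: "0 < lam" and g: "g \<in> borel_measurable borel"
  shows "(\<integral>\<^sup>+t. g t \<partial>exp_measure lam) \<le> (\<integral>\<^sup>+t. g t * indicator {0<..} t \<partial>lborel)"
  unfolding nn_integral_exp_measure[OF g]
proof (rule nn_integral_mono)
  fix t :: real
  have "ennreal (exp (- lam * t)) * g t \<le> 1 * g t" if "0 < t"
    using lam that by (intro mult_right_mono) (auto simp: ennreal_le_1)
  then show "ennreal (exp (- lam * t)) * g t * indicator {0<..} t \<le> g t * indicator {0<..} t"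
    by (auto simp: indicator_def)
qed

lemma exp_measure_total:
  assumes lam: "0 < lam"
  shows "(\<integral>\<^sup>+t. 1 \<partial>exp_measure lam) \<le> ennreal (1 / lam)"
proof -
  have "(\<integral>\<^sup>+t. 1 \<partial>exp_measure lam) = (\<integral>\<^sup>+t. ennreal (exp (- lam * t)) * 1 * indicator {0<..} t \<partial>lborel)"
    by (rule nn_integral_exp_measure) simp
  also have "\<dots> \<le> (\<integral>\<^sup>+t. ennreal (exp (- lam * t)) * indicator {0..} t \<partial>lborel)"
    by (rule nn_integral_mono) (auto simp: indicator_def)
  also have "\<dots> = ennreal (1 / lam)"
    using has_integral_exp_minus_to_infinity[OF lam, of 0] by (intro nn_integral_has_integral_lebesgue') auto
  finally show ?thesis .
qed

lemma exp_measure_powr_small: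
  assumes lam: "0 < lam" and p: "p < 1" and b: "0 \<le> b"
  shows "(\<integral>\<^sup>+t. ennreal (t powr (- p)) * indicator {..b} t \<partial>exp_measure lam) \<le> ennreal (b powr (1 - p) / (1 - p))"
proof -
  have "(\<integral>\<^sup>+t. ennreal (t powr (- p)) * indicator {..b} t \<partial>exp_measure lam) \<le>
     (\<integral>\<^sup>+t. ennreal (t powr (- p)) * indicator {..b} t * indicator {0<..} t \<partial>lborel)"
    by (rule nn_integral_exp_measure_le[OF lam]) measurable
  also have "\<dots> \<le> (\<integral>\<^sup>+t. ennreal (t powr (- p)) * indicator {0..b} t \<partial>lborel)"
    by (rule nn_integral_mono) (auto simp: indicator_def)
  also have "\<dots> = ennreal (b powr (- p + 1) / (- p + 1))"
    using p b by (intro nn_integral_has_integral_lebesgue' has_integral_powr_from_0) auto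
  finally show ?thesis by (simp add: add.commute)
qed

lemma exp_measure_powr_large:
  assumes lam: "0 < lam" and q: "1 < q" and b: "0 < b"
  shows "(\<integral>\<^sup>+t. ennreal (t powr (- q)) * indicator {b<..} t \<partial>exp_measure lam) \<le> ennreal (b powr (1 - q) / (q - 1))"
proof -
  have "(\<integral>\<^sup>+t. ennreal (t powr (- q)) * indicator {b<..} t \<partial>exp_measure lam) \<le>
     (\<integral>\<^sup>+t. ennreal (t powr (- q)) * indicator {b<..} t * indicator {0<..} t \<partial>lborel)"
    by (rule nn_integral_exp_measure_le[OF lam]) measurable
  also have "\<dots> \<le> (\<integral>\<^sup>+t. ennreal (t powr (- q)) * indicator {b..} t \<partial>lborel)"
    by (rule nn_integral_mono) (auto simp: indicator_def)
  also have "\<dots> = ennreal (- (b powr (- q + 1)) / (- q + 1))"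
    using q b by (intro nn_integral_has_integral_lebesgue' has_integral_powr_to_inf) auto
  also have "- (b powr (- q + 1)) / (- q + 1) = b powr (1 - q) / (q - 1)"
  proof -
    have "- q + 1 = - (q - 1)" "1 - q = - (q - 1)" by simp_all
    then show ?thesis by (simp only: minus_divide_divide)
  qed
  finally show ?thesis .
qed

lemma exp_measure_bound:
  fixes \<phi> m :: "real \<Rightarrow> real"
  assumes \<phi>: "\<phi> \<in> borel_measurable (restrict_space borel {0<..})"
    and le: "\<And>t. 0 < t \<Longrightarrow> ennreal \<bar>\<phi> t\<bar> \<le> g t" and C: "(\<integral>\<^sup>+t. g t \<partial>exp_measure lam) \<le> ennreal C" "0 \<le> C"
  shows "integrable (exp_measure lam) \<phi>" "\<bar>\<integral>t. \<phi> t \<partial>exp_measure lam\<bar> \<le> C"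
proof -
  have "(\<integral>\<^sup>+t. ennreal (norm (\<phi> t)) \<partial>exp_measure lam) \<le> (\<integral>\<^sup>+t. g t \<partial>exp_measure lam)"
    using le by (intro nn_integral_mono) (auto simp: space_exp_measure)
  then have C': "(\<integral>\<^sup>+t. ennreal (norm (\<phi> t)) \<partial>exp_measure lam) \<le> ennreal C" using C(1) by simp
  show i: "integrable (exp_measure lam) \<phi>"
    using \<phi> le_less_trans[OF C' ennreal_less_top]
    by (intro integrableI_bounded) (auto simp: measurable_exp_measure)
  have "ennreal (norm (\<integral>t. \<phi> t \<partial>exp_measure lam)) \<le> ennreal C"
    using integral_norm_bound_ennreal[OF i] C' by simp
  then show "\<bar>\<integral>t. \<phi> t \<partial>exp_measure lam\<bar> \<le> C" using C(2) by simp
qed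

text \<open>For 0 \<le> p < 1 an upper bound of the Laplace transform of t^(-p) at lam: 1/(1 - p)
  comes from t \<le> 1, and 1/lam from t > 1, where t^(-p) \<le> 1.\<close>

definition exp_powr_const :: "real \<Rightarrow> real \<Rightarrow> real" where
  "exp_powr_const lam p = 1 / (1 - p) + 1 / lam"

lemma exp_measure_bound_powr:
  fixes \<phi> :: "real \<Rightarrow> real"
  assumes lam: "0 < lam" and p: "0 \<le> p" "p < 1" and A: "0 \<le> A"
    and \<phi>: "\<phi> \<in> borel_measurable (restrict_space borel {0<..})"
    and le: "\<And>t. 0 < t \<Longrightarrow> \<bar>\<phi> t\<bar> \<le> A * t powr (- p)"
  shows "integrable (exp_measure lam) \<phi>" "\<bar>\<integral>t. \<phi> t \<partial>exp_measure lam\<bar> \<le> A * exp_powr_const lam p"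
proof -
  let ?g = "\<lambda>t. ennreal A * (ennreal (t powr (- p)) * indicator {..1} t + 1)"
  have g: "ennreal \<bar>\<phi> t\<bar> \<le> ?g t" if t: "0 < t" for t
  proof -
    have "ennreal (t powr (- p)) \<le> ennreal (t powr (- p)) * indicator {..1} t + 1"
    proof (cases "t \<le> 1")
      case True
      then show ?thesis by simp
    next
      case False
      then have "t powr (- p) \<le> t powr 0" using p by (intro powr_mono) auto
      then show ?thesis using False by (simp add: ennreal_le_1)
    qed
    then have "ennreal A * ennreal (t powr (- p)) \<le> ?g t" by (rule mult_left_mono) simp
    moreover have "ennreal \<bar>\<phi> t\<bar> \<le> ennreal A * ennreal (t powr (- p))"
      using le[OF t] A by (simp add: ennreal_mult[symmetric] ennreal_leI)
    ultimately show ?thesis by simp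
  qed
  have m: "(\<lambda>t. ennreal (t powr (- p)) * indicator {..1} t) \<in> borel_measurable (exp_measure lam)"
    unfolding measurable_exp_measure by (intro measurable_restrict_space1) measurable
  have "(\<integral>\<^sup>+t. ?g t \<partial>exp_measure lam) =
     ennreal A * ((\<integral>\<^sup>+t. ennreal (t powr (- p)) * indicator {..1} t \<partial>exp_measure lam) + (\<integral>\<^sup>+t. 1 \<partial>exp_measure lam))"
    using m by (subst nn_integral_cmult) (auto simp: nn_integral_add)
  also have "\<dots> \<le> ennreal A * (ennreal (1 powr (1 - p) / (1 - p)) + ennreal (1 / lam))"
    by (intro mult_left_mono add_mono exp_measure_powr_small[OF lam p(2)] exp_measure_total[OF lam]) auto
  also have "\<dots> = ennreal (A * exp_powr_const lam p)"
    using A p lam by (simp add: exp_powr_const_def ennreal_mult ennreal_plus)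
  finally have C: "(\<integral>\<^sup>+t. ?g t \<partial>exp_measure lam) \<le> ennreal (A * exp_powr_const lam p)" .
  have "0 \<le> A * exp_powr_const lam p" using A p lam by (simp add: exp_powr_const_def)
  then show "integrable (exp_measure lam) \<phi>" "\<bar>\<integral>t. \<phi> t \<partial>exp_measure lam\<bar> \<le> A * exp_powr_const lam p"
    using exp_measure_bound[OF \<phi> g C] by auto
qed

text \<open>The first majorant is integrated up to \<open>b\<close> and the second beyond it, each
  on the side where it is integrable without the help of the exponential weight.\<close>

lemma exp_measure_bound_two_powr:
  fixes \<phi> :: "real \<Rightarrow> real"
  assumes lam: "0 < lam" and p: "p < 1" and q: "1 < q" and b: "0 < b" and A: "0 \<le> A" and B: "0 \<le> B"
    and \<phi>: "\<phi> \<in> borel_measurable (restrict_space borel {0<..})"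
    and le: "\<And>t. 0 < t \<Longrightarrow> \<bar>\<phi> t\<bar> \<le> A * t powr (- p)" "\<And>t. 0 < t \<Longrightarrow> \<bar>\<phi> t\<bar> \<le> B * t powr (- q)"
  shows "\<bar>\<integral>t. \<phi> t \<partial>exp_measure lam\<bar> \<le> A * (b powr (1 - p) / (1 - p)) + B * (b powr (1 - q) / (q - 1))"
proof -
  let ?g = "\<lambda>t. ennreal A * (ennreal (t powr (- p)) * indicator {..b} t)
      + ennreal B * (ennreal (t powr (- q)) * indicator {b<..} t)"
  have g: "ennreal \<bar>\<phi> t\<bar> \<le> ?g t" if t: "0 < t" for t
    using le[OF t] A B by (cases "t \<le> b") (simp_all add: ennreal_mult[symmetric] ennreal_leI)
  have m: "(\<lambda>t. ennreal (t powr (- p)) * indicator {..b} t) \<in> borel_measurable (exp_measure lam)"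
    "(\<lambda>t. ennreal (t powr (- q)) * indicator {b<..} t) \<in> borel_measurable (exp_measure lam)"
    unfolding measurable_exp_measure by (intro measurable_restrict_space1; measurable)+
  have "(\<integral>\<^sup>+t. ?g t \<partial>exp_measure lam) =
     ennreal A * (\<integral>\<^sup>+t. ennreal (t powr (- p)) * indicator {..b} t \<partial>exp_measure lam) +
     ennreal B * (\<integral>\<^sup>+t. ennreal (t powr (- q)) * indicator {b<..} t \<partial>exp_measure lam)"
    using m by (subst nn_integral_add) (auto simp: nn_integral_cmult)
  also have "\<dots> \<le> ennreal A * ennreal (b powr (1 - p) / (1 - p)) + ennreal B * ennreal (b powr (1 - q) / (q - 1))"
    using b by (intro mult_left_mono add_mono exp_measure_powr_small[OF lam p] exp_measure_powr_large[OF lam q]) auto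
  also have "\<dots> = ennreal (A * (b powr (1 - p) / (1 - p)) + B * (b powr (1 - q) / (q - 1)))"
  proof -
    have "0 \<le> b powr (1 - p) / (1 - p)" "0 \<le> b powr (1 - q) / (q - 1)" using p q by auto
    then show ?thesis using A B by (simp only: ennreal_mult ennreal_plus mult_nonneg_nonneg)
  qed
  finally have C: "(\<integral>\<^sup>+t. ?g t \<partial>exp_measure lam) \<le>
    ennreal (A * (b powr (1 - p) / (1 - p)) + B * (b powr (1 - q) / (q - 1)))" .
  have "0 \<le> A * (b powr (1 - p) / (1 - p)) + B * (b powr (1 - q) / (q - 1))" using A B p q by simp
  then show ?thesis using exp_measure_bound[OF \<phi> g C] by auto
qed

text \<open>The cut at \<open>t = b\<^sup>2\<close> balances the two bounds.\<close>

lemma exp_measure_interpolation: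
  fixes \<phi> :: "real \<Rightarrow> real"
  assumes lam: "0 < lam" and \<gamma>: "\<gamma> < 1" and b: "0 < b" and A: "0 \<le> A" and B: "0 \<le> B"
    and \<theta>: "\<theta> = 2 * (1 - \<gamma>)" "\<theta> < 2 * \<beta>"
    and \<phi>: "\<phi> \<in> borel_measurable (restrict_space borel {0<..})"
    and le: "\<And>t. 0 < t \<Longrightarrow> \<bar>\<phi> t\<bar> \<le> A * t powr (- \<gamma>)"
      "\<And>t. 0 < t \<Longrightarrow> \<bar>\<phi> t\<bar> \<le> B * b powr (2 * \<beta>) * t powr (- (\<gamma> + \<beta>))"
  shows "\<bar>\<integral>t. \<phi> t \<partial>exp_measure lam\<bar> \<le> (2 * A / \<theta> + 2 * B / (2 * \<beta> - \<theta>)) * b powr \<theta>"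
proof -
  have q: "1 < \<gamma> + \<beta>" using \<theta> by (simp add: field_simps)
  have "\<bar>\<integral>t. \<phi> t \<partial>exp_measure lam\<bar> \<le>
      A * ((b powr 2) powr (1 - \<gamma>) / (1 - \<gamma>)) +
      (B * b powr (2 * \<beta>)) * ((b powr 2) powr (1 - (\<gamma> + \<beta>)) / (\<gamma> + \<beta> - 1))"
    using b A B by (intro exp_measure_bound_two_powr[OF lam \<gamma> q _ _ _ \<phi> le]) auto
  also have "(b powr 2) powr (1 - \<gamma>) / (1 - \<gamma>) = 2 / \<theta> * b powr \<theta>"
  proof -
    have "1 - \<gamma> = \<theta> / 2" using \<theta> by simp
    then show ?thesis by (simp only: powr_powr) simp
  qed
  also have "(B * b powr (2 * \<beta>)) * ((b powr 2) powr (1 - (\<gamma> + \<beta>)) / (\<gamma> + \<beta> - 1)) =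
      B * (2 / (2 * \<beta> - \<theta>)) * b powr \<theta>"
  proof -
    have "b powr (2 * \<beta>) * b powr (2 * (1 - (\<gamma> + \<beta>))) = b powr \<theta>"
    proof -
      have "2 * \<beta> + 2 * (1 - (\<gamma> + \<beta>)) = \<theta>" using \<theta>(1) by simp
      then show ?thesis by (simp only: powr_add[symmetric])
    qed
    moreover have "1 / (\<gamma> + \<beta> - 1) = 2 / (2 * \<beta> - \<theta>)" using \<theta> q by (simp add: field_simps)
    ultimately show ?thesis by (simp add: powr_powr divide_inverse mult.assoc mult.left_commute)
  qed
  also have "A * (2 / \<theta> * b powr \<theta>) + B * (2 / (2 * \<beta> - \<theta>)) * b powr \<theta> =
     (2 * A / \<theta> + 2 * B / (2 * \<beta> - \<theta>)) * b powr \<theta>"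
    by (simp add: algebra_simps)
  finally show ?thesis .
qed

lemma gateaux_deriv_eq:
  assumes "has_gateaux_derivative F D x"
  shows "gateaux_deriv F x = D"
  unfolding gateaux_deriv_def
proof (rule the_equality)
  show "has_gateaux_derivative F D x" by (rule assms)
  fix D' assume "has_gateaux_derivative F D' x"
  then show "D' = D"
    using assms by (intro blinfun_eqI) (auto simp: has_gateaux_derivative_def intro: tendsto_unique[OF trivial_limit_at])
qed

section \<open>Regularity of the resolvent\<close>

lemma quad_deriv_gateaux:
  assumes q: "quad_deriv G D x K"
  shows "((\<lambda>r. (G (x + r *\<^sub>R h) - G x) / r) \<longlongrightarrow> D h) (at 0)"
proof (rule LIM_zero_cancel, rule Lim_null_comparison)
  show "((\<lambda>r. K * (norm h)\<^sup>2 * \<bar>r\<bar>) \<longlongrightarrow> 0) (at 0)"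
    by (rule tendsto_mult_right_zero) (use tendsto_rabs_zero[OF tendsto_ident_at] in simp)
  show "\<forall>\<^sub>F r in at 0. norm ((G (x + r *\<^sub>R h) - G x) / r - D h) \<le> K * (norm h)\<^sup>2 * \<bar>r\<bar>"
  proof (rule eventually_at_topological[THEN iffD2], intro exI[of _ UNIV] conjI ballI impI)
    fix r :: real assume r: "r \<noteq> 0"
    have "(G (x + r *\<^sub>R h) - G x) / r - D h = (G (x + r *\<^sub>R h) - G x - D (r *\<^sub>R h)) / r"
      using r by (simp add: blinfun.scaleR_right field_simps)
    then have "norm ((G (x + r *\<^sub>R h) - G x) / r - D h) = \<bar>G (x + r *\<^sub>R h) - G x - D (r *\<^sub>R h)\<bar> / \<bar>r\<bar>"
      by simp
    also have "\<dots> \<le> (K * (norm (r *\<^sub>R h))\<^sup>2) / \<bar>r\<bar>"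
      by (intro divide_right_mono quad_derivD[OF q]) simp
    also have "\<dots> = K * (norm h)\<^sup>2 * \<bar>r\<bar>" using r by (simp add: power_mult_distrib power2_eq_square)
    finally show "norm ((G (x + r *\<^sub>R h) - G x) / r - D h) \<le> K * (norm h)\<^sup>2 * \<bar>r\<bar>" .
  qed auto
qed

text \<open>Exhibits the derivative as a limit of one fixed sequence of difference quotients, which
  gives measurability in t of the derivatives.\<close>

lemma quad_deriv_LIMSEQ:
  assumes q: "quad_deriv G D x K"
  shows "(\<lambda>n. (G (x + (1 / real (Suc n)) *\<^sub>R h) - G x) / (1 / real (Suc n))) \<longlonglongrightarrow> D h"
proof (rule filterlim_compose[OF quad_deriv_gateaux[OF q]])
  show "filterlim (\<lambda>n. 1 / real (Suc n)) (at 0) sequentially"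
    using LIMSEQ_Suc[OF lim_1_over_n] by (auto simp: filterlim_at)
qed

text \<open>Needed for domination in time: the remainder constant of \<open>P t f\<close> grows like
  1/t and is not integrable at 0, whereas the gradient bound is, and by the mean value inequality it
  controls the difference quotients.\<close>

lemma quad_deriv_lipschitz_value:
  assumes q: "\<And>x. quad_deriv G (D x) x K" and A: "\<And>x. norm (D x) \<le> A"
  shows "\<bar>G (x + h) - G x\<bar> \<le> A * norm h"
proof -
  have der: "(G has_derivative D x) (at x)" for x
    unfolding has_derivative_at
  proof (rule conjI[OF blinfun.bounded_linear_right], rule Lim_null_comparison)
    show "((\<lambda>h::'a. K * norm h) \<longlongrightarrow> 0) (at 0)"
      by (rule tendsto_mult_right_zero[OF tendsto_norm_zero[OF tendsto_ident_at]])
    have "norm (norm (G (x + h) - G x - D x h) / norm h) \<le> K * norm h" for h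
    proof (cases "h = 0")
      case False
      have "norm (G (x + h) - G x - D x h) / norm h \<le> K * (norm h)\<^sup>2 / norm h"
        using quad_derivD[OF q] by (intro divide_right_mono) auto
      then show ?thesis using False by (simp add: power2_eq_square)
    qed simp
    then show "\<forall>\<^sub>F h in at 0. norm (norm (G (x + h) - G x - D x h) / norm h) \<le> K * norm h"
      by (intro always_eventually allI)
  qed
  have "norm (G (x + h) - G x) \<le> A * norm (x + h - x)"
    by (rule differentiable_bound[of UNIV G "\<lambda>x. blinfun_apply (D x)"])
       (use der A in \<open>auto simp: norm_blinfun.rep_eq[symmetric]\<close>)
  then show ?thesis by simp
qed

lemma exp_measure_dominated:
  assumes lam: "0 < lam" and p: "0 \<le> p" "p < 1" and A: "0 \<le> A"
    and \<phi>: "\<And>n::nat. \<phi> n \<in> borel_measurable (restrict_space borel {0<..})"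
    and le: "\<And>n t. 0 < t \<Longrightarrow> \<bar>\<phi> n t\<bar> \<le> A * t powr (- p)"
    and lim: "\<And>t. 0 < t \<Longrightarrow> (\<lambda>n. \<phi> n t) \<longlonglongrightarrow> (\<xi> t :: real)"
  shows "(\<lambda>n. \<integral>t. \<phi> n t \<partial>exp_measure lam) \<longlonglongrightarrow> (\<integral>t. \<xi> t \<partial>exp_measure lam)"
proof (rule integral_dominated_convergence[where w = "\<lambda>t. A * t powr (- p)"])
  have "(\<lambda>t. A * t powr (- p)) \<in> borel_measurable (restrict_space borel {0<..})"
    by (intro measurable_restrict_space1) measurable
  then show "integrable (exp_measure lam) (\<lambda>t. A * t powr (- p))"
    using A by (intro exp_measure_bound_powr(1)[OF lam p A]) auto
  show "\<phi> n \<in> borel_measurable (exp_measure lam)" for n using \<phi> by (simp add: measurable_exp_measure)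
  have "\<xi> \<in> borel_measurable (restrict_space borel {0<..})"
    by (rule borel_measurable_LIMSEQ_real[OF lim \<phi>]) (simp add: space_restrict_space)
  then show "\<xi> \<in> borel_measurable (exp_measure lam)" by (simp add: measurable_exp_measure)
qed (auto intro!: AE_I2 simp: space_exp_measure le lim)

context ou_semigroup
begin

text \<open>Treats both kinds of data at once: \<gamma> = 1/2 for bounded functions and \<gamma> =
  (1 - \<alpha>)/2 for \<alpha>-Hoelder ones. In both cases \<gamma> < 1, so the gradient is
  integrable in time.\<close>

definition grad_rate :: "('a \<Rightarrow> real) \<Rightarrow> real \<Rightarrow> real \<Rightarrow> bool" where
  "grad_rate f a \<gamma> \<longleftrightarrow> 0 \<le> a \<and> (\<forall>t>0. \<forall>x. norm (DP t f x) \<le> a * t powr (- \<gamma>))"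

lemma grad_rate_bdd_cont:
  assumes "bdd_cont f B"
  shows "grad_rate f B (1/2)"
  unfolding grad_rate_def
  using norm_DP_le[OF _ assms] bdd_contD(4)[OF assms]
  by (auto simp: powr_minus_divide powr_half_sqrt)

lemma grad_rate_hoelder:
  assumes "bdd_cont f B" "hoelder \<alpha> H f" "0 < \<alpha>" "\<alpha> < 1"
  shows "grad_rate f (2 * H) ((1 - \<alpha>) / 2)"
proof -
  have "- ((1 - \<alpha>) / 2) = (\<alpha> - 1) / 2" by (simp add: field_simps)
  then show ?thesis
    unfolding grad_rate_def using norm_DP_hoelder_le[OF _ assms(1,3,4,2)] assms(2)
    by (simp only: hoelder_def) auto
qed

lemma P_measurable': "bdd_cont f B \<Longrightarrow> (\<lambda>t. P t f x) \<in> borel_measurable (restrict_space borel {0<..})"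
  by (rule measurable_restrict_mono[OF P_measurable]) auto

lemma DP_measurable:
  assumes f: "bdd_cont f B"
  shows "(\<lambda>t. DP t f x h) \<in> borel_measurable (restrict_space borel {0<..})"
proof (rule borel_measurable_LIMSEQ_real)
  fix t :: real assume "t \<in> space (restrict_space borel {0<..})"
  then show "(\<lambda>n. (P t f (x + (1 / real (Suc n)) *\<^sub>R h) - P t f x) / (1 / real (Suc n))) \<longlonglongrightarrow> DP t f x h"
    by (intro quad_deriv_LIMSEQ[OF DP_quad_deriv[OF _ f]]) (simp add: space_restrict_space)
qed (intro borel_measurable_divide borel_measurable_diff P_measurable'[OF f] borel_measurable_const)

lemma DP_apply_le:
  assumes "grad_rate f a \<gamma>" "0 < t"
  shows "\<bar>DP t f x h\<bar> \<le> a * norm h * t powr (- \<gamma>)"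
proof -
  have "\<bar>DP t f x h\<bar> \<le> norm (DP t f x) * norm h" using norm_blinfun[of "DP t f x" h] by simp
  also have "\<dots> \<le> (a * t powr (- \<gamma>)) * norm h"
    using assms by (intro mult_right_mono) (auto simp: grad_rate_def)
  finally show ?thesis by (simp add: mult_ac)
qed

definition U :: "real \<Rightarrow> ('a \<Rightarrow> real) \<Rightarrow> 'a \<Rightarrow> real" where
  "U lam f x = (\<integral>t. P t f x \<partial>exp_measure lam)"

definition U1 :: "real \<Rightarrow> ('a \<Rightarrow> real) \<Rightarrow> 'a \<Rightarrow> 'a \<Rightarrow>\<^sub>L real" where
  "U1 lam f x = Blinfun (\<lambda>h. \<integral>t. DP t f x h \<partial>exp_measure lam)"

lemma U_bound:
  assumes lam: "0 < lam" and f: "bdd_cont f B"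
  shows "integrable (exp_measure lam) (\<lambda>t. P t f x)" "\<bar>U lam f x\<bar> \<le> B * exp_powr_const lam 0"
  unfolding U_def
  using exp_measure_bound_powr[OF lam, of 0 B "\<lambda>t. P t f x"] bdd_contD[OF P_bdd_cont[OF _ f]] bdd_contD(4)[OF f]
    P_measurable'[OF f] by auto

lemma DP_integrable:
  assumes lam: "0 < lam" and f: "bdd_cont f B" and gr: "grad_rate f a \<gamma>" and \<gamma>: "0 < \<gamma>" "\<gamma> < 1"
  shows "integrable (exp_measure lam) (\<lambda>t. DP t f x h)"
    "\<bar>\<integral>t. DP t f x h \<partial>exp_measure lam\<bar> \<le> a * exp_powr_const lam \<gamma> * norm h"
  using exp_measure_bound_powr[OF lam _ \<gamma>(2) _ DP_measurable[OF f] DP_apply_le[OF gr], of h x] \<gamma> gr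
  by (auto simp: grad_rate_def mult_ac)

lemma U1_apply:
  assumes lam: "0 < lam" and f: "bdd_cont f B" and gr: "grad_rate f a \<gamma>" and \<gamma>: "0 < \<gamma>" "\<gamma> < 1"
  shows "U1 lam f x h = (\<integral>t. DP t f x h \<partial>exp_measure lam)"
proof -
  have "bounded_linear (\<lambda>h. \<integral>t. DP t f x h \<partial>exp_measure lam)"
    by (rule bounded_linear_intro[of _ "a * exp_powr_const lam \<gamma>"])
       (use DP_integrable[OF assms] in \<open>auto simp: blinfun.add_right blinfun.scaleR_right mult.commute\<close>)
  then show ?thesis by (simp add: U1_def bounded_linear_Blinfun_apply)
qed

lemma norm_U1_le:
  assumes lam: "0 < lam" and f: "bdd_cont f B" and gr: "grad_rate f a \<gamma>" and \<gamma>: "0 < \<gamma>" "\<gamma> < 1"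
  shows "norm (U1 lam f x) \<le> a * exp_powr_const lam \<gamma>"
proof (rule norm_blinfun_bound)
  show "0 \<le> a * exp_powr_const lam \<gamma>" using gr \<gamma> lam by (simp add: grad_rate_def exp_powr_const_def)
qed (simp add: U1_apply[OF assms] DP_integrable[OF assms])

lemma U_gateaux:
  assumes lam: "0 < lam" and f: "bdd_cont f B" and gr: "grad_rate f a \<gamma>" and \<gamma>: "0 < \<gamma>" "\<gamma> < 1"
  shows "has_gateaux_derivative (U lam f) (U1 lam f x) x"
  unfolding has_gateaux_derivative_def tendsto_at_iff_sequentially o_def
proof safe
  fix h and X :: "nat \<Rightarrow> real" assume X: "\<forall>i. X i \<in> UNIV - {0}" "X \<longlonglongrightarrow> 0"
  have X0: "filterlim X (at 0) sequentially" using X by (auto simp: filterlim_at)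
  have "(\<lambda>n. \<integral>t. (P t f (x + X n *\<^sub>R h) - P t f x) / X n \<partial>exp_measure lam) \<longlonglongrightarrow> (\<integral>t. DP t f x h \<partial>exp_measure lam)"
  proof (rule exp_measure_dominated[OF lam _ \<gamma>(2), where A = "a * norm h"])
    show "(\<lambda>t. (P t f (x + X n *\<^sub>R h) - P t f x) / X n) \<in> borel_measurable (restrict_space borel {0<..})" for n
      by (intro borel_measurable_divide borel_measurable_diff P_measurable'[OF f] borel_measurable_const)
    show "\<bar>(P t f (x + X n *\<^sub>R h) - P t f x) / X n\<bar> \<le> a * norm h * t powr (- \<gamma>)" if t: "0 < t" for n t
    proof -
      have "\<bar>P t f (x + X n *\<^sub>R h) - P t f x\<bar> \<le> a * t powr (- \<gamma>) * norm (X n *\<^sub>R h)"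
        using t gr by (intro quad_deriv_lipschitz_value[OF DP_quad_deriv[OF t f]]) (auto simp: grad_rate_def)
      then have "\<bar>P t f (x + X n *\<^sub>R h) - P t f x\<bar> / \<bar>X n\<bar> \<le> a * t powr (- \<gamma>) * norm (X n *\<^sub>R h) / \<bar>X n\<bar>"
        by (rule divide_right_mono) simp
      then show ?thesis using X(1) by (simp add: mult_ac)
    qed
    show "(\<lambda>n. (P t f (x + X n *\<^sub>R h) - P t f x) / X n) \<longlonglongrightarrow> DP t f x h" if t: "0 < t" for t
      by (rule filterlim_compose[OF quad_deriv_gateaux[OF DP_quad_deriv[OF t f]] X0])
  qed (use \<gamma> gr in \<open>auto simp: grad_rate_def\<close>)
  then show "(\<lambda>n. (U lam f (x + X n *\<^sub>R h) - U lam f x) /\<^sub>R X n) \<longlonglongrightarrow> U1 lam f x h"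
    by (simp add: U_def U1_apply[OF assms] U_bound(1)[OF lam f] divide_inverse mult.commute)
qed

lemma U1_continuous:
  assumes lam: "0 < lam" and f: "bdd_cont f B" and gr: "grad_rate f a \<gamma>" and \<gamma>: "0 < \<gamma>" "\<gamma> < 1"
  shows "continuous_on UNIV (\<lambda>x. U1 lam f x h)"
  unfolding continuous_on_sequentially o_def U1_apply[OF assms]
proof safe
  fix X x assume X: "X \<longlonglongrightarrow> (x::'a)"
  show "(\<lambda>n. \<integral>t. DP t f (X n) h \<partial>exp_measure lam) \<longlonglongrightarrow> (\<integral>t. DP t f x h \<partial>exp_measure lam)"
  proof (rule exp_measure_dominated[OF lam _ \<gamma>(2), where A = "a * norm h"])
    show "(\<lambda>n. DP t f (X n) h) \<longlonglongrightarrow> DP t f x h" if t: "0 < t" for t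
      using bdd_contD(1)[OF DP_bdd_cont[OF t f norm_DP_le[OF t f]]] X
      by (rule continuous_on_tendsto_compose) auto
  qed (use \<gamma> gr DP_measurable[OF f] DP_apply_le[OF gr] in \<open>auto simp: grad_rate_def\<close>)
qed

text \<open>The gradient rate at time t/2 is fed into \<open>second_derivative\<close>: each further
  derivative costs t^(-1/2), so the second derivative has rate \<gamma> + 1/2 and its Lipschitz
  constant rate \<gamma> + 1.\<close>

lemma second_rates:
  assumes f: "bdd_cont f B" and gr: "grad_rate f a \<gamma>" and \<gamma>: "0 < \<gamma>" "\<gamma> \<le> 1"
  obtains D2 :: "real \<Rightarrow> 'a \<Rightarrow> 'a \<Rightarrow>\<^sub>L 'a \<Rightarrow>\<^sub>L real" where
    "\<And>t x. 0 < t \<Longrightarrow> norm (D2 t x) \<le> 3 * a * t powr (- (\<gamma> + 1/2))"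
    "\<And>t x h k. 0 < t \<Longrightarrow> \<bar>DP t f (x + k) h - DP t f x h - apply2 (D2 t x) k h\<bar>
        \<le> 12 * a * t powr (- (\<gamma> + 1)) * norm h * (norm k)\<^sup>2"
    "\<And>t x y. 0 < t \<Longrightarrow> norm (D2 t y - D2 t x) \<le> 72 * a * t powr (- (\<gamma> + 1)) * norm (y - x)"
proof -
  have a: "0 \<le> a" using gr by (simp add: grad_rate_def)
  have "\<exists>D2 :: 'a \<Rightarrow> 'a \<Rightarrow>\<^sub>L 'a \<Rightarrow>\<^sub>L real. \<forall>x. norm (D2 x) \<le> 3 * a * t powr (- (\<gamma> + 1/2)) \<and>
      (\<forall>h k. \<bar>DP t f (x + k) h - DP t f x h - apply2 (D2 x) k h\<bar>
        \<le> 12 * a * t powr (- (\<gamma> + 1)) * norm h * (norm k)\<^sup>2) \<and>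
      (\<forall>y. norm (D2 y - D2 x) \<le> 72 * a * t powr (- (\<gamma> + 1)) * norm (y - x))" if t: "0 < t" for t
  proof -
    \<comment> \<open>The factor 2 absorbs 2 powr \<gamma>, which arises from passing to t/2.
      Together with sqrt 2 \<le> 3/2 it yields the constant 3, and 6 and 36 become 12 and
      72.\<close>
    define A where "A = 2 * a * t powr (- \<gamma>)"
    have "norm (DP (t / 2) f x) \<le> A" for x
    proof -
      have "norm (DP (t / 2) f x) \<le> a * (t / 2) powr (- \<gamma>)" using gr t by (simp add: grad_rate_def)
      also have "(t / 2) powr (- \<gamma>) = t powr (- \<gamma>) * 2 powr \<gamma>"
        using t by (simp add: powr_divide powr_minus_divide)
      also have "a * (t powr (- \<gamma>) * 2 powr \<gamma>) \<le> a * (t powr (- \<gamma>) * 2 powr 1)"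
        using a \<gamma> by (intro mult_left_mono powr_mono) auto
      finally show ?thesis by (simp add: A_def mult_ac)
    qed
    then obtain D2 :: "'a \<Rightarrow> 'a \<Rightarrow>\<^sub>L 'a \<Rightarrow>\<^sub>L real" where D2: "\<And>x. norm (D2 x) \<le> A / sqrt (t / 2)"
      "\<And>x h k. \<bar>DP t f (x + k) h - DP t f x h - apply2 (D2 x) k h\<bar>
         \<le> 6 * A / t * norm h * (norm k)\<^sup>2"
      "\<And>x y. norm (D2 y - D2 x) \<le> 36 * A / t * norm (y - x)"
      using second_derivative[OF t f, of A] by blast
    have At: "A / t = 2 * a * t powr (- (\<gamma> + 1))"
    proof -
      have "t powr (- (\<gamma> + 1)) = t powr (- \<gamma>) * t powr (- 1)"
        by (subst powr_add[symmetric]) simp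
      then show ?thesis using t by (simp add: A_def powr_minus_divide)
    qed
    have Asqrt: "A / sqrt (t / 2) \<le> 3 * a * t powr (- (\<gamma> + 1/2))"
    proof -
      have "t powr (- (\<gamma> + 1/2)) = t powr (- \<gamma>) * t powr (- (1/2))"
        by (subst powr_add[symmetric]) simp
      also have "t powr (- (1/2)) = 1 / sqrt t" using t by (simp add: powr_minus_divide powr_half_sqrt)
      finally have e: "3 * a * t powr (- (\<gamma> + 1/2)) = (3/2) * (A / sqrt t)" by (simp add: A_def)
      have "sqrt 2 \<le> 3/2" by (rule real_le_lsqrt) (auto simp: power2_eq_square)
      moreover have "A / sqrt (t / 2) = sqrt 2 * (A / sqrt t)" by (simp add: real_sqrt_divide)
      moreover have "0 \<le> A / sqrt t" using a t by (simp add: A_def)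
      ultimately show ?thesis unfolding e by (metis mult_right_mono)
    qed
    show ?thesis
    proof (intro exI[of _ D2] allI conjI)
      fix x
      show "norm (D2 x) \<le> 3 * a * t powr (- (\<gamma> + 1/2))" using D2(1)[of x] Asqrt by linarith
      have e: "6 * A / t = 12 * a * t powr (- (\<gamma> + 1))" "36 * A / t = 72 * a * t powr (- (\<gamma> + 1))"
        using At by simp_all
      show "\<bar>DP t f (x + k) h - DP t f x h - apply2 (D2 x) k h\<bar>
          \<le> 12 * a * t powr (- (\<gamma> + 1)) * norm h * (norm k)\<^sup>2"
        "norm (D2 y - D2 x) \<le> 72 * a * t powr (- (\<gamma> + 1)) * norm (y - x)" for h k y
        using D2(2)[of x k h] D2(3)[of y x] unfolding e .
    qed
  qed
  then have "\<forall>t. \<exists>D2 :: 'a \<Rightarrow> 'a \<Rightarrow>\<^sub>L 'a \<Rightarrow>\<^sub>L real. 0 < t \<longrightarrow> (\<forall>x. norm (D2 x) \<le> 3 * a * t powr (- (\<gamma> + 1/2)) \<and>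
      (\<forall>h k. \<bar>DP t f (x + k) h - DP t f x h - apply2 (D2 x) k h\<bar>
        \<le> 12 * a * t powr (- (\<gamma> + 1)) * norm h * (norm k)\<^sup>2) \<and>
      (\<forall>y. norm (D2 y - D2 x) \<le> 72 * a * t powr (- (\<gamma> + 1)) * norm (y - x)))" by blast
  then obtain D2 :: "real \<Rightarrow> 'a \<Rightarrow> 'a \<Rightarrow>\<^sub>L 'a \<Rightarrow>\<^sub>L real" where
    "\<forall>t>0. \<forall>x. norm (D2 t x) \<le> 3 * a * t powr (- (\<gamma> + 1/2)) \<and>
      (\<forall>h k. \<bar>DP t f (x + k) h - DP t f x h - apply2 (D2 t x) k h\<bar>
        \<le> 12 * a * t powr (- (\<gamma> + 1)) * norm h * (norm k)\<^sup>2) \<and>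
      (\<forall>y. norm (D2 t y - D2 t x) \<le> 72 * a * t powr (- (\<gamma> + 1)) * norm (y - x))"
    unfolding choice_iff by blast
  then show ?thesis by (intro that[of D2]) auto
qed

text \<open>The second difference of the gradient at time t is at most 4 B t^(-1/2)
  \<parallel>h\<parallel> trivially and 24 B t^(-3/2) \<parallel>h\<parallel>
  \<parallel>k\<parallel>^2 by Taylor expansion. Interpolation with \<theta> = \<beta> = 1 gives 2 *
  4 + 2 * 24 = 56.\<close>

lemma U1_zygmund:
  assumes lam: "0 < lam" and f: "bdd_cont f B" and k: "k \<noteq> 0"
  shows "norm (U1 lam f (x + 2 *\<^sub>R k) - 2 *\<^sub>R U1 lam f (x + k) + U1 lam f x) \<le> 56 * B * norm k"
proof (rule norm_blinfun_bound)
  note gr = grad_rate_bdd_cont[OF f]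
  have half: "0 < (1/2::real)" "(1/2::real) \<le> 1" by auto
  have B: "0 \<le> B" by (rule bdd_contD(4)[OF f])
  show "0 \<le> 56 * B * norm k" using B by simp
  fix h
  obtain D2 :: "real \<Rightarrow> 'a \<Rightarrow> 'a \<Rightarrow>\<^sub>L 'a \<Rightarrow>\<^sub>L real" where D2:
    "\<And>t x h k. 0 < t \<Longrightarrow> \<bar>DP t f (x + k) h - DP t f x h - apply2 (D2 t x) k h\<bar>
        \<le> 12 * B * t powr (- (1/2 + 1)) * norm h * (norm k)\<^sup>2"
    using second_rates[OF f gr half, of thesis] by blast
  define \<phi> where "\<phi> t = DP t f (x + 2 *\<^sub>R k) h - 2 * DP t f (x + k) h + DP t f x h" for t
  have "\<bar>\<integral>t. \<phi> t \<partial>exp_measure lam\<bar> \<le> (2 * (4 * B * norm h) / 1 + 2 * (24 * B * norm h) / (2 * 1 - 1)) * norm k powr 1"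
  proof (rule exp_measure_interpolation[OF lam, where \<gamma> = "1/2"])
    show "\<phi> \<in> borel_measurable (restrict_space borel {0<..})"
      unfolding \<phi>_def[abs_def]
      by (intro borel_measurable_add borel_measurable_diff borel_measurable_times borel_measurable_const DP_measurable[OF f])
    fix t :: real assume t: "0 < t"
    show "\<bar>\<phi> t\<bar> \<le> 4 * B * norm h * t powr (- (1/2))"
      using DP_apply_le[OF gr t, of "x + 2 *\<^sub>R k" h] DP_apply_le[OF gr t, of "x + k" h] DP_apply_le[OF gr t, of x h]
      unfolding \<phi>_def by linarith
    \<comment> \<open>Both outer points are expanded about the midpoint \<open>x + k\<close>; the
      second derivative there enters with opposite signs and cancels.\<close>
    have "x + k + k = x + 2 *\<^sub>R k" by (simp add: scaleR_2)
    note d1 = D2[OF t, of "x + k" k h, unfolded this]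
    have d2: "\<bar>DP t f x h - DP t f (x + k) h + apply2 (D2 t (x + k)) k h\<bar>
        \<le> 12 * B * t powr (- (1/2 + 1)) * norm h * (norm k)\<^sup>2"
      using D2[OF t, of "x + k" "- k" h] by (simp add: blinfun.minus_right blinfun.minus_left)
    have "\<bar>\<phi> t\<bar> \<le> 2 * (12 * B * t powr (- (1/2 + 1)) * norm h * (norm k)\<^sup>2)"
      using d1 d2 unfolding \<phi>_def by linarith
    then show "\<bar>\<phi> t\<bar> \<le> 24 * B * norm h * norm k powr (2 * 1) * t powr (- (1/2 + 1))"
      using k by (simp add: mult_ac)
  qed (use k B in auto)
  also have "\<dots> = 56 * B * norm k * norm h" using k by simp
  also have "(\<integral>t. \<phi> t \<partial>exp_measure lam) =
     (U1 lam f (x + 2 *\<^sub>R k) - 2 *\<^sub>R U1 lam f (x + k) + U1 lam f x) h"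
    using DP_integrable[OF lam f gr]
    by (simp add: \<phi>_def U1_apply[OF lam f gr] blinfun.add_left blinfun.diff_left blinfun.scaleR_left)
  finally show "norm ((U1 lam f (x + 2 *\<^sub>R k) - 2 *\<^sub>R U1 lam f (x + k) + U1 lam f x) h)
     \<le> 56 * B * norm k * norm h" by simp
qed

text \<open>Here the second derivative has the integrable rate p = 1 - \<alpha>/2, so it can be
  integrated in time. Interpolation with \<beta> = 1/2 and \<theta> = 2 (1 - p) = \<alpha> is used
  twice: for the Taylor remainder divided by \<parallel>k\<parallel>, which gives the derivative in
  operator norm, and for increments of the second derivative, which gives the Hoelder bound.\<close>

lemma U_second:
  assumes lam: "0 < lam" and f: "bdd_cont f B" and \<alpha>: "0 < \<alpha>" "\<alpha> < 1"
    and gr: "grad_rate f a ((1 - \<alpha>) / 2)"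
  obtains U2 :: "'a \<Rightarrow> 'a \<Rightarrow>\<^sub>L 'a \<Rightarrow>\<^sub>L real" where
    "\<And>x. norm (U2 x) \<le> 3 * a * exp_powr_const lam (1 - \<alpha> / 2)"
    "\<And>x. has_gateaux_derivative (U1 lam f) (U2 x) x"
    "\<And>x k. k \<noteq> 0 \<Longrightarrow> norm (U2 (x + k) - U2 x) \<le> (12 / \<alpha> + 144 / (1 - \<alpha>)) * a * norm k powr \<alpha>"
proof -
  define \<gamma> where "\<gamma> = (1 - \<alpha>) / 2"
  define p where "p = 1 - \<alpha> / 2"
  have \<gamma>: "0 < \<gamma>" "\<gamma> < 1" "\<gamma> \<le> 1" using \<alpha> by (auto simp: \<gamma>_def)
  have p: "0 \<le> p" "p < 1" "\<gamma> + 1/2 = p" "\<gamma> + 1 = p + 1/2" "\<alpha> = 2 * (1 - p)" 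
    using \<alpha> by (auto simp: p_def \<gamma>_def field_simps)
  note gr = gr[folded \<gamma>_def]
  have a: "0 \<le> a" using gr by (simp add: grad_rate_def)
  obtain D2 :: "real \<Rightarrow> 'a \<Rightarrow> 'a \<Rightarrow>\<^sub>L 'a \<Rightarrow>\<^sub>L real" where D2:
    "\<And>t x. 0 < t \<Longrightarrow> norm (D2 t x) \<le> 3 * a * t powr (- p)"
    "\<And>t x h k. 0 < t \<Longrightarrow> \<bar>DP t f (x + k) h - DP t f x h - apply2 (D2 t x) k h\<bar>
        \<le> 12 * a * t powr (- (p + 1/2)) * norm h * (norm k)\<^sup>2"
    "\<And>t x y. 0 < t \<Longrightarrow> norm (D2 t y - D2 t x) \<le> 72 * a * t powr (- (p + 1/2)) * norm (y - x)"
    using second_rates[OF f gr \<gamma>(1,3), of thesis] unfolding p(3,4) by blast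
  have two: "\<bar>apply2 L k h\<bar> \<le> C * norm k * norm h" if "norm L \<le> C"
    for L :: "'a \<Rightarrow>\<^sub>L 'a \<Rightarrow>\<^sub>L real" and k h C
  proof -
    have "\<bar>apply2 L k h\<bar> \<le> norm (blinfun_apply L k) * norm h"
      using norm_blinfun[of "blinfun_apply L k" h] by simp
    also have "\<dots> \<le> (norm L * norm k) * norm h" by (intro mult_right_mono norm_blinfun) auto
    also have "\<dots> \<le> (C * norm k) * norm h" using that by (intro mult_right_mono) auto
    finally show ?thesis .
  qed
  have D2_le: "\<bar>apply2 (D2 t x) k h\<bar> \<le> 3 * a * norm k * norm h * t powr (- p)"
    if "0 < t" for t x k h
    using two[OF D2(1)[OF that], of x k h] by (simp add: mult_ac)
  \<comment> \<open>The derivative, as a functional of the direction \<open>k\<close>, of the scalar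
    function x \<mapsto> \<open>DP t f x h\<close> with \<open>h\<close> frozen; the scalar lemmas
    on \<open>quad_deriv\<close> then give the Lipschitz bound and measurability in time.\<close>
  define B where "B t x h = Blinfun (\<lambda>k. apply2 (D2 t x) k h)" for t x h
  have B: "blinfun_apply (B t x h) k = apply2 (D2 t x) k h" for t x h k
    unfolding B_def
    by (subst bounded_linear_Blinfun_apply)
       (auto intro: bounded_linear_compose[OF blinfun.bounded_linear_left blinfun.bounded_linear_right])
  have B_quad: "quad_deriv (\<lambda>x. DP t f x h) (B t x h) x (12 * a * t powr (- (p + 1/2)) * norm h)"
    if "0 < t" for t x h
    unfolding quad_deriv_def B using D2(2)[OF that] by blast
  have B_norm: "norm (B t x h) \<le> 3 * a * t powr (- p) * norm h" if "0 < t" for t x h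
    using D2_le[OF that, of x _ h] a by (intro norm_blinfun_bound) (auto simp: B mult_ac)
  have DP_lip: "\<bar>DP t f (x + k) h - DP t f x h\<bar> \<le> 3 * a * norm k * norm h * t powr (- p)"
    if "0 < t" for t x k h
    using quad_deriv_lipschitz_value[OF B_quad B_norm, OF that that, of x k h] by (simp add: mult_ac)
  have D2_measurable: "(\<lambda>t. apply2 (D2 t x) k h) \<in> borel_measurable (restrict_space borel {0<..})"
    for x k h
  proof (rule borel_measurable_LIMSEQ_real)
    fix t :: real assume "t \<in> space (restrict_space borel {0<..})"
    then have "0 < t" by (simp add: space_restrict_space)
    then show "(\<lambda>n. (DP t f (x + (1 / real (Suc n)) *\<^sub>R k) h - DP t f x h) / (1 / real (Suc n)))
        \<longlonglongrightarrow> apply2 (D2 t x) k h"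
      using quad_deriv_LIMSEQ[OF B_quad, of t x k h] by (simp only: B)
  qed (intro borel_measurable_divide borel_measurable_diff DP_measurable[OF f] borel_measurable_const)
  define T where "T x k h = (\<integral>t. apply2 (D2 t x) k h \<partial>exp_measure lam)" for x k h
  have T: "integrable (exp_measure lam) (\<lambda>t. apply2 (D2 t x) k h)"
    "\<bar>T x k h\<bar> \<le> 3 * a * exp_powr_const lam p * norm k * norm h" for x k h
    unfolding T_def
    using exp_measure_bound_powr[OF lam p(1,2) _ D2_measurable D2_le, of k h x] a
    by (auto simp: mult_ac)
  have C: "0 \<le> 3 * a * exp_powr_const lam p" using a lam p by (simp add: exp_powr_const_def)
  have "\<exists>L :: 'a \<Rightarrow>\<^sub>L 'a \<Rightarrow>\<^sub>L real. norm L \<le> 3 * a * exp_powr_const lam p \<and>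
     (\<forall>k h. apply2 L k h = T x k h)" for x
  proof (rule bilinear_blinfun_exists[OF _ _ _ _ C T(2)])
    show "T x (k + k') h = T x k h + T x k' h" "T x k (h + h') = T x k h + T x k h'"
      "T x (r *\<^sub>R k) h = r * T x k h" "T x k (r *\<^sub>R h) = r * T x k h" for k k' h h' r
      using T(1) by (simp_all add: T_def blinfun.add_right blinfun.add_left blinfun.scaleR_right blinfun.scaleR_left)
  qed
  then have "\<forall>x. \<exists>L :: 'a \<Rightarrow>\<^sub>L 'a \<Rightarrow>\<^sub>L real. norm L \<le> 3 * a * exp_powr_const lam p \<and>
     (\<forall>k h. apply2 L k h = T x k h)" by blast
  then obtain U2 :: "'a \<Rightarrow> 'a \<Rightarrow>\<^sub>L 'a \<Rightarrow>\<^sub>L real" where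
    U2: "\<And>x. norm (U2 x) \<le> 3 * a * exp_powr_const lam p"
      "\<And>x k h. apply2 (U2 x) k h = T x k h"
    unfolding choice_iff by blast
  note U1_app = U1_apply[OF lam f gr \<gamma>(1,2)] and DP_int = DP_integrable(1)[OF lam f gr \<gamma>(1,2)]
  have remainder: "norm (U1 lam f (x + k) - U1 lam f x - blinfun_apply (U2 x) k)
      \<le> (12 / \<alpha> + 24 / (1 - \<alpha>)) * a * norm k * norm k powr \<alpha>" if k: "k \<noteq> 0" for x k
  proof (rule norm_blinfun_bound)
    show "0 \<le> (12 / \<alpha> + 24 / (1 - \<alpha>)) * a * norm k * norm k powr \<alpha>" using a \<alpha> by simp
    fix h
    define \<phi> where "\<phi> t = DP t f (x + k) h - DP t f x h - apply2 (D2 t x) k h" for t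
    have "\<bar>\<integral>t. \<phi> t \<partial>exp_measure lam\<bar> \<le> (2 * (6 * a * norm h * norm k) / \<alpha>
        + 2 * (12 * a * norm h * norm k) / (2 * (1/2) - \<alpha>)) * norm k powr \<alpha>"
    proof (rule exp_measure_interpolation[OF lam, where \<gamma> = p])
      show "\<phi> \<in> borel_measurable (restrict_space borel {0<..})"
        unfolding \<phi>_def[abs_def] by (intro borel_measurable_diff DP_measurable[OF f] D2_measurable)
      fix t :: real assume t: "0 < t"
      show "\<bar>\<phi> t\<bar> \<le> 6 * a * norm h * norm k * t powr (- p)"
        using DP_lip[OF t, of x k h] D2_le[OF t, of x k h] unfolding \<phi>_def by (simp add: mult_ac)
      show "\<bar>\<phi> t\<bar> \<le> 12 * a * norm h * norm k * norm k powr (2 * (1/2)) * t powr (- (p + 1/2))"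
        using D2(2)[OF t, of x k h] k unfolding \<phi>_def by (simp add: mult_ac power2_eq_square)
    qed (use a k p \<alpha> in auto)
    also have "\<dots> = (12 / \<alpha> + 24 / (1 - \<alpha>)) * a * norm k * norm k powr \<alpha> * norm h"
      by (simp add: algebra_simps)
    also have "(\<integral>t. \<phi> t \<partial>exp_measure lam) = (U1 lam f (x + k) - U1 lam f x - blinfun_apply (U2 x) k) h"
      using DP_int T(1) by (simp add: \<phi>_def U2 T_def U1_app blinfun.diff_left)
    finally show "norm ((U1 lam f (x + k) - U1 lam f x - blinfun_apply (U2 x) k) h)
      \<le> (12 / \<alpha> + 24 / (1 - \<alpha>)) * a * norm k * norm k powr \<alpha> * norm h" by simp
  qed
  show ?thesis
  proof (rule that[of U2])
    show "norm (U2 x) \<le> 3 * a * exp_powr_const lam (1 - \<alpha> / 2)" for x using U2(1) by (simp add: p_def)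
    show "has_gateaux_derivative (U1 lam f) (U2 x) x" for x
      unfolding has_gateaux_derivative_def
    proof
      fix k
      show "((\<lambda>r. (U1 lam f (x + r *\<^sub>R k) - U1 lam f x) /\<^sub>R r) \<longlongrightarrow> blinfun_apply (U2 x) k) (at 0)"
      proof (cases "k = 0")
        case False
        define c' where "c' = (12 / \<alpha> + 24 / (1 - \<alpha>)) * a * norm k"
        show ?thesis
        proof (rule LIM_zero_cancel, rule Lim_null_comparison)
          have "((\<lambda>r. norm (r *\<^sub>R k)) \<longlongrightarrow> 0) (at 0)"
            by (rule tendsto_norm_zero) (rule tendsto_eq_intros refl | simp)+
          then have "((\<lambda>r. norm (r *\<^sub>R k) powr \<alpha>) \<longlongrightarrow> 0) (at 0)"
            using \<alpha> by (intro tendsto_zero_powrI tendsto_const) auto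
          then show "((\<lambda>r. c' * norm (r *\<^sub>R k) powr \<alpha>) \<longlongrightarrow> 0) (at 0)"
            by (rule tendsto_mult_right_zero)
          show "\<forall>\<^sub>F r in at 0. norm ((U1 lam f (x + r *\<^sub>R k) - U1 lam f x) /\<^sub>R r - blinfun_apply (U2 x) k)
             \<le> c' * norm (r *\<^sub>R k) powr \<alpha>"
          proof (rule eventually_at_topological[THEN iffD2], intro exI[of _ UNIV] conjI ballI impI)
            fix r :: real assume r: "r \<noteq> 0"
            have "(U1 lam f (x + r *\<^sub>R k) - U1 lam f x) /\<^sub>R r - blinfun_apply (U2 x) k =
               (U1 lam f (x + r *\<^sub>R k) - U1 lam f x - blinfun_apply (U2 x) (r *\<^sub>R k)) /\<^sub>R r"
              using r by (simp add: blinfun.scaleR_right scaleR_diff_right)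
            then have "norm ((U1 lam f (x + r *\<^sub>R k) - U1 lam f x) /\<^sub>R r - blinfun_apply (U2 x) k) =
               norm (U1 lam f (x + r *\<^sub>R k) - U1 lam f x - blinfun_apply (U2 x) (r *\<^sub>R k)) / \<bar>r\<bar>"
              by (simp add: divide_inverse mult.commute)
            also have "\<dots> \<le> ((12 / \<alpha> + 24 / (1 - \<alpha>)) * a * norm (r *\<^sub>R k) * norm (r *\<^sub>R k) powr \<alpha>) / \<bar>r\<bar>"
              using False r by (intro divide_right_mono remainder) auto
            also have "\<dots> = c' * norm (r *\<^sub>R k) powr \<alpha>" using r by (simp add: c'_def)
            finally show "norm ((U1 lam f (x + r *\<^sub>R k) - U1 lam f x) /\<^sub>R r - blinfun_apply (U2 x) k)
               \<le> c' * norm (r *\<^sub>R k) powr \<alpha>" .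
          qed auto
        qed
      qed simp
    qed
    fix x k :: 'a assume k: "k \<noteq> 0"
    let ?c = "(12 / \<alpha> + 144 / (1 - \<alpha>)) * a * norm k powr \<alpha>"
    have c0: "0 \<le> ?c" using a \<alpha> by simp
    show "norm (U2 (x + k) - U2 x) \<le> ?c"
    proof (rule norm_blinfun_bound[OF c0], rule norm_blinfun_bound)
      fix e :: 'a show "0 \<le> ?c * norm e" using c0 by simp
      fix h
      define \<phi> where "\<phi> t = apply2 (D2 t (x + k)) e h - apply2 (D2 t x) e h" for t
      have "\<bar>\<integral>t. \<phi> t \<partial>exp_measure lam\<bar> \<le> (2 * (6 * a * norm e * norm h) / \<alpha>
          + 2 * (72 * a * norm e * norm h) / (2 * (1/2) - \<alpha>)) * norm k powr \<alpha>"
      proof (rule exp_measure_interpolation[OF lam, where \<gamma> = p])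
        show "\<phi> \<in> borel_measurable (restrict_space borel {0<..})"
          unfolding \<phi>_def[abs_def] by (intro borel_measurable_diff D2_measurable)
        fix t :: real assume t: "0 < t"
        show "\<bar>\<phi> t\<bar> \<le> 6 * a * norm e * norm h * t powr (- p)"
          using D2_le[OF t, of "x + k" e h] D2_le[OF t, of x e h] unfolding \<phi>_def by (simp add: mult_ac)
        have "norm (D2 t (x + k) - D2 t x) \<le> 72 * a * t powr (- (p + 1/2)) * norm k"
          using D2(3)[OF t, of "x + k" x] by simp
        from two[OF this, of e h]
        show "\<bar>\<phi> t\<bar> \<le> 72 * a * norm e * norm h * norm k powr (2 * (1/2)) * t powr (- (p + 1/2))"
          using k unfolding \<phi>_def by (simp add: mult_ac blinfun.diff_left)
      qed (use a k p \<alpha> in auto)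
      also have "\<dots> = ?c * norm e * norm h" by (simp add: algebra_simps)
      also have "(\<integral>t. \<phi> t \<partial>exp_measure lam) = apply2 (U2 (x + k) - U2 x) e h"
        using T(1) by (simp add: \<phi>_def U2 T_def blinfun.diff_left)
      finally show "norm (apply2 (U2 (x + k) - U2 x) e h) \<le> ?c * norm e * norm h" by simp
    qed
  qed
qed

end

section \<open>From the Laplace transform to the norms of the function spaces\<close>

lemma bdd_cont_bcontfun: "bdd_cont (apply_bcontfun f) (norm f)"
  using norm_bounded[of f] by (auto simp: bdd_cont_def)

lemma zygmund_seminorm_le:
  assumes "\<And>x h. h \<noteq> 0 \<Longrightarrow> norm (F (x + 2 *\<^sub>R h) - 2 *\<^sub>R F (x + h) + F x) \<le> C * norm h"
  shows "zygmund_seminorm F \<le> ennreal C"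
  unfolding zygmund_seminorm_def
  by (intro SUP_least ennreal_leI) (use assms in \<open>simp add: divide_le_eq\<close>)

lemma hoelder_seminorm_le:
  assumes "\<And>x h. h \<noteq> 0 \<Longrightarrow> norm (F (x + h) - F x) \<le> C * norm h powr \<alpha>"
  shows "hoelder_seminorm \<alpha> F \<le> ennreal C"
  unfolding hoelder_seminorm_def
  by (intro SUP_least ennreal_leI) (use assms in \<open>simp add: divide_le_eq\<close>)

lemma hoelder_seminorm_finiteD:
  assumes "hoelder_seminorm \<alpha> F < \<infinity>"
  shows "norm (F x - F y) \<le> enn2real (hoelder_seminorm \<alpha> F) * norm (x - y) powr \<alpha>"
proof (cases "x = y")
  case False
  have "ennreal (norm (F (y + (x - y)) - F y) / norm (x - y) powr \<alpha>) \<le> hoelder_seminorm \<alpha> F"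
    unfolding hoelder_seminorm_def by (intro SUP_upper2[of y] SUP_upper2[of "x - y"]) (use False in auto)
  then have "norm (F x - F y) / norm (x - y) powr \<alpha> \<le> enn2real (hoelder_seminorm \<alpha> F)"
    using assms by (simp add: le_ennreal_iff[symmetric] ennreal_enn2real_if flip: ennreal_le_iff)
  then show ?thesis using False by (simp add: divide_le_eq)
qed simp

context ou_semigroup
begin

lemma hoelder_bcontfun:
  assumes "f \<in> Cb_hoelder \<alpha>"
  shows "hoelder \<alpha> (enn2real (hoelder_seminorm \<alpha> (apply_bcontfun f))) (apply_bcontfun f)"
  using assms hoelder_seminorm_finiteD[of \<alpha> "apply_bcontfun f"]
  by (auto simp: hoelder_def Cb_hoelder_def)

text \<open>The only contact with the generator: a solution is the resolvent of \<open>f\<close>,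
  and that is the Laplace transform \<open>U\<close>. Regularity is then a property of an explicit
  integral.\<close>

lemma solves_eq_U:
  assumes L: "OU_generator S \<mu> L" and lam: "0 < lam" and u: "solves L lam f u"
  shows "apply_bcontfun u = U lam (apply_bcontfun f)"
proof
  fix x
  have "\<exists>!u. solves L lam f u" using L lam by (auto simp: OU_generator_def resolvent_set_def)
  then have "resolvent lam L f = u" unfolding resolvent_def using u by (rule the1_equality)
  then have "u x = (LINT t:{0..}|lborel. exp (- lam * t) * OU_semigroup S \<mu> t f x)"
    using L lam by (auto simp: OU_generator_def)
  also have "\<dots> = (LINT t:{0..}|lborel. exp (- lam * t) * P t (apply_bcontfun f) x)"
    by (simp add: OU_semigroup_def P_def)
  also have "\<dots> = U lam (apply_bcontfun f) x"
    unfolding U_def by (rule integral_exp_measure[symmetric, OF P_measurable'[OF bdd_cont_bcontfun]])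
  finally show "u x = U lam (apply_bcontfun f) x" .
qed

lemma U_bcontfun_Cb1:
  fixes f u :: "'a \<Rightarrow>\<^sub>C real"
  assumes lam: "0 < lam" and u: "apply_bcontfun u = U lam (apply_bcontfun f)"
    and gr: "grad_rate (apply_bcontfun f) a \<gamma>" and \<gamma>: "0 < \<gamma>" "\<gamma> < 1"
  shows "D1 u = U1 lam (apply_bcontfun f)" "u \<in> Cb1"
    "norm_Cb1 u \<le> ennreal (norm f * exp_powr_const lam 0 + a * exp_powr_const lam \<gamma>)"
proof -
  note f = bdd_cont_bcontfun[of f]
  note G = U_gateaux[OF lam f gr \<gamma>]
  show D1: "D1 u = U1 lam (apply_bcontfun f)"
    by (rule ext) (simp add: D1_def u gateaux_deriv_eq[OF G])
  have bd: "bounded (range (\<lambda>x. U1 lam (apply_bcontfun f) x h))" for h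
    using DP_integrable(2)[OF lam f gr \<gamma>]
    by (intro boundedI[of _ "a * exp_powr_const lam \<gamma> * norm h"]) (auto simp: U1_apply[OF lam f gr \<gamma>])
  show "u \<in> Cb1"
    unfolding Cb1_def mem_Collect_eq D1 gateaux_differentiable_def u
    using G U1_continuous[OF lam f gr \<gamma>] bd by auto
  have "norm u \<le> norm f * exp_powr_const lam 0"
    using U_bound(2)[OF lam f] by (intro norm_bound) (simp add: u)
  moreover have "(SUP x. ennreal (norm (D1 u x))) \<le> ennreal (a * exp_powr_const lam \<gamma>)"
    unfolding D1 by (intro SUP_least ennreal_leI norm_U1_le[OF lam f gr \<gamma>])
  ultimately have "norm_Cb1 u \<le> ennreal (norm f * exp_powr_const lam 0) + ennreal (a * exp_powr_const lam \<gamma>)"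
    unfolding norm_Cb1_def by (intro add_mono ennreal_leI)
  then show "norm_Cb1 u \<le> ennreal (norm f * exp_powr_const lam 0 + a * exp_powr_const lam \<gamma>)"
    using gr lam \<gamma> by (simp add: exp_powr_const_def grad_rate_def flip: ennreal_plus)
qed

lemma Zb2_estimate:
  fixes f u :: "'a \<Rightarrow>\<^sub>C real"
  assumes lam: "0 < lam" and u: "apply_bcontfun u = U lam (apply_bcontfun f)"
  shows "u \<in> Zb2"
    "norm_Zb2 u \<le> ennreal (exp_powr_const lam 0 + exp_powr_const lam (1/2) + 56) * ennreal (norm f)"
proof -
  note f = bdd_cont_bcontfun[of f]
  have \<gamma>: "0 < (1/2::real)" "(1/2::real) < 1" by auto
  note Cb1 = U_bcontfun_Cb1[OF lam u grad_rate_bdd_cont[OF f] \<gamma>]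
  have z: "zygmund_seminorm (D1 u) \<le> ennreal (56 * norm f)"
    unfolding Cb1(1) by (rule zygmund_seminorm_le) (rule U1_zygmund[OF lam f])
  then show "u \<in> Zb2"
    using Cb1(2) le_less_trans[OF z ennreal_less_top] by (simp add: Zb2_def)
  have "norm_Zb2 u \<le> ennreal (norm f * exp_powr_const lam 0 + norm f * exp_powr_const lam (1/2)) + ennreal (56 * norm f)"
    unfolding norm_Zb2_def by (rule add_mono[OF Cb1(3) z])
  also have "\<dots> = ennreal ((exp_powr_const lam 0 + exp_powr_const lam (1/2) + 56) * norm f)"
    using lam by (simp add: exp_powr_const_def algebra_simps flip: ennreal_plus)
  also have "\<dots> = ennreal (exp_powr_const lam 0 + exp_powr_const lam (1/2) + 56) * ennreal (norm f)"
    using lam by (intro ennreal_mult) (simp_all add: exp_powr_const_def)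
  finally show "norm_Zb2 u \<le> ennreal (exp_powr_const lam 0 + exp_powr_const lam (1/2) + 56) * ennreal (norm f)" .
qed

text \<open>In order: the sup norm, the gradient, the second derivative and its Hoelder seminorm.
  All terms but the first are doubled because the gradient rate of Hoelder data has constant 2
  H.\<close>

definition schauder_const :: "real \<Rightarrow> real \<Rightarrow> real" where
  "schauder_const lam \<alpha> = exp_powr_const lam 0 + 2 * exp_powr_const lam ((1 - \<alpha>) / 2)
     + 6 * exp_powr_const lam (1 - \<alpha> / 2) + (24 / \<alpha> + 288 / (1 - \<alpha>))"

lemma schauder_const_pos:
  assumes "0 < lam" "0 < \<alpha>" "\<alpha> < 1"
  shows "0 < schauder_const lam \<alpha>"
proof -
  have "0 \<le> exp_powr_const lam p" if "p < 1" for p using that assms by (simp add: exp_powr_const_def)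
  moreover have "0 < 24 / \<alpha> + 288 / (1 - \<alpha>)" using assms by (intro add_pos_pos) auto
  ultimately show ?thesis using assms unfolding schauder_const_def by (intro add_nonneg_pos add_nonneg_nonneg) auto
qed

lemma Cb2_hoelder_estimate:
  fixes f u :: "'a \<Rightarrow>\<^sub>C real"
  assumes lam: "0 < lam" and u: "apply_bcontfun u = U lam (apply_bcontfun f)"
    and \<alpha>: "0 < \<alpha>" "\<alpha> < 1" and fH: "f \<in> Cb_hoelder \<alpha>"
  shows "u \<in> Cb2_hoelder \<alpha>"
    "norm_Cb2_hoelder \<alpha> u \<le> ennreal (schauder_const lam \<alpha>) * norm_Cb_hoelder \<alpha> f"
proof -
  note f = bdd_cont_bcontfun[of f]
  define H where "H = enn2real (hoelder_seminorm \<alpha> (apply_bcontfun f))"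
  have H: "0 \<le> H" "hoelder_seminorm \<alpha> (apply_bcontfun f) = ennreal H"
    using fH by (auto simp: H_def Cb_hoelder_def ennreal_enn2real_if)
  define \<gamma> where "\<gamma> = (1 - \<alpha>) / 2"
  have \<gamma>: "0 < \<gamma>" "\<gamma> < 1" using \<alpha> by (auto simp: \<gamma>_def)
  have gr: "grad_rate (apply_bcontfun f) (2 * H) \<gamma>"
    unfolding \<gamma>_def H_def by (rule grad_rate_hoelder[OF f hoelder_bcontfun[OF fH] \<alpha>])
  note Cb1 = U_bcontfun_Cb1[OF lam u gr \<gamma>]
  let ?c2 = "3 * (2 * H) * exp_powr_const lam (1 - \<alpha> / 2)" and ?ch = "(12 / \<alpha> + 144 / (1 - \<alpha>)) * (2 * H)"
  obtain U2 :: "'a \<Rightarrow> 'a \<Rightarrow>\<^sub>L 'a \<Rightarrow>\<^sub>L real" where U2: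
    "\<And>x. norm (U2 x) \<le> ?c2"
    "\<And>x. has_gateaux_derivative (U1 lam (apply_bcontfun f)) (U2 x) x"
    "\<And>x k. k \<noteq> 0 \<Longrightarrow> norm (U2 (x + k) - U2 x) \<le> ?ch * norm k powr \<alpha>"
    using U_second[OF lam f \<alpha> gr[unfolded \<gamma>_def]] by blast
  have D2: "D2 u = U2" by (rule ext) (simp add: D2_def Cb1(1) gateaux_deriv_eq[OF U2(2)])
  have cont: "continuous_on UNIV U2"
    unfolding continuous_on_sequentially o_def
  proof safe
    fix X x assume X: "X \<longlonglongrightarrow> (x::'a)"
    have le: "norm (U2 y - U2 x) \<le> ?ch * norm (y - x) powr \<alpha>" for y
      using U2(3)[of "y - x" x] by (cases "y = x") auto
    have "(\<lambda>n. norm (X n - x)) \<longlonglongrightarrow> 0" using X by (simp add: LIM_zero_iff tendsto_norm_zero_iff)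
    then have "(\<lambda>n. norm (X n - x) powr \<alpha>) \<longlonglongrightarrow> 0"
      using \<alpha> by (intro tendsto_zero_powrI tendsto_const) auto
    then have "(\<lambda>n. ?ch * norm (X n - x) powr \<alpha>) \<longlonglongrightarrow> 0" by (rule tendsto_mult_right_zero)
    then have "(\<lambda>n. U2 (X n) - U2 x) \<longlonglongrightarrow> 0"
      by (rule Lim_null_comparison[rotated]) (use le in \<open>auto intro!: always_eventually\<close>)
    then show "(\<lambda>n. U2 (X n)) \<longlonglongrightarrow> U2 x" by (rule LIM_zero_cancel)
  qed
  have bd: "\<bar>apply2 (U2 x) k h\<bar> \<le> ?c2 * norm k * norm h" for x k h
  proof -
    have "\<bar>apply2 (U2 x) k h\<bar> \<le> norm (blinfun_apply (U2 x) k) * norm h"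
      using norm_blinfun[of "blinfun_apply (U2 x) k" h] by simp
    also have "\<dots> \<le> (norm (U2 x) * norm k) * norm h" by (intro mult_right_mono norm_blinfun) auto
    also have "\<dots> \<le> (?c2 * norm k) * norm h" using U2(1) by (intro mult_right_mono) auto
    finally show ?thesis .
  qed
  then have bd': "bounded (range (\<lambda>x. apply2 (U2 x) k h))" for k h
    by (intro boundedI[of _ "?c2 * norm k * norm h"]) auto
  have "u \<in> Cb2"
    unfolding Cb2_def mem_Collect_eq D2 gateaux_differentiable_def Cb1(1)
    using Cb1(2) U2(2) bd' by (auto intro!: continuous_intros cont)
  moreover have h: "hoelder_seminorm \<alpha> (D2 u) \<le> ennreal ?ch"
    unfolding D2 by (rule hoelder_seminorm_le) (rule U2(3))
  ultimately show "u \<in> Cb2_hoelder \<alpha>"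
    using le_less_trans[OF h ennreal_less_top] by (simp add: Cb2_hoelder_def)
  have n2: "(SUP x. ennreal (norm (D2 u x))) \<le> ennreal ?c2"
    unfolding D2 by (intro SUP_least ennreal_leI U2(1))
  have pos: "0 \<le> exp_powr_const lam p" if "p < 1" for p using that lam by (simp add: exp_powr_const_def)
  have p1: "0 \<le> exp_powr_const lam 0" "0 \<le> exp_powr_const lam \<gamma>" "0 \<le> exp_powr_const lam (1 - \<alpha> / 2)"
    using pos \<alpha> \<gamma> by auto
  have p2: "0 \<le> 24 / \<alpha> + 288 / (1 - \<alpha>)" using \<alpha> by auto
  let ?e0 = "exp_powr_const lam 0" and ?e1 = "exp_powr_const lam \<gamma>" and ?e2 = "exp_powr_const lam (1 - \<alpha> / 2)"
    and ?e3 = "24 / \<alpha> + 288 / (1 - \<alpha>)"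
  have "norm_Cb2_hoelder \<alpha> u \<le> ennreal (norm f * ?e0 + 2 * H * ?e1) + ennreal ?c2 + ennreal ?ch"
    unfolding norm_Cb2_hoelder_def norm_Cb2_def by (intro add_mono Cb1(3) n2 h)
  also have "\<dots> = ennreal (norm f * ?e0 + 2 * H * ?e1 + ?c2 + ?ch)"
    using p1 H(1) \<alpha> by (simp flip: ennreal_plus)
  also have "norm f * ?e0 + 2 * H * ?e1 + ?c2 + ?ch = norm f * ?e0 + H * (2 * ?e1 + 6 * ?e2 + ?e3)"
    by (simp add: algebra_simps)
  \<comment> \<open>The cross terms added here are nonnegative and complete the product with
    \<open>norm f + H\<close>, the Hoelder norm of \<open>f\<close>.\<close>
  also have "ennreal \<dots> \<le> ennreal ((norm f + H) * (?e0 + (2 * ?e1 + 6 * ?e2 + ?e3)))"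
  proof (rule ennreal_leI)
    have "0 \<le> norm f * (2 * ?e1 + 6 * ?e2 + ?e3)" "0 \<le> H * ?e0"
      using p1 p2 H(1) by (auto intro!: mult_nonneg_nonneg add_nonneg_nonneg)
    then show "norm f * ?e0 + H * (2 * ?e1 + 6 * ?e2 + ?e3) \<le> (norm f + H) * (?e0 + (2 * ?e1 + 6 * ?e2 + ?e3))"
      unfolding distrib_left distrib_right by linarith
  qed
  also have "?e0 + (2 * ?e1 + 6 * ?e2 + ?e3) = schauder_const lam \<alpha>"
    by (simp add: schauder_const_def \<gamma>_def)
  also have "ennreal ((norm f + H) * schauder_const lam \<alpha>) = ennreal (schauder_const lam \<alpha>) * norm_Cb_hoelder \<alpha> f"
    using H schauder_const_pos[OF lam \<alpha>]
    by (simp add: norm_Cb_hoelder_def ennreal_mult mult.commute)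
  finally show "norm_Cb2_hoelder \<alpha> u \<le> ennreal (schauder_const lam \<alpha>) * norm_Cb_hoelder \<alpha> f" .
qed

theorem schauder_estimates:
  fixes L :: "('a \<Rightarrow>\<^sub>C real) operator"
  assumes L: "OU_generator S \<mu> L"
  shows "(\<forall>lam>0. \<forall>f. \<exists>!u. solves L lam f u) \<and>
    (\<forall>lam>0. \<exists>C>0. \<forall>f u. solves L lam f u \<longrightarrow>
        u \<in> Zb2 \<and> norm_Zb2 u \<le> ennreal C * ennreal (norm f)) \<and>
    (\<forall>lam>0. \<forall>\<alpha>. 0 < \<alpha> \<and> \<alpha> < 1 \<longrightarrow> (\<exists>C>0. \<forall>f u. f \<in> Cb_hoelder \<alpha> \<longrightarrow> solves L lam f u \<longrightarrow>
        u \<in> Cb2_hoelder \<alpha> \<and> norm_Cb2_hoelder \<alpha> u \<le> ennreal C * norm_Cb_hoelder \<alpha> f))"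
proof (intro conjI allI impI)
  fix lam :: real assume lam: "0 < lam"
  show "\<exists>!u. solves L lam f u" for f using L lam by (auto simp: OU_generator_def resolvent_set_def)
  show "\<exists>C>0. \<forall>f u. solves L lam f u \<longrightarrow> u \<in> Zb2 \<and> norm_Zb2 u \<le> ennreal C * ennreal (norm f)"
  proof (intro exI conjI allI impI)
    show "0 < exp_powr_const lam 0 + exp_powr_const lam (1/2) + 56"
      using lam by (simp add: exp_powr_const_def add_pos_pos)
  qed (use Zb2_estimate[OF lam solves_eq_U[OF L lam]] in blast)+
  fix \<alpha> :: real assume \<alpha>: "0 < \<alpha> \<and> \<alpha> < 1"
  show "\<exists>C>0. \<forall>f u. f \<in> Cb_hoelder \<alpha> \<longrightarrow> solves L lam f u \<longrightarrow>
        u \<in> Cb2_hoelder \<alpha> \<and> norm_Cb2_hoelder \<alpha> u \<le> ennreal C * norm_Cb_hoelder \<alpha> f"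
    using Cb2_hoelder_estimate[OF lam solves_eq_U[OF L lam]] schauder_const_pos[OF lam] \<alpha> by blast
qed

end

section \<open>Completeness and separability of \<open>L\<^sup>2(0,1)\<close>\<close>

lemma rep_L2: "square_integrable01 (rep_L2 u)" "abs_L2 (rep_L2 u) = u"
  using Quotient3_abs_rep[OF Quotient3_L2, of u] Quotient3_rep_reflp[OF Quotient3_L2, of u]
  by (auto simp: eq_L2_def)

lemma inner_abs_L2:
  assumes "square_integrable01 f" "square_integrable01 g"
  shows "inner (abs_L2 f) (abs_L2 g) = (\<integral>x. f x * g x \<partial>leb01)"
  using assms by (intro inner_L2.abs_eq) (auto simp: eq_L2_def)

lemma norm_abs_L2: "square_integrable01 f \<Longrightarrow> (norm (abs_L2 f))\<^sup>2 = (\<integral>x. (f x)\<^sup>2 \<partial>leb01)"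
  unfolding power2_norm_eq_inner by (simp add: inner_abs_L2 power2_eq_square)

lemma nn_integral_norm_abs_L2:
  assumes f: "square_integrable01 f"
  shows "(\<integral>\<^sup>+x. ennreal ((f x)\<^sup>2) \<partial>leb01) = ennreal ((norm (abs_L2 f))\<^sup>2)"
  unfolding norm_abs_L2[OF f] using f
  by (intro nn_integral_eq_integral) (auto simp: square_integrable01_def)

lemma square_integrable01_diff:
  assumes "square_integrable01 f" "square_integrable01 g"
  shows "square_integrable01 (\<lambda>x. f x - g x)"
  using square_integrable01_add[OF assms(1) square_integrable01_scale[OF assms(2), of "-1"]] by simp

lemma abs_L2_diff:
  assumes f: "square_integrable01 f" and g: "square_integrable01 g"
  shows "abs_L2 (\<lambda>x. f x - g x) = abs_L2 f - abs_L2 g"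
proof -
  have "abs_L2 f + (-1) *\<^sub>R abs_L2 g = abs_L2 (\<lambda>x. f x + (-1) * g x)"
    using f g square_integrable01_scale[OF g, of "-1"]
    by (subst scaleR_L2.abs_eq, simp add: eq_L2_def, subst plus_L2.abs_eq) (auto simp: eq_L2_def)
  then show ?thesis by simp
qed

lemma prob_space_leb01: "prob_space leb01"
  by (rule prob_spaceI) (simp add: space_restrict_space emeasure_restrict_space)

lemma square_integrable01_bounded:
  assumes "f \<in> borel_measurable leb01" "\<And>x. x \<in> {0<..<1} \<Longrightarrow> \<bar>f x\<bar> \<le> B"
  shows "square_integrable01 f"
proof -
  interpret prob_space leb01 by (rule prob_space_leb01)
  have "integrable leb01 (\<lambda>x. (f x)\<^sup>2)"
  proof (rule integrable_const_bound[of _ "B\<^sup>2"])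
    show "AE x in leb01. norm ((f x)\<^sup>2) \<le> B\<^sup>2"
    proof (rule AE_I2)
      fix x assume "x \<in> space leb01"
      then have "\<bar>f x\<bar> \<le> B" using assms(2) by (simp add: space_restrict_space)
      then have "\<bar>f x\<bar>\<^sup>2 \<le> B\<^sup>2" by (intro power_mono) auto
      then show "norm ((f x)\<^sup>2) \<le> B\<^sup>2" by simp
    qed
  qed (use assms(1) in measurable)
  then show ?thesis using assms(1) by (simp add: square_integrable01_def)
qed

lemma norm_abs_L2_le:
  assumes f: "square_integrable01 f" and B: "\<And>x. x \<in> {0<..<1} \<Longrightarrow> \<bar>f x\<bar> \<le> B" "0 \<le> B"
  shows "norm (abs_L2 f) \<le> B"
proof -
  interpret prob_space leb01 by (rule prob_space_leb01)
  have "(norm (abs_L2 f))\<^sup>2 \<le> (\<integral>x. B\<^sup>2 \<partial>leb01)"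
    unfolding norm_abs_L2[OF f]
  proof (rule integral_mono)
    show "integrable leb01 (\<lambda>x. (f x)\<^sup>2)" using f by (simp add: square_integrable01_def)
    fix x assume "x \<in> space leb01"
    then have "\<bar>f x\<bar>\<^sup>2 \<le> B\<^sup>2" using B by (intro power_mono) (auto simp: space_restrict_space)
    then show "(f x)\<^sup>2 \<le> B\<^sup>2" by simp
  qed simp
  then have "(norm (abs_L2 f))\<^sup>2 \<le> B\<^sup>2" by (simp add: prob_space[simplified])
  then show ?thesis using B(2) by (rule power2_le_imp_le)
qed

text \<open>Cauchy-Schwarz against the constant function 1, which has norm 1 because the interval
  has unit length.\<close>

lemma nn_integral_abs_le_L2:
  assumes f: "square_integrable01 f"
  shows "(\<integral>\<^sup>+x. ennreal \<bar>f x\<bar> \<partial>leb01) \<le> ennreal (norm (abs_L2 f))"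
proof -
  interpret prob_space leb01 by (rule prob_space_leb01)
  have [measurable]: "f \<in> borel_measurable leb01" using f by (simp add: square_integrable01_def)
  have sg: "square_integrable01 (\<lambda>x. \<bar>f x\<bar>)" and s1: "square_integrable01 (\<lambda>x. 1)"
    using f by (auto simp: square_integrable01_def)
  have "integrable leb01 (\<lambda>x. \<bar>f x\<bar>)" using square_integrable01_mult[OF sg s1] by simp
  then have "(\<integral>\<^sup>+x. ennreal \<bar>f x\<bar> \<partial>leb01) = ennreal (\<integral>x. \<bar>f x\<bar> \<partial>leb01)"
    by (intro nn_integral_eq_integral) auto
  also have "(\<integral>x. \<bar>f x\<bar> \<partial>leb01) = inner (abs_L2 (\<lambda>x. \<bar>f x\<bar>)) (abs_L2 (\<lambda>x. 1))"
    by (simp add: inner_abs_L2[OF sg s1])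
  also have "\<dots> \<le> norm (abs_L2 (\<lambda>x. \<bar>f x\<bar>)) * norm (abs_L2 (\<lambda>x. 1))" by (rule norm_cauchy_schwarz)
  also have "norm (abs_L2 (\<lambda>x. 1)) = 1"
  proof -
    have "(norm (abs_L2 (\<lambda>x. 1)))\<^sup>2 = 1" using norm_abs_L2[OF s1] prob_space by simp
    then show ?thesis using power2_eq_imp_eq[of _ "1::real"] by simp
  qed
  also have "norm (abs_L2 (\<lambda>x. \<bar>f x\<bar>)) = norm (abs_L2 f)"
    using norm_abs_L2[OF sg] norm_abs_L2[OF f] power2_eq_imp_eq[of "norm (abs_L2 (\<lambda>x. \<bar>f x\<bar>))" "norm (abs_L2 f)"] by simp
  finally show ?thesis by (simp add: ennreal_leI)
qed

text \<open>A rapidly converging subsequence has summable increments in \<open>L\<^sup>1\<close>, hence converges almost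
  everywhere, and Fatou's lemma identifies the limit in \<open>L\<^sup>2\<close>.\<close>

lemma L2_Cauchy_convergent:
  fixes X :: "nat \<Rightarrow> L2"
  assumes X: "Cauchy X"
  shows "convergent X"
proof -
  have "\<forall>k. \<exists>N. \<forall>m\<ge>N. \<forall>n\<ge>N. dist (X m) (X n) < (1/2) ^ k"
    using X by (auto simp: Cauchy_def)
  then obtain N where N: "\<And>k m n. m \<ge> N k \<Longrightarrow> n \<ge> N k \<Longrightarrow> dist (X m) (X n) < (1/2) ^ k" by metis
  \<comment> \<open>The sum dominates \<open>N j\<close> for every j \<le> k, and the summand
    \<open>k\<close> makes the sequence strictly increasing.\<close>
  define r where "r k = (\<Sum>j\<le>k. N j) + k" for k
  have r_mono: "strict_mono r" by (rule strict_mono_Suc_iff[THEN iffD2]) (simp add: r_def)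
  have rN: "r j \<ge> N k" if "k \<le> j" for j k
    using member_le_sum[of k "{..j}" N] that by (simp add: r_def)
  have d: "norm (X (r j) - X (r k)) < (1/2) ^ k" if "k \<le> j" for j k
    using N[of k "r j" "r k"] rN[of k j] rN[of k k] that by (simp add: dist_norm)
  define g where "g k = rep_L2 (X (r k))" for k
  have g: "square_integrable01 (g k)" "abs_L2 (g k) = X (r k)" for k
    unfolding g_def by (rule rep_L2)+
  have gm [measurable]: "g k \<in> borel_measurable leb01" for k using g(1)[of k] by (simp add: square_integrable01_def)
  have gd: "square_integrable01 (\<lambda>x. g j x - g k x)" "abs_L2 (\<lambda>x. g j x - g k x) = X (r j) - X (r k)" for j k
    using square_integrable01_diff[OF g(1) g(1)] abs_L2_diff[OF g(1) g(1)] g(2) by auto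
  have "(\<integral>\<^sup>+x. (\<Sum>k. ennreal \<bar>g (Suc k) x - g k x\<bar>) \<partial>leb01) = (\<Sum>k. \<integral>\<^sup>+x. ennreal \<bar>g (Suc k) x - g k x\<bar> \<partial>leb01)"
    by (rule nn_integral_suminf) measurable
  also have "\<dots> \<le> (\<Sum>k. ennreal ((1/2) ^ k))"
  proof (rule suminf_le)
    fix k
    have "(\<integral>\<^sup>+x. ennreal \<bar>g (Suc k) x - g k x\<bar> \<partial>leb01) \<le> ennreal (norm (X (r (Suc k)) - X (r k)))"
      using nn_integral_abs_le_L2[OF gd(1)[of "Suc k" k]] gd(2)[of "Suc k" k] by simp
    also have "\<dots> \<le> ennreal ((1/2) ^ k)" using d[of k "Suc k"] by (intro ennreal_leI) simp
    finally show "(\<integral>\<^sup>+x. ennreal \<bar>g (Suc k) x - g k x\<bar> \<partial>leb01) \<le> ennreal ((1/2) ^ k)" .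
  qed auto
  also have "(\<Sum>k. ennreal ((1/2) ^ k)) = ennreal (\<Sum>k. (1/2::real) ^ k)"
    by (rule suminf_ennreal2) (auto intro!: summable_geometric)
  also have "\<dots> < \<infinity>" by simp
  finally have "AE x in leb01. (\<Sum>k. ennreal \<bar>g (Suc k) x - g k x\<bar>) \<noteq> \<infinity>"
    by (intro nn_integral_noteq_infinite) auto
  then have AE_conv: "AE x in leb01. (\<lambda>k. g k x) \<longlonglongrightarrow> lim (\<lambda>k. g k x)"
  proof eventually_elim
    fix x assume "(\<Sum>k. ennreal \<bar>g (Suc k) x - g k x\<bar>) \<noteq> \<infinity>"
    then have "summable (\<lambda>k. \<bar>g (Suc k) x - g k x\<bar>)" by (intro summable_suminf_not_top) auto
    then have "summable (\<lambda>k. g (Suc k) x - g k x)" by (rule summable_rabs_cancel)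
    then have "convergent (\<lambda>n. \<Sum>k<n. g (Suc k) x - g k x)" by (simp add: summable_iff_convergent)
    then have "convergent (\<lambda>n. g n x - g 0 x)" by (simp add: sum_lessThan_telescope[of "\<lambda>k. g k x"])
    then have "convergent (\<lambda>n. (g n x - g 0 x) + g 0 x)" by (intro convergent_add convergent_const)
    then show "(\<lambda>k. g k x) \<longlonglongrightarrow> lim (\<lambda>k. g k x)" by (simp add: convergent_LIMSEQ_iff)
  qed
  define F where "F x = lim (\<lambda>k. g k x)" for x
  have Fm [measurable]: "F \<in> borel_measurable leb01" unfolding F_def[abs_def] by measurable
  have Fk: "(\<integral>\<^sup>+x. ennreal ((F x - g k x)\<^sup>2) \<partial>leb01) \<le> ennreal (((1/2) ^ k)\<^sup>2)" for k
  proof -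
    have "(\<integral>\<^sup>+x. ennreal ((F x - g k x)\<^sup>2) \<partial>leb01) = (\<integral>\<^sup>+x. liminf (\<lambda>j. ennreal ((g j x - g k x)\<^sup>2)) \<partial>leb01)"
    proof (rule nn_integral_cong_AE, use AE_conv in eventually_elim)
      fix x assume "(\<lambda>k. g k x) \<longlonglongrightarrow> lim (\<lambda>k. g k x)"
      then have "(\<lambda>j. ennreal ((g j x - g k x)\<^sup>2)) \<longlonglongrightarrow> ennreal ((F x - g k x)\<^sup>2)"
        unfolding F_def by (intro tendsto_intros tendsto_ennrealI)
      then show "ennreal ((F x - g k x)\<^sup>2) = liminf (\<lambda>j. ennreal ((g j x - g k x)\<^sup>2))"
        by (rule lim_imp_Liminf[OF sequentially_bot, symmetric])
    qed
    also have "\<dots> \<le> liminf (\<lambda>j. \<integral>\<^sup>+x. ennreal ((g j x - g k x)\<^sup>2) \<partial>leb01)"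
      by (rule nn_integral_liminf) measurable
    also have "\<dots> \<le> ennreal (((1/2) ^ k)\<^sup>2)"
    proof (rule Liminf_le)
      show "\<forall>\<^sub>F j in sequentially. (\<integral>\<^sup>+x. ennreal ((g j x - g k x)\<^sup>2) \<partial>leb01) \<le> ennreal (((1/2) ^ k)\<^sup>2)"
        using eventually_ge_at_top[of k]
      proof eventually_elim
        fix j assume "k \<le> j"
        then have "(norm (X (r j) - X (r k)))\<^sup>2 \<le> ((1/2) ^ k)\<^sup>2" using d[of k j] by (intro power_mono) auto
        then show "(\<integral>\<^sup>+x. ennreal ((g j x - g k x)\<^sup>2) \<partial>leb01) \<le> ennreal (((1/2) ^ k)\<^sup>2)"
          unfolding nn_integral_norm_abs_L2[OF gd(1)] gd(2) by (rule ennreal_leI)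
      qed
    qed simp
    finally show ?thesis .
  qed
  have sF': "square_integrable01 (\<lambda>x. F x - g k x)" for k
    unfolding square_integrable01_def
    using le_less_trans[OF Fk ennreal_less_top] by (intro conjI integrableI_bounded) auto
  have sF: "square_integrable01 F" using square_integrable01_add[OF sF'[of 0] g(1)[of 0]] by simp
  have "norm (abs_L2 F - X (r k)) \<le> (1/2) ^ k" for k
  proof -
    have "ennreal ((norm (abs_L2 F - X (r k)))\<^sup>2) \<le> ennreal (((1/2) ^ k)\<^sup>2)"
      using Fk[of k] unfolding nn_integral_norm_abs_L2[OF sF'] abs_L2_diff[OF sF g(1)] g(2) .
    then have "(norm (abs_L2 F - X (r k)))\<^sup>2 \<le> ((1/2) ^ k)\<^sup>2" by simp
    then show ?thesis by (rule power2_le_imp_le) simp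
  qed
  then have "\<forall>k. norm (X (r k) - abs_L2 F) \<le> (1/2) ^ k" by (simp add: norm_minus_commute)
  then have "(\<lambda>k. X (r k) - abs_L2 F) \<longlonglongrightarrow> 0"
    by (rule Lim_null_comparison[OF always_eventually]) (rule LIMSEQ_power_zero, simp)
  then have "(\<lambda>k. X (r k)) \<longlonglongrightarrow> abs_L2 F" by (rule LIM_zero_cancel)
  then have "convergent (X \<circ> r)" by (auto simp: convergent_def o_def)
  then show ?thesis using X r_mono Cauchy_converges_subseq by (metis convergent_def)
qed

text \<open>Completeness is what the uniform boundedness argument and the integrals of orbits rely
  on in the study of the heat semigroup.\<close>

instance L2 :: complete_space
  by standard (rule L2_Cauchy_convergent)

instance L2 :: banach ..

section \<open>Separability through polynomials with rational coefficients\<close>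

definition rat_poly :: "rat list \<Rightarrow> real \<Rightarrow> real" where
  "rat_poly qs x = (\<Sum>i<length qs. of_rat (qs ! i) * x ^ i)"

lemma continuous_leb01_measurable:
  fixes f :: "real \<Rightarrow> real"
  shows "continuous_on UNIV f \<Longrightarrow> f \<in> borel_measurable leb01"
  by (intro measurable_restrict_space1 measurable_completion) (auto intro: borel_measurable_continuous_onI)

lemma rat_poly_square_integrable: "square_integrable01 (rat_poly qs)"
proof (rule square_integrable01_bounded)
  show "rat_poly qs \<in> borel_measurable leb01"
    unfolding rat_poly_def[abs_def] by (intro continuous_leb01_measurable continuous_intros)
  show "\<bar>rat_poly qs x\<bar> \<le> (\<Sum>i<length qs. \<bar>of_rat (qs ! i)\<bar>)" if x: "x \<in> {0<..<1}" for x
    unfolding rat_poly_def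
  proof (rule order_trans[OF sum_abs sum_mono])
    fix i
    have "\<bar>real_of_rat (qs ! i) * x ^ i\<bar> = \<bar>of_rat (qs ! i)\<bar> * x ^ i" using x by (simp add: abs_mult)
    also have "\<dots> \<le> \<bar>of_rat (qs ! i)\<bar> * 1" using x by (intro mult_left_mono power_le_one) auto
    finally show "\<bar>real_of_rat (qs ! i) * x ^ i\<bar> \<le> \<bar>of_rat (qs ! i)\<bar>" by simp
  qed
qed

lemma rat_poly_uniformly_dense:
  fixes g :: "real \<Rightarrow> real"
  assumes g: "continuous_on {0..1} g" and e: "0 < e"
  shows "\<exists>qs. \<forall>x\<in>{0..1}. \<bar>g x - rat_poly qs x\<bar> \<le> e"
proof -
  have "0 < e / 2" using e by simp
  then obtain p where p: "real_polynomial_function p" "\<And>x. x \<in> {0..1} \<Longrightarrow> \<bar>g x - p x\<bar> < e / 2"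
    using Stone_Weierstrass_real_polynomial_function[OF compact_Icc g] by metis
  obtain a n where a: "p = (\<lambda>x. \<Sum>i\<le>n. a i * x ^ i)"
    using p(1) real_polynomial_function_iff_sum by auto
  let ?d = "e / (2 * real (Suc n))"
  have "\<exists>q::rat. \<bar>a i - of_rat q\<bar> < ?d" for i
  proof -
    have "a i - ?d < a i + ?d" using e by simp
    then obtain q where "a i - ?d < of_rat q" "of_rat q < a i + ?d" using of_rat_dense by blast
    then show ?thesis by (intro exI[of _ q]) (simp add: abs_less_iff)
  qed
  then obtain q :: "nat \<Rightarrow> rat" where q: "\<And>i. \<bar>a i - of_rat (q i)\<bar> < ?d" by metis
  let ?qs = "map q [0..<Suc n]"
  have rp: "rat_poly ?qs x = (\<Sum>i\<le>n. of_rat (q i) * x ^ i)" for x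
    unfolding rat_poly_def by (intro sum.cong) (auto simp del: upt_Suc simp: less_Suc_eq_le)
  have "\<bar>g x - rat_poly ?qs x\<bar> \<le> e" if x: "x \<in> {0..1}" for x
  proof -
    have "\<bar>p x - rat_poly ?qs x\<bar> = \<bar>\<Sum>i\<le>n. (a i - of_rat (q i)) * x ^ i\<bar>"
      by (simp add: a rp sum_subtractf left_diff_distrib del: upt_Suc)
    also have "\<dots> \<le> (\<Sum>i\<le>n. \<bar>(a i - of_rat (q i)) * x ^ i\<bar>)" by (rule sum_abs)
    also have "\<dots> \<le> (\<Sum>i\<le>n. ?d)"
    proof (rule sum_mono)
      fix i
      have "\<bar>(a i - of_rat (q i)) * x ^ i\<bar> = \<bar>a i - of_rat (q i)\<bar> * x ^ i" using x by (simp add: abs_mult)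
      also have "\<dots> \<le> ?d * 1" using q[of i] x e by (intro mult_mono power_le_one) auto
      finally show "\<bar>(a i - of_rat (q i)) * x ^ i\<bar> \<le> ?d" by simp
    qed
    also have "\<dots> = e / 2" by (simp add: field_simps)
    finally show ?thesis using p(2)[OF x] by linarith
  qed
  then show ?thesis by blast
qed

lemma L2_dominated_convergence:
  assumes f: "square_integrable01 f" and g: "\<And>n::nat. square_integrable01 (g n)"
    and w: "integrable leb01 w" "\<And>n x. (f x - g n x)\<^sup>2 \<le> w x"
    and lim: "AE x in leb01. (\<lambda>n. g n x) \<longlonglongrightarrow> f x"
  shows "(\<lambda>n. norm (abs_L2 f - abs_L2 (g n))) \<longlonglongrightarrow> 0"
proof -
  have m: "f \<in> borel_measurable leb01" "\<And>n. g n \<in> borel_measurable leb01"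
    using f g by (auto simp: square_integrable01_def)
  have "(\<lambda>n. \<integral>x. (f x - g n x)\<^sup>2 \<partial>leb01) \<longlonglongrightarrow> (\<integral>x. 0 \<partial>leb01)"
  proof (rule integral_dominated_convergence[OF _ _ w(1)])
    show "AE x in leb01. (\<lambda>n. (f x - g n x)\<^sup>2) \<longlonglongrightarrow> 0"
      using lim
    proof eventually_elim
      fix x assume "(\<lambda>n. g n x) \<longlonglongrightarrow> f x"
      then have "(\<lambda>n. (f x - g n x)\<^sup>2) \<longlonglongrightarrow> (f x - f x)\<^sup>2" by (intro tendsto_intros)
      then show "(\<lambda>n. (f x - g n x)\<^sup>2) \<longlonglongrightarrow> 0" by simp
    qed
  qed (use m w(2) in auto)
  then have "(\<lambda>n. (norm (abs_L2 f - abs_L2 (g n)))\<^sup>2) \<longlonglongrightarrow> 0"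
    by (simp add: norm_abs_L2[OF square_integrable01_diff[OF f g], symmetric] abs_L2_diff[OF f g])
  then have "(\<lambda>n. sqrt ((norm (abs_L2 f - abs_L2 (g n)))\<^sup>2)) \<longlonglongrightarrow> sqrt 0" by (rule tendsto_real_sqrt)
  then show ?thesis by simp
qed

definition clamp1 :: "real \<Rightarrow> real \<Rightarrow> real" where
  "clamp1 M x = max (- M) (min M x)"

lemma clamp1_props:
  assumes "0 \<le> M"
  shows "\<bar>clamp1 M x\<bar> \<le> M" "\<bar>x - clamp1 M x\<bar> \<le> \<bar>x\<bar>" "\<bar>x\<bar> \<le> M \<Longrightarrow> clamp1 M x = x"
  using assms by (auto simp: clamp1_def max_def min_def)

lemma clamp1_continuous: "continuous_on A (clamp1 M)"
  unfolding clamp1_def by (intro continuous_intros)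

text \<open>Three approximations, each within e/3: truncation of \<open>f\<close>, continuous
  functions converging almost everywhere to the truncation, and Weierstrass with rational
  coefficients. Clamping the continuous functions at the truncation level keeps their convergence
  dominated.\<close>

lemma L2_rat_poly_dense:
  assumes e: "0 < e"
  shows "\<exists>qs. norm (u - abs_L2 (rat_poly qs)) < e"
proof -
  obtain f where f: "square_integrable01 f" "abs_L2 f = u" using rep_L2 by blast
  have fm [measurable]: "f \<in> borel_measurable leb01" using f by (simp add: square_integrable01_def)
  have f2: "integrable leb01 (\<lambda>x. (f x)\<^sup>2)" using f by (simp add: square_integrable01_def)
  have cm: "(\<lambda>x. clamp1 M (h x)) \<in> borel_measurable leb01" if "h \<in> borel_measurable leb01" for h M
    using that borel_measurable_continuous_onI[OF clamp1_continuous] by (rule measurable_compose)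
  have cs: "square_integrable01 (\<lambda>x. clamp1 M (h x))" if "h \<in> borel_measurable leb01" "0 \<le> M" for h M
    by (rule square_integrable01_bounded[OF cm[OF that(1)], of M]) (rule clamp1_props[OF that(2)])
  have "(\<lambda>n. norm (abs_L2 f - abs_L2 (\<lambda>x. clamp1 (real n) (f x)))) \<longlonglongrightarrow> 0"
  proof (rule L2_dominated_convergence[OF f(1) _ f2])
    show "square_integrable01 (\<lambda>x. clamp1 (real n) (f x))" for n by (rule cs[OF fm]) simp
    show "(f x - clamp1 (real n) (f x))\<^sup>2 \<le> (f x)\<^sup>2" for n x
      using clamp1_props(2)[of "real n" "f x"] by (simp add: abs_le_square_iff)
    show "AE x in leb01. (\<lambda>n. clamp1 (real n) (f x)) \<longlonglongrightarrow> f x"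
    proof (intro AE_I2 tendsto_eventually)
      fix x
      obtain m where "\<bar>f x\<bar> \<le> real m" using real_arch_simple by blast
      then show "\<forall>\<^sub>F n in sequentially. clamp1 (real n) (f x) = f x"
        by (intro eventually_sequentiallyI[of m] clamp1_props(3)) simp_all
    qed
  qed
  then have "\<forall>\<^sub>F n in sequentially. norm (abs_L2 f - abs_L2 (\<lambda>x. clamp1 (real n) (f x))) < e / 3"
    using e by (intro order_tendstoD(2)[of _ 0]) auto
  then obtain M where M: "norm (abs_L2 f - abs_L2 (\<lambda>x. clamp1 (real M) (f x))) < e / 3"
    by (auto dest: eventually_happens)
  let ?h = "\<lambda>x. clamp1 (real M) (f x)"
  \<comment> \<open>Values outside the interval are arbitrary, so they are set to 0 to obtain a
    function measurable on the whole line.\<close>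
  define f0 where "f0 x = (if x \<in> {0<..<1::real} then f x else 0)" for x
  have "f0 \<in> borel_measurable lebesgue"
    unfolding f0_def[abs_def] by (rule borel_measurable_if_I[OF fm]) simp
  then have "f0 measurable_on UNIV" by (rule lebesgue_measurable_imp_measurable_on_real) simp
  then obtain N g where N: "negligible N" and g: "\<And>n. continuous_on UNIV (g n)"
    "\<And>x. x \<notin> N \<Longrightarrow> (\<lambda>n. g n x) \<longlonglongrightarrow> f0 x"
    unfolding measurable_on_def by auto
  have gc: "continuous_on UNIV (\<lambda>x. clamp1 (real M) (g n x))" for n
    by (rule continuous_on_compose2[OF clamp1_continuous g(1)]) auto
  interpret prob_space leb01 by (rule prob_space_leb01)
  have "(\<lambda>n. norm (abs_L2 ?h - abs_L2 (\<lambda>x. clamp1 (real M) (g n x)))) \<longlonglongrightarrow> 0"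
  proof (rule L2_dominated_convergence[where w = "\<lambda>_. (2 * real M)\<^sup>2"])
    show "square_integrable01 ?h" by (rule cs[OF fm]) simp
    show "square_integrable01 (\<lambda>x. clamp1 (real M) (g n x))" for n
      by (rule cs[OF continuous_leb01_measurable[OF g(1)]]) simp
    show "(?h x - clamp1 (real M) (g n x))\<^sup>2 \<le> (2 * real M)\<^sup>2" for n x
    proof (rule abs_le_square_iff[THEN iffD1])
      show "\<bar>?h x - clamp1 (real M) (g n x)\<bar> \<le> \<bar>2 * real M\<bar>"
        using clamp1_props(1)[of "real M" "f x"] clamp1_props(1)[of "real M" "g n x"] by linarith
    qed
    have "N \<in> null_sets lebesgue" using N by (simp add: negligible_iff_null_sets)
    then have "AE x in lebesgue. x \<notin> N" by (rule AE_not_in)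
    then have "AE x in leb01. x \<notin> N" by (subst AE_restrict_space_iff) auto
    moreover have "AE x in leb01. x \<in> {0<..<1}" by (rule AE_I2) (simp add: space_restrict_space)
    ultimately show "AE x in leb01. (\<lambda>n. clamp1 (real M) (g n x)) \<longlonglongrightarrow> ?h x"
    proof eventually_elim
      fix x assume x: "x \<notin> N" "x \<in> {0<..<1::real}"
      then have "(\<lambda>n. g n x) \<longlonglongrightarrow> f x" using g(2)[OF x(1)] by (simp add: f0_def)
      then show "(\<lambda>n. clamp1 (real M) (g n x)) \<longlonglongrightarrow> ?h x"
        by (rule continuous_on_tendsto_compose[OF clamp1_continuous[of UNIV]]) auto
    qed
  qed simp
  then have "\<forall>\<^sub>F n in sequentially. norm (abs_L2 ?h - abs_L2 (\<lambda>x. clamp1 (real M) (g n x))) < e / 3"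
    using e by (intro order_tendstoD(2)[of _ 0]) auto
  then obtain n where n: "norm (abs_L2 ?h - abs_L2 (\<lambda>x. clamp1 (real M) (g n x))) < e / 3"
    by (auto dest: eventually_happens)
  let ?g = "\<lambda>x. clamp1 (real M) (g n x)"
  have sg: "square_integrable01 ?g" by (rule cs[OF continuous_leb01_measurable[OF g(1)]]) simp
  have "\<exists>qs. \<forall>x\<in>{0..1}. \<bar>?g x - rat_poly qs x\<bar> \<le> e / 3"
    using e by (intro rat_poly_uniformly_dense continuous_on_subset[OF gc]) auto
  then obtain qs where qs: "\<And>x. x \<in> {0..1} \<Longrightarrow> \<bar>?g x - rat_poly qs x\<bar> \<le> e / 3" by blast
  have "norm (abs_L2 ?g - abs_L2 (rat_poly qs)) \<le> e / 3"
    unfolding abs_L2_diff[OF sg rat_poly_square_integrable, symmetric]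
    by (rule norm_abs_L2_le[OF square_integrable01_diff[OF sg rat_poly_square_integrable]]) (use qs e in auto)
  then have "norm ((abs_L2 f - abs_L2 ?h) + (abs_L2 ?h - abs_L2 ?g) + (abs_L2 ?g - abs_L2 (rat_poly qs))) < e"
    using M n norm_triangle_ineq[of "abs_L2 f - abs_L2 ?h" "abs_L2 ?h - abs_L2 ?g"]
      norm_triangle_ineq[of "(abs_L2 f - abs_L2 ?h) + (abs_L2 ?h - abs_L2 ?g)" "abs_L2 ?g - abs_L2 (rat_poly qs)"]
    by linarith
  then show ?thesis using f(2) by (intro exI[of _ qs]) simp
qed

text \<open>Balls of radius 1/(n+1) around rational polynomials form a countable base. Second
  countability makes addition measurable on product spaces and provides the approximating
  projections.\<close>

instance L2 :: second_countable_topology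
proof
  define B where "B = (\<lambda>(qs, n). ball (abs_L2 (rat_poly qs)) (1 / real (Suc n))) ` (UNIV :: (rat list \<times> nat) set)"
  have "topological_basis B"
  proof (rule topological_basisI)
    show "open b" if "b \<in> B" for b using that by (auto simp: B_def)
    fix A :: "L2 set" and u assume A: "open A" "u \<in> A"
    then obtain e where e: "0 < e" "ball u e \<subseteq> A" by (meson open_contains_ball)
    obtain n where n: "1 / real (Suc n) < e / 2" using nat_approx_posE[of "e / 2"] e by auto
    obtain qs where qs: "norm (u - abs_L2 (rat_poly qs)) < 1 / real (Suc n)"
      using L2_rat_poly_dense[of "1 / real (Suc n)" u] by auto
    show "\<exists>b\<in>B. u \<in> b \<and> b \<subseteq> A"
    proof (intro bexI[of _ "ball (abs_L2 (rat_poly qs)) (1 / real (Suc n))"] conjI)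
      show "u \<in> ball (abs_L2 (rat_poly qs)) (1 / real (Suc n))"
        using qs by (simp add: dist_norm norm_minus_commute)
      show "ball (abs_L2 (rat_poly qs)) (1 / real (Suc n)) \<subseteq> A"
      proof (rule order_trans[OF subsetI e(2)])
        fix v assume v: "v \<in> ball (abs_L2 (rat_poly qs)) (1 / real (Suc n))"
        have "dist u v \<le> dist u (abs_L2 (rat_poly qs)) + dist (abs_L2 (rat_poly qs)) v" by (rule dist_triangle)
        also have "\<dots> < e" using v n qs by (simp add: dist_norm)
        finally show "v \<in> ball u e" by simp
      qed
    qed (auto simp: B_def)
  qed
  moreover have "countable B" unfolding B_def by (rule countable_image) simp
  ultimately show "\<exists>B::L2 set set. countable B \<and> open = generate_topology B"
    using topological_basis_imp_subbasis by blast
qed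

section \<open>Semigroups with symmetric dissipative generator\<close>

text \<open>\<open>T h\<close> is half the difference of the values of \<open>T\<close> at x + h and
  x - h, so \<open>T\<close> cannot be small on all of a ball, wherever its centre \<open>x\<close>
  lies.\<close>

lemma norm_blinfun_sup_shift:
  fixes T :: "'a::real_normed_vector \<Rightarrow>\<^sub>L 'b::real_normed_vector"
  assumes r: "0 < r" and C: "0 \<le> C" "C < norm T"
  shows "\<exists>y. norm (y - x) \<le> r \<and> C * r < norm (T y)"
proof (rule ccontr)
  assume "\<not> ?thesis"
  then have le: "norm (T y) \<le> C * r" if "norm (y - x) \<le> r" for y using that by (meson not_less)
  have "norm T \<le> C"
  proof (rule norm_blinfun_bound_sphere[OF r C(1)])
    fix h :: 'a assume h: "norm h = r"
    have "2 *\<^sub>R T h = T (x + h) - T (x - h)" by (simp add: blinfun.add_right blinfun.diff_right scaleR_2)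
    then have "2 * norm (T h) \<le> norm (T (x + h)) + norm (T (x - h))"
      by (metis norm_triangle_ineq4 norm_scaleR abs_numeral)
    then show "norm (T h) \<le> C * r" using le[of "x + h"] le[of "x - h"] h by simp
  qed
  then show False using C by simp
qed

text \<open>Gliding hump: the steps \<open>3\<^sup>-\<^sup>n\<close> are summable while the values at step \<open>n\<close> are of order \<open>(4/3)\<^sup>n\<close>.\<close>

lemma uniform_boundedness:
  fixes T :: "nat \<Rightarrow> 'a::banach \<Rightarrow>\<^sub>L 'b::real_normed_vector"
  assumes bdd: "\<And>x. \<exists>M. \<forall>n. norm (T n x) \<le> M"
  shows "\<exists>M. \<forall>n. norm (T n) \<le> M"
proof (rule ccontr)
  assume "\<not> ?thesis"
  then have "\<forall>k. \<exists>n. (4::real) ^ k < norm (T n)" by (meson not_less)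
  then obtain r where r: "\<And>k. (4::real) ^ k < norm (T (r k))" by metis
  have pos: "0 < norm (T (r k))" for k
    using r[of k] zero_less_power[of "4::real" k] by linarith
  have "\<exists>y. norm (y - x) \<le> (1/3) ^ k \<and> 3/4 * norm (T (r k)) * (1/3) ^ k < norm (T (r k) y)" for x k
    by (rule norm_blinfun_sup_shift) (use pos[of k] in auto)
  then obtain step where step: "\<And>x k. norm (step x k - x) \<le> (1/3) ^ k"
    "\<And>x k. 3/4 * norm (T (r k)) * (1/3) ^ k < norm (T (r k) (step x k))" by metis
  define X where "X = rec_nat 0 (\<lambda>k x. step x k)"
  have X: "X (Suc k) = step (X k) k" for k by (simp add: X_def)
  have dX: "norm (X (Suc k) - X k) \<le> (1/3) ^ k" for k unfolding X by (rule step)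
  \<comment> \<open>3/2 * 3^(-k) is the sum of all steps from index k on; keeping the exact partial
    sum lets the induction close.\<close>
  have tail: "norm (X (k + n) - X k) \<le> 3/2 * (1/3) ^ k * (1 - (1/3) ^ n)" for k n
  proof (induction n)
    case (Suc n)
    have "norm (X (k + Suc n) - X k) \<le> norm (X (Suc (k + n)) - X (k + n)) + norm (X (k + n) - X k)"
      using norm_triangle_ineq[of "X (Suc (k + n)) - X (k + n)" "X (k + n) - X k"] by simp
    also have "\<dots> \<le> (1/3) ^ (k + n) + 3/2 * (1/3) ^ k * (1 - (1/3) ^ n)"
      by (intro add_mono dX Suc.IH)
    also have "\<dots> = 3/2 * (1/3) ^ k * (1 - (1/3) ^ Suc n)" by (simp add: power_add field_simps)
    finally show ?case .
  qed simp
  have sm: "summable (\<lambda>k. X (Suc k) - X k)"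
    by (rule summable_comparison_test'[OF summable_geometric[of "1/3::real"], of 0]) (use dX in auto)
  then have "convergent (\<lambda>n. \<Sum>k<n. X (Suc k) - X k)" by (simp add: summable_iff_convergent)
  then have "convergent (\<lambda>n. X n - X 0)" by (simp add: sum_lessThan_telescope)
  then have "convergent X" by (simp add: X_def)
  then obtain l where l: "X \<longlonglongrightarrow> l" by (auto simp: convergent_def)
  have tail_l: "norm (l - X k) \<le> 3/2 * (1/3) ^ k" for k
  proof (rule LIMSEQ_le_const2)
    show "(\<lambda>n. norm (X (n + k) - X k)) \<longlonglongrightarrow> norm (l - X k)"
      by (intro tendsto_intros LIMSEQ_ignore_initial_segment l)
    have "norm (X (n + k) - X k) \<le> 3/2 * (1/3) ^ k" for n
    proof -
      have "3/2 * (1/3::real) ^ k * (1 - (1/3) ^ n) \<le> 3/2 * (1/3) ^ k * 1" by (intro mult_left_mono) auto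
      then show ?thesis using tail[of k n] unfolding add.commute[of n k] by linarith
    qed
    then show "\<exists>N. \<forall>n\<ge>N. norm (X (n + k) - X k) \<le> 3/2 * (1/3) ^ k" by blast
  qed
  obtain M where M: "\<And>n. norm (T n l) \<le> M" using bdd by blast
  \<comment> \<open>After step k the sequence still moves by at most 3/2 * 3^(-k-1), which is half
    of 3^(-k). Of the share 3/4 gained at step k at least 1/4 therefore survives in the
    limit.\<close>
  have "1/4 * (4/3) ^ k \<le> M" for k
  proof -
    let ?n = "norm (T (r k))"
    have "norm (T (r k) (l - X (Suc k))) \<le> ?n * norm (l - X (Suc k))" by (rule norm_blinfun)
    also have "\<dots> \<le> ?n * (3/2 * (1/3) ^ Suc k)" by (intro mult_left_mono tail_l) simp
    finally have "norm (T (r k) (X (Suc k)) - T (r k) l) \<le> 1/2 * ?n * (1/3) ^ k"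
      by (simp add: blinfun.diff_right norm_minus_commute mult_ac)
    then have "norm (T (r k) (X (Suc k))) \<le> 1/2 * ?n * (1/3) ^ k + norm (T (r k) l)"
      using norm_triangle_sub[of "T (r k) (X (Suc k))" "T (r k) l"] by linarith
    moreover have "3/4 * ?n * (1/3) ^ k < norm (T (r k) (X (Suc k)))" unfolding X by (rule step)
    ultimately have "1/4 * (?n * (1/3) ^ k) \<le> M" using M[of "r k"] by simp
    moreover have "4 ^ k * (1/3) ^ k \<le> ?n * (1/3) ^ k" using r[of k] by (intro mult_right_mono) auto
    ultimately show ?thesis by (simp add: power_mult_distrib[symmetric])
  qed
  moreover obtain k where "4 * M < (4/3) ^ k" using real_arch_pow[of "4/3" "4 * M"] by auto
  moreover have "1/4 * (4/3) ^ k \<le> M" by fact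
  ultimately show False by linarith
qed

lemma right_difference_quotient:
  assumes f: "(f has_vector_derivative D) (at a within {a..b})" and ab: "a < b"
  shows "((\<lambda>r. (f (a + r) - f a) /\<^sub>R r) \<longlongrightarrow> D) (at_right 0)"
proof (rule tendstoI)
  fix e :: real assume e: "0 < e"
  then have "\<exists>d>0. \<forall>y\<in>{a..b}. norm (y - a) < d \<longrightarrow> norm (f y - f a - (y - a) *\<^sub>R D) \<le> e / 2 * norm (y - a)"
    using f unfolding has_vector_derivative_def has_derivative_within_alt by (metis half_gt_zero)
  then obtain d where d: "0 < d"
    "\<And>y. y \<in> {a..b} \<Longrightarrow> norm (y - a) < d \<Longrightarrow> norm (f y - f a - (y - a) *\<^sub>R D) \<le> e / 2 * norm (y - a)" by blast
  have "dist ((f (a + r) - f a) /\<^sub>R r) D < e" if r: "0 < r" "r < min d (b - a)" for r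
  proof -
    have "norm (f (a + r) - f a - r *\<^sub>R D) \<le> e / 2 * r" using d(2)[of "a + r"] r by simp
    moreover have "(f (a + r) - f a) /\<^sub>R r - D = (f (a + r) - f a - r *\<^sub>R D) /\<^sub>R r"
      using r by (simp add: scaleR_diff_right)
    moreover have "norm ((f (a + r) - f a - r *\<^sub>R D) /\<^sub>R r) = norm (f (a + r) - f a - r *\<^sub>R D) / r"
      using r by (simp only: norm_scaleR) (simp add: divide_inverse mult.commute)
    ultimately have "norm ((f (a + r) - f a) /\<^sub>R r - D) \<le> e / 2"
      using r by (simp only: pos_divide_le_eq)
    then show ?thesis using e by (simp add: dist_norm)
  qed
  then show "\<forall>\<^sub>F r in at_right 0. dist ((f (a + r) - f a) /\<^sub>R r) D < e"
    unfolding eventually_at_right_field using d(1) ab by (intro exI[of _ "min d (b - a)"]) auto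
qed

locale symmetric_dissipative_semigroup =
  fixes S :: "real \<Rightarrow> 'a::{real_inner, banach} \<Rightarrow>\<^sub>L 'a" and A :: "'a operator"
  assumes C0: "C0_semigroup S" and gen: "infinitesimal_generator S = A"
    and symm: "\<And>x y u v. (x, y) \<in> A \<Longrightarrow> (u, v) \<in> A \<Longrightarrow> inner y u = inner x v"
    and diss: "\<And>x y. (x, y) \<in> A \<Longrightarrow> inner y x \<le> 0"
begin

lemma S_0: "S 0 x = x" and S_add: "0 \<le> r \<Longrightarrow> 0 \<le> t \<Longrightarrow> S (r + t) = S r o\<^sub>L S t"
  and S_lim: "((\<lambda>t. S t x) \<longlongrightarrow> x) (at_right 0)"
  using C0 by (auto simp: C0_semigroup_def)

lemma S_near_0:
  assumes "0 < e"
  shows "\<exists>d>0. \<forall>h. 0 \<le> h \<longrightarrow> h < d \<longrightarrow> norm (S h x - x) < e"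
proof -
  obtain d where d: "0 < d" "\<And>h. 0 < h \<Longrightarrow> h < d \<Longrightarrow> norm (S h x - x) < e"
    using tendstoD[OF S_lim assms, of x] unfolding eventually_at_right_field dist_norm by auto
  have "norm (S h x - x) < e" if "0 \<le> h" "h < d" for h
    using d(2)[of h] that assms by (cases "h = 0") (auto simp: S_0)
  then show ?thesis using d(1) by blast
qed

text \<open>Otherwise there are times tending to 0 along which the operator norms are unbounded,
  although strong continuity bounds every orbit along them, contrary to uniform boundedness.\<close>

lemma S_bounded_near_0: "\<exists>d>0. \<exists>K. \<forall>t. 0 \<le> t \<longrightarrow> t \<le> d \<longrightarrow> norm (S t) \<le> K"
proof (rule ccontr)
  assume "\<not> ?thesis"
  then have "\<exists>t. 0 \<le> t \<and> t \<le> 1 / real (Suc n) \<and> real n < norm (S t)" for n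
    by (meson not_less zero_less_divide_1_iff of_nat_0_less_iff zero_less_Suc)
  then obtain t where t: "\<And>n. 0 \<le> t n" "\<And>n. t n \<le> 1 / real (Suc n)" "\<And>n. real n < norm (S (t n))" by metis
  have "\<exists>M. \<forall>n. norm (S (t n) x) \<le> M" for x
  proof -
    obtain d where d: "0 < d" "\<And>h. 0 \<le> h \<Longrightarrow> h < d \<Longrightarrow> norm (S h x - x) < 1"
      using S_near_0[of 1 x] by auto
    obtain N where N: "1 / real (Suc N) < d" using nat_approx_posE[OF d(1)] by blast
    \<comment> \<open>The sum takes care of the finitely many indices below \<open>N\<close>, whose
      times may still be far from 0.\<close>
    have "norm (S (t n) x) \<le> norm x + 1 + (\<Sum>j<N. norm (S (t j) x))" for n
    proof (cases "n < N")
      case True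
      then have "norm (S (t n) x) \<le> (\<Sum>j<N. norm (S (t j) x))"
        by (intro member_le_sum) auto
      then show ?thesis using norm_ge_zero[of x] by linarith
    next
      case False
      then have "1 / real (Suc n) \<le> 1 / real (Suc N)" by (simp add: field_simps)
      then have "norm (S (t n) x - x) < 1" using t[of n] N by (intro d(2)) auto
      moreover have "0 \<le> (\<Sum>j<N. norm (S (t j) x))" by (intro sum_nonneg) auto
      ultimately show ?thesis using norm_triangle_sub[of "S (t n) x" x] by linarith
    qed
    then show ?thesis by blast
  qed
  then obtain M where M: "\<And>n. norm (S (t n)) \<le> M" using uniform_boundedness[of "\<lambda>n. S (t n)"] by blast
  obtain n where "M < real n" using reals_Archimedean2 by blast
  then show False using M[of n] t(3)[of n] by linarith
qed

text \<open>A time up to \<open>T\<close> is n steps of length at most \<open>d\<close>, with the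
  same n for all of them; raising the bound near 0 to at least 1 keeps its powers positive.\<close>

lemma S_locally_bounded: "\<exists>K>0. \<forall>t. 0 \<le> t \<longrightarrow> t \<le> T \<longrightarrow> norm (S t) \<le> K"
proof -
  obtain d K0 where d: "0 < d" "\<And>t. 0 \<le> t \<Longrightarrow> t \<le> d \<Longrightarrow> norm (S t) \<le> K0"
    using S_bounded_near_0 by blast
  define K where "K = max K0 1"
  have K: "norm (S t) \<le> K" if "0 \<le> t" "t \<le> d" for t using d(2)[OF that] by (simp add: K_def)
  have pow: "norm (S (real n * t)) \<le> K ^ n" if "0 \<le> t" "t \<le> d" for n t
  proof (induction n)
    case 0
    have "S 0 = id_blinfun" using C0 by (simp add: C0_semigroup_def)
    then show ?case by (simp add: norm_blinfun_id_le)
  next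
    case (Suc n)
    have "S (real (Suc n) * t) = S t o\<^sub>L S (real n * t)"
      using S_add[of t "real n * t"] that by (simp add: distrib_right)
    then have "norm (S (real (Suc n) * t)) \<le> norm (S t) * norm (S (real n * t))"
      by (simp add: norm_blinfun_compose)
    also have "\<dots> \<le> K * K ^ n" using K[OF that] Suc.IH by (intro mult_mono) (auto simp: K_def)
    finally show ?case by simp
  qed
  obtain n where n: "T / d < real n" using reals_Archimedean2 by blast
  have "norm (S t) \<le> K ^ n" if t: "0 \<le> t" "t \<le> T" for t
  proof -
    have "0 \<le> T / d" using t d(1) by simp
    then have n0: "0 < real n" using n by linarith
    have "t / real n \<le> d" using n n0 t d(1) by (simp add: field_simps)
    then have "norm (S (real n * (t / real n))) \<le> K ^ n" using t n0 by (intro pow) auto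
    then show ?thesis using n0 by simp
  qed
  moreover have "0 < K ^ n" by (simp add: K_def)
  ultimately show ?thesis by blast
qed

lemma S_diff_le:
  assumes "0 \<le> r" "r \<le> t" "norm (S r) \<le> K"
  shows "norm (S t x - S r x) \<le> K * norm (S (t - r) x - x)"
proof -
  have "S t x - S r x = S r (S (t - r) x - x)"
    using S_add[of r "t - r"] assms by (simp add: blinfun.diff_right)
  then have "norm (S t x - S r x) \<le> norm (S r) * norm (S (t - r) x - x)" by (metis norm_blinfun)
  also have "\<dots> \<le> K * norm (S (t - r) x - x)" using assms by (intro mult_right_mono) auto
  finally show ?thesis .
qed

text \<open>Factoring out the smaller of two times, as in \<open>S_diff_le\<close>, reduces
  continuity from either side to right continuity at 0, at the cost of a local bound of the operator
  norms.\<close>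

lemma S_continuous: "continuous_on {0..} (\<lambda>t. S t x)"
  unfolding continuous_on_iff
proof (intro ballI allI impI)
  fix t e :: real assume t: "t \<in> {0..}" and e: "0 < e"
  obtain K where K: "0 < K" "\<And>r. 0 \<le> r \<Longrightarrow> r \<le> t + 1 \<Longrightarrow> norm (S r) \<le> K"
    using S_locally_bounded[of "t + 1"] by blast
  obtain d where d: "0 < d" "\<And>h. 0 \<le> h \<Longrightarrow> h < d \<Longrightarrow> norm (S h x - x) < e / K"
    using S_near_0[of "e / K" x] e K by auto
  have "dist (S r x) (S t x) < e" if r: "r \<in> {0..}" "dist r t < min d 1" for r
  proof -
    have *: "norm (S v x - S u x) < e" if "0 \<le> u" "u \<le> v" "u \<le> t + 1" "v - u < d" for u v
    proof -
      have "norm (S v x - S u x) \<le> K * norm (S (v - u) x - x)" using that K by (intro S_diff_le) auto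
      also have "\<dots> < K * (e / K)" using that K d by (intro mult_strict_left_mono) auto
      finally show ?thesis using K by simp
    qed
    show ?thesis
      using *[of r t] *[of t r] r t by (cases "r \<le> t") (auto simp: dist_norm norm_minus_commute)
  qed
  then show "\<exists>d>0. \<forall>r\<in>{0..}. dist r t < d \<longrightarrow> dist (S r x) (S t x) < e"
    using d(1) by (intro exI[of _ "min d 1"]) auto
qed

lemma A_lim: "(x, y) \<in> A \<longleftrightarrow> ((\<lambda>t. (S t x - x) /\<^sub>R t) \<longlongrightarrow> y) (at_right 0)"
  unfolding gen[symmetric] infinitesimal_generator_def by simp

lemma A_invariant:
  assumes xy: "(x, y) \<in> A" and t: "0 \<le> t"
  shows "(S t x, S t y) \<in> A"
  unfolding A_lim
proof (rule Lim_transform_eventually)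
  show "((\<lambda>h. S t ((S h x - x) /\<^sub>R h)) \<longlongrightarrow> S t y) (at_right 0)"
    using xy unfolding A_lim by (intro blinfun.tendsto tendsto_const)
  show "\<forall>\<^sub>F h in at_right 0. S t ((S h x - x) /\<^sub>R h) = (S h (S t x) - S t x) /\<^sub>R h"
    unfolding eventually_at_right_field
  proof (intro exI[of _ 1] conjI allI impI)
    fix h :: real assume "0 < h"
    then have "S t (S h x) = S h (S t x)"
      using S_add[of t h] S_add[of h t] t by (metis add.commute blinfun_apply_blinfun_compose less_imp_le)
    then show "S t ((S h x - x) /\<^sub>R h) = (S h (S t x) - S t x) /\<^sub>R h"
      by (simp add: blinfun.scaleR_right blinfun.diff_right)
  qed simp
qed

lemma S_derivative:
  assumes xy: "(x, y) \<in> A" and t: "0 < t"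
  shows "((\<lambda>t. S t x) has_vector_derivative S t y) (at t)"
  unfolding has_vector_derivative_def has_derivative_at_alt
proof (intro conjI allI impI)
  show "bounded_linear (\<lambda>h. h *\<^sub>R S t y)" by (rule bounded_linear_scaleR_left)
  fix e :: real assume e: "0 < e"
  obtain K where K: "0 < K" "\<And>r. 0 \<le> r \<Longrightarrow> r \<le> t + 1 \<Longrightarrow> norm (S r) \<le> K"
    using S_locally_bounded[of "t + 1"] by blast
  have e': "0 < e / (2 * K)" using e K by simp
  obtain d1 where d1: "0 < d1" "\<And>h. 0 < h \<Longrightarrow> h < d1 \<Longrightarrow> dist ((S h x - x) /\<^sub>R h) y < e / (2 * K)"
    using tendstoD[OF xy[unfolded A_lim] e'] unfolding eventually_at_right_field by auto
  have d1': "norm (S h x - x - h *\<^sub>R y) \<le> h * (e / (2 * K))" if h: "0 < h" "h < d1" for h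
  proof -
    have "S h x - x - h *\<^sub>R y = h *\<^sub>R ((S h x - x) /\<^sub>R h - y)" using h by (simp add: scaleR_diff_right)
    then have "norm (S h x - x - h *\<^sub>R y) = h * norm ((S h x - x) /\<^sub>R h - y)" using h by simp
    also have "\<dots> \<le> h * (e / (2 * K))" using d1(2)[OF h] h by (intro mult_left_mono) (auto simp: dist_norm)
    finally show ?thesis .
  qed
  have SK: "norm (S r (S h x - x - h *\<^sub>R y)) \<le> e / 2 * h" if "0 < h" "h < d1" "0 \<le> r" "r \<le> t + 1" for h r
  proof -
    have "norm (S r (S h x - x - h *\<^sub>R y)) \<le> norm (S r) * norm (S h x - x - h *\<^sub>R y)" by (rule norm_blinfun)
    also have "\<dots> \<le> K * (h * (e / (2 * K)))" using K that d1' by (intro mult_mono) auto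
    finally show ?thesis using K by (simp add: mult.commute)
  qed
  obtain d2 where d2: "0 < d2" "\<And>r. 0 \<le> r \<Longrightarrow> dist r t < d2 \<Longrightarrow> dist (S r y) (S t y) < e / 2"
    using S_continuous[of y] t e unfolding continuous_on_iff by (metis atLeast_iff half_gt_zero less_imp_le)
  show "\<exists>d>0. \<forall>r. norm (r - t) < d \<longrightarrow> norm (S r x - S t x - (r - t) *\<^sub>R S t y) \<le> e * norm (r - t)"
  proof (intro exI[of _ "min (min d1 d2) (min t 1)"] conjI allI impI)
    fix r assume r: "norm (r - t) < min (min d1 d2) (min t 1)"
    then have r0: "0 < r" by auto
    consider "r = t" | "t < r" | "r < t" by linarith
    then show "norm (S r x - S t x - (r - t) *\<^sub>R S t y) \<le> e * norm (r - t)"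
    proof cases
      case 2
      have "S r x = S t (S (r - t) x)" using S_add[of t "r - t"] 2 t by simp
      then have "S r x - S t x - (r - t) *\<^sub>R S t y = S t (S (r - t) x - x - (r - t) *\<^sub>R y)"
        by (simp add: blinfun.diff_right blinfun.scaleR_right)
      then have "norm (S r x - S t x - (r - t) *\<^sub>R S t y) \<le> e / 2 * (r - t)"
        using SK[of "r - t" t] 2 r t by simp
      also have "\<dots> \<le> e * (r - t)" using 2 e by (intro mult_right_mono) auto
      finally show ?thesis using 2 by simp
    next
      case 3
      have *: "S t x = S r (S (t - r) x)" using S_add[of r "t - r"] 3 r0 by simp
      \<comment> \<open>Factoring out the smaller time \<open>r\<close> produces the derivative
        \<open>S r y\<close> instead of \<open>S t y\<close>; the discrepancy is small by continuity
        of the orbit of \<open>y\<close>.\<close>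
      have "S r x - S t x - (r - t) *\<^sub>R S t y =
          (t - r) *\<^sub>R (S t y - S r y) - S r (S (t - r) x - x - (t - r) *\<^sub>R y)"
        by (simp only: * blinfun.diff_right blinfun.scaleR_right) (simp add: algebra_simps)
      then have "norm (S r x - S t x - (r - t) *\<^sub>R S t y) \<le>
          (t - r) * norm (S t y - S r y) + norm (S r (S (t - r) x - x - (t - r) *\<^sub>R y))"
        using norm_triangle_ineq4[of "(t - r) *\<^sub>R (S t y - S r y)"] 3 by simp
      also have "\<dots> \<le> (t - r) * (e / 2) + e / 2 * (t - r)"
        using SK[of "t - r" r] 3 r r0 d2(2)[of r]
        by (intro add_mono mult_left_mono) (auto simp: dist_norm norm_minus_commute)
      finally show ?thesis using 3 by (simp add: mult.commute)
    qed simp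
  qed (use d1(1) d2(1) t in auto)
qed

lemma contraction_on_domain:
  assumes xy: "(x, y) \<in> A" and t: "0 \<le> t"
  shows "norm (S t x) \<le> norm x"
proof -
  have "inner (S t x) (S t x) \<le> inner (S 0 x) (S 0 x)"
  proof (rule DERIV_nonpos_imp_decreasing_open[OF t])
    fix r :: real assume r: "0 < r"
    have "((\<lambda>t. inner (S t x) (S t x)) has_vector_derivative inner (S r x) (S r y) + inner (S r y) (S r x)) (at r)"
      by (rule bounded_bilinear.has_vector_derivative[OF bounded_bilinear_inner S_derivative[OF xy r] S_derivative[OF xy r]])
    moreover have "inner (S r y) (S r x) \<le> 0" using diss[OF A_invariant[OF xy, of r]] r by simp
    ultimately show "\<exists>D. ((\<lambda>t. inner (S t x) (S t x)) has_real_derivative D) (at r) \<and> D \<le> 0"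
      by (intro exI[of _ "inner (S r x) (S r y) + inner (S r y) (S r x)"])
         (simp add: has_real_derivative_iff_has_vector_derivative inner_commute)
  next
    show "continuous_on {0..t} (\<lambda>t. inner (S t x) (S t x))"
      by (intro continuous_intros continuous_on_subset[OF S_continuous]) auto
  qed
  then have "(norm (S t x))\<^sup>2 \<le> (norm x)\<^sup>2" by (simp add: S_0 power2_norm_eq_inner)
  then show ?thesis by (rule power2_le_imp_le) simp
qed

text \<open>The function r \<mapsto> \<open>inner (S r x) (S (t - r) u)\<close> is constant, because
  symmetry of the generator makes its derivative vanish; its values at t and 0 are the two
  sides.\<close>

lemma selfadjoint_on_domain:
  assumes xy: "(x, y) \<in> A" and uv: "(u, v) \<in> A" and t: "0 \<le> t"
  shows "inner (S t x) u = inner x (S t u)"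
proof (cases "t = 0")
  case False
  then have t: "0 < t" using t by simp
  let ?\<phi> = "\<lambda>r. inner (S r x) (S (t - r) u)"
  have "?\<phi> t = ?\<phi> 0"
  proof (rule DERIV_isconst2[OF t])
    show "continuous_on {0..t} ?\<phi>"
      by (intro continuous_intros continuous_on_subset[OF S_continuous]
          continuous_on_compose2[OF S_continuous]) auto
    fix r assume r: "0 < r" "r < t"
    have "((\<lambda>r. S (t - r) u) has_vector_derivative (-1) *\<^sub>R S (t - r) v) (at r)"
    proof -
      have "((\<lambda>r. t - r) has_real_derivative -1) (at r)" by (auto intro!: derivative_eq_intros)
      then have d: "((\<lambda>r. t - r) has_vector_derivative -1) (at r)"
        by (simp add: has_real_derivative_iff_has_vector_derivative)
      have "((\<lambda>s. S s u) has_vector_derivative S (t - r) v) (at (t - r))"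
        using S_derivative[OF uv] r by simp
      from vector_diff_chain_at[OF d this] show ?thesis by (simp add: o_def)
    qed
    then have "(?\<phi> has_vector_derivative inner (S r x) ((-1) *\<^sub>R S (t - r) v) + inner (S r y) (S (t - r) u)) (at r)"
      by (rule bounded_bilinear.has_vector_derivative[OF bounded_bilinear_inner S_derivative[OF xy r(1)]])
    moreover have "inner (S r y) (S (t - r) u) = inner (S r x) (S (t - r) v)"
      using r by (intro symm A_invariant xy uv) auto
    ultimately show "(?\<phi> has_real_derivative 0) (at r)"
      by (simp add: has_real_derivative_iff_has_vector_derivative)
  qed (use t in auto)
  then show ?thesis by (simp add: S_0)
qed (simp add: S_0)

text \<open>The averages of the orbit over [0, h] tend to \<open>x\<close>, and they lie in the
  domain: applying \<open>S r\<close> to the integral shifts its interval, so the difference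
  quotient involves only the two end pieces.\<close>

lemma domain_dense:
  assumes e: "0 < e"
  shows "\<exists>z w. (z, w) \<in> A \<and> norm (z - x) < e"
proof -
  define I where "I u = integral {0..u} (\<lambda>r. S r x)" for u
  have cont: "continuous_on {a..b} (\<lambda>r. S r x)" if "0 \<le> a" for a b
    by (rule continuous_on_subset[OF S_continuous]) (use that in auto)
  have I_quot: "((\<lambda>r. (I (a + r) - I a) /\<^sub>R r) \<longlongrightarrow> S a x) (at_right 0)" if a: "0 \<le> a" for a
  proof (rule right_difference_quotient)
    have "(I has_vector_derivative S a x) (at a within {0..a + 1})"
      unfolding I_def[abs_def] using a by (intro integral_has_vector_derivative cont) auto
    then show "(I has_vector_derivative S a x) (at a within {a..a + 1})"
      by (rule has_vector_derivative_within_subset) (use a in auto)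
  qed simp
  have I0: "I 0 = 0" by (simp add: I_def)
  have in_A: "(I h, S h x - x) \<in> A" if h: "0 < h" for h
    unfolding A_lim
  proof (rule Lim_transform_eventually)
    show "((\<lambda>r. (I (h + r) - I h) /\<^sub>R r - (I (0 + r) - I 0) /\<^sub>R r) \<longlongrightarrow> S h x - x) (at_right 0)"
      using I_quot[of h] I_quot[of 0] h by (intro tendsto_diff) (auto simp: S_0)
    show "\<forall>\<^sub>F r in at_right 0. (I (h + r) - I h) /\<^sub>R r - (I (0 + r) - I 0) /\<^sub>R r = (S r (I h) - I h) /\<^sub>R r"
      unfolding eventually_at_right_field
    proof (intro exI[of _ 1] conjI allI impI)
      fix r :: real assume r: "0 < r"
      have "S r (I h) = integral {0..h} (S r o (\<lambda>u. S u x))"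
        unfolding I_def by (intro integral_linear[symmetric] integrable_continuous_interval cont blinfun.bounded_linear_right) simp
      also have "\<dots> = integral {0..h} ((\<lambda>u. S u x) o ((+) r))"
        by (rule Henstock_Kurzweil_Integration.integral_cong) (use r S_add[of r] in auto)
      also have "\<dots> = integral {0 + r..h + r} (\<lambda>u. S u x)" by (rule integral_shift_Icc_real)
      finally have "S r (I h) = integral {r..h + r} (\<lambda>u. S u x)" by simp
      moreover have "I r + integral {r..h + r} (\<lambda>u. S u x) = I (h + r)"
        unfolding I_def using r h
        by (intro Henstock_Kurzweil_Integration.integral_combine integrable_continuous_interval cont) auto
      ultimately have *: "S r (I h) = I (h + r) - I r" by (simp add: algebra_simps)
      show "(I (h + r) - I h) /\<^sub>R r - (I (0 + r) - I 0) /\<^sub>R r = (S r (I h) - I h) /\<^sub>R r"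
        unfolding * I0 by (simp add: scaleR_diff_right)
    qed simp
  qed
  have "((\<lambda>h. I h /\<^sub>R h) \<longlongrightarrow> x) (at_right 0)" using I_quot[of 0] by (simp add: I0 S_0)
  then have "\<forall>\<^sub>F h in at_right 0. dist (I h /\<^sub>R h) x < e" using e by (rule tendstoD)
  then obtain d where d: "0 < d" "\<And>h. 0 < h \<Longrightarrow> h < d \<Longrightarrow> dist (I h /\<^sub>R h) x < e"
    unfolding eventually_at_right_field by auto
  let ?h = "d / 2"
  have "((\<lambda>t. (S t (I ?h /\<^sub>R ?h) - I ?h /\<^sub>R ?h) /\<^sub>R t) \<longlongrightarrow> (S ?h x - x) /\<^sub>R ?h) (at_right 0)"
  proof -
    have "((\<lambda>t. ((S t (I ?h) - I ?h) /\<^sub>R t) /\<^sub>R ?h) \<longlongrightarrow> (S ?h x - x) /\<^sub>R ?h) (at_right 0)"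
      using in_A[of ?h] d(1) unfolding A_lim by (intro tendsto_intros) auto
    then show ?thesis by (simp add: blinfun.scaleR_right scaleR_diff_right mult.commute)
  qed
  then have "(I ?h /\<^sub>R ?h, (S ?h x - x) /\<^sub>R ?h) \<in> A" unfolding A_lim .
  moreover have "norm (I ?h /\<^sub>R ?h - x) < e" using d(2)[of ?h] d(1) by (simp add: dist_norm)
  ultimately show ?thesis by blast
qed

lemma domain_sequence: "\<exists>z w. (\<forall>n::nat. (z n, w n) \<in> A) \<and> z \<longlonglongrightarrow> x"
proof -
  have "\<forall>n. \<exists>z w. (z, w) \<in> A \<and> norm (z - x) < 1 / real (Suc n)" by (intro allI domain_dense) simp
  then obtain z w where z: "\<And>n. (z n, w n) \<in> A" "\<And>n. norm (z n - x) < 1 / real (Suc n)" by metis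
  have "(\<lambda>n. z n - x) \<longlonglongrightarrow> 0"
    by (rule Lim_null_comparison[OF always_eventually LIMSEQ_Suc[OF lim_1_over_n]])
       (use z(2) in \<open>auto intro: less_imp_le\<close>)
  then show ?thesis using z(1) LIM_zero_cancel by blast
qed

lemma contraction:
  assumes t: "0 \<le> t"
  shows "norm (S t x) \<le> norm x"
proof -
  obtain z w where z: "\<And>n::nat. (z n, w n) \<in> A" "z \<longlonglongrightarrow> x" using domain_sequence by blast
  show ?thesis
    by (rule LIMSEQ_le[of "\<lambda>n. norm (S t (z n))" _ "\<lambda>n. norm (z n)"])
       (use z contraction_on_domain[OF z(1) t] in \<open>auto intro!: tendsto_intros\<close>)
qed

lemma selfadjoint:
  assumes t: "0 \<le> t"
  shows "inner (S t x) u = inner x (S t u)"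
proof -
  obtain z w where z: "\<And>n::nat. (z n, w n) \<in> A" "z \<longlonglongrightarrow> x" using domain_sequence by blast
  obtain z' w' where z': "\<And>n::nat. (z' n, w' n) \<in> A" "z' \<longlonglongrightarrow> u" using domain_sequence by blast
  have "(\<lambda>n. inner (S t (z n)) (z' n)) \<longlonglongrightarrow> inner (S t x) u" using z(2) z'(2) by (intro tendsto_intros)
  moreover have "(\<lambda>n. inner (S t (z n)) (z' n)) \<longlonglongrightarrow> inner x (S t u)"
    unfolding selfadjoint_on_domain[OF z(1) z'(1) t] using z(2) z'(2) by (intro tendsto_intros)
  ultimately show ?thesis by (rule LIMSEQ_unique)
qed

end

section \<open>The Dirichlet Laplacian\<close>

lemma leb01_ident_measurable: "(\<lambda>x. x) \<in> borel_measurable leb01"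
  using id_borel_measurable_lebesgue_on[of "{0<..<1::real}"] by (simp add: id_def)

lemma LINT_leb01:
  fixes g :: "real \<Rightarrow> real"
  assumes "x \<in> {0..1}"
  shows "(LINT y:{0<..<x}|lebesgue. g y) = (\<integral>y. (if y < x then g y else 0) \<partial>leb01)"
proof -
  have "(\<integral>y. (if y < x then g y else 0) \<partial>leb01) =
      (\<integral>y. indicator {0<..<1} y *\<^sub>R (if y < x then g y else 0) \<partial>lebesgue)"
    by (rule integral_restrict_space) simp
  also have "\<dots> = (\<integral>y. indicator {0<..<x} y *\<^sub>R g y \<partial>lebesgue)"
    using assms by (intro Bochner_Integration.integral_cong) (auto simp: indicator_def)
  finally show ?thesis by (simp add: set_lebesgue_integral_def)
qed

lemma square_integrable01_integrable: "square_integrable01 f \<Longrightarrow> integrable leb01 f"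
  using square_integrable01_mult[of f "\<lambda>_. 1"] square_integrable01_bounded[of "\<lambda>_. 1" 1] by simp

lemma primitive_props:
  fixes W :: "real \<Rightarrow> real"
  assumes W: "integrable leb01 W" and G: "\<forall>x\<in>{0..1}. G x = G 0 + (LINT y:{0<..<x}|lebesgue. W y)"
  shows "G \<in> borel_measurable leb01" "\<And>x. x \<in> {0<..<1} \<Longrightarrow> \<bar>G x\<bar> \<le> \<bar>G 0\<bar> + (\<integral>y. \<bar>W y\<bar> \<partial>leb01)"
proof -
  interpret prob_space leb01 by (rule prob_space_leb01)
  have [measurable]: "W \<in> borel_measurable leb01" using W by simp
  note [measurable] = leb01_ident_measurable
  have G': "G x = G 0 + (\<integral>y. (if y < x then W y else 0) \<partial>leb01)" if "x \<in> {0<..<1}" for x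
    using G[rule_format, of x] that LINT_leb01[of x W] by simp
  have "(\<lambda>x. G 0 + (\<integral>y. (if y < x then W y else 0) \<partial>leb01)) \<in> borel_measurable leb01"
    by measurable
  then show "G \<in> borel_measurable leb01"
    by (subst measurable_cong[OF G']) (simp_all add: space_restrict_space)
  fix x assume x: "x \<in> {0<..<1::real}"
  have i: "integrable leb01 (\<lambda>y. if y < x then W y else 0)"
    by (rule Bochner_Integration.integrable_bound[OF W]) auto
  have "\<bar>\<integral>y. (if y < x then W y else 0) \<partial>leb01\<bar> \<le> (\<integral>y. \<bar>if y < x then W y else 0\<bar> \<partial>leb01)"
    using integral_norm_bound[of leb01 "\<lambda>y. if y < x then W y else 0"] by simp
  also have "\<dots> \<le> (\<integral>y. \<bar>W y\<bar> \<partial>leb01)"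
    using W i by (intro integral_mono integrable_abs) auto
  finally show "\<bar>G x\<bar> \<le> \<bar>G 0\<bar> + (\<integral>y. \<bar>W y\<bar> \<partial>leb01)" unfolding G'[OF x] by linarith
qed

lemma leb01_split_at:
  fixes W :: "real \<Rightarrow> real"
  assumes W: "integrable leb01 W"
  shows "(\<integral>x. (if y < x then W x else 0) \<partial>leb01) = (\<integral>x. W x \<partial>leb01) - (\<integral>x. (if x < y then W x else 0) \<partial>leb01)"
proof -
  note [measurable] = leb01_ident_measurable
  have [measurable]: "W \<in> borel_measurable leb01" using W by simp
  have i: "integrable leb01 (\<lambda>x. if x < y then W x else 0)" "integrable leb01 (\<lambda>x. if y < x then W x else 0)"
    by (rule Bochner_Integration.integrable_bound[OF W]; auto)+
  have "AE x in lborel. x \<noteq> y" by (rule AE_lborel_singleton)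
  then have "AE x in lebesgue. x \<noteq> y" by (rule AE_completion)
  then have "AE x in leb01. x \<noteq> y" by (subst AE_restrict_space_iff) auto
  then have "(\<integral>x. (if y < x then W x else 0) \<partial>leb01) = (\<integral>x. W x - (if x < y then W x else 0) \<partial>leb01)"
    by (intro integral_cong_AE) (auto elim!: eventually_mono)
  then show ?thesis using W i by simp
qed

text \<open>Integration by parts in disguise: the product \<open>W x * g y\<close> is integrated
  over the triangle y < x in both orders, and the inner integral over x > y is the total minus the
  primitive of \<open>W\<close>.\<close>

lemma leb01_triangle_fubini:
  fixes W g :: "real \<Rightarrow> real"
  assumes W: "integrable leb01 W" and g: "integrable leb01 g"
  shows "(\<integral>x. W x * (\<integral>y. (if y < x then g y else 0) \<partial>leb01) \<partial>leb01) =
    (\<integral>y. g y * ((\<integral>x. W x \<partial>leb01) - (\<integral>x. (if x < y then W x else 0) \<partial>leb01)) \<partial>leb01)"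
proof -
  interpret prob_space leb01 by (rule prob_space_leb01)
  interpret P: pair_prob_space leb01 leb01 ..
  have [measurable]: "W \<in> borel_measurable leb01" "g \<in> borel_measurable leb01" using W g by simp_all
  note [measurable] = leb01_ident_measurable
  have "integrable (leb01 \<Otimes>\<^sub>M leb01) (\<lambda>(x, y). W x * g y)"
  proof (rule P.Fubini_integrable)
    show "integrable leb01 (\<lambda>x. \<integral>y. norm (case (x, y) of (x, y) \<Rightarrow> W x * g y) \<partial>leb01)"
      using W by (simp add: abs_mult)
    show "AE x in leb01. integrable leb01 (\<lambda>y. case (x, y) of (x, y) \<Rightarrow> W x * g y)"
      using g by simp
  qed measurable
  then have "integrable (leb01 \<Otimes>\<^sub>M leb01) (\<lambda>(x, y). W x * (if y < x then g y else 0))"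
    by (rule Bochner_Integration.integrable_bound) (measurable, auto simp: abs_mult)
  then have "(\<integral>y. \<integral>x. W x * (if y < x then g y else 0) \<partial>leb01 \<partial>leb01) =
      (\<integral>x. \<integral>y. W x * (if y < x then g y else 0) \<partial>leb01 \<partial>leb01)"
    by (rule P.Fubini_integral)
  moreover have "(\<integral>x. W x * (if y < x then g y else 0) \<partial>leb01) =
      g y * ((\<integral>x. W x \<partial>leb01) - (\<integral>x. (if x < y then W x else 0) \<partial>leb01))" for y
  proof -
    have "(\<lambda>x. W x * (if y < x then g y else 0)) = (\<lambda>x. g y * (if y < x then W x else 0))" by auto
    then show ?thesis by (simp add: leb01_split_at[OF W])
  qed
  ultimately show ?thesis by simp
qed

text \<open>Here \<open>G'\<close> is the first derivative of \<open>F\<close>, and \<open>G\<close>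
  is a primitive of \<open>W\<close>. Integration by parts leaves constants multiplied by the
  integral of \<open>G'\<close>, which is \<open>F 1 - F 0\<close> and vanishes by the boundary
  conditions.\<close>

lemma dirichlet_green:
  fixes F G G' W :: "real \<Rightarrow> real"
  assumes F: "represents F v" "F 0 = 0" "F 1 = 0"
    "\<forall>x\<in>{0..1}. F x = F 0 + (LINT y:{0<..<x}|lebesgue. G' y)"
    and G': "G' \<in> borel_measurable leb01" "\<And>x. x \<in> {0<..<1} \<Longrightarrow> \<bar>G' x\<bar> \<le> B'"
    and W: "represents W w" and G: "\<forall>x\<in>{0..1}. G x = G 0 + (LINT y:{0<..<x}|lebesgue. W y)"
  shows "inner w v = - (\<integral>x. G' x * G x \<partial>leb01)"
proof -
  have sq: "square_integrable01 W" "square_integrable01 F" "abs_L2 W = w" "abs_L2 F = v"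
    using F(1) W by (auto simp: represents_def)
  have iW: "integrable leb01 W" by (rule square_integrable01_integrable[OF sq(1)])
  have sG': "square_integrable01 G'" by (rule square_integrable01_bounded[OF G'])
  have iG': "integrable leb01 G'" by (rule square_integrable01_integrable[OF sG'])
  have sG: "square_integrable01 G"
    by (rule square_integrable01_bounded[OF primitive_props[OF iW G]])
  have iGG: "integrable leb01 (\<lambda>x. G' x * G x)" by (rule square_integrable01_mult[OF sG' sG])
  have "(\<integral>y. G' y \<partial>leb01) = (\<integral>y. (if y < 1 then G' y else 0) \<partial>leb01)"
    by (rule Bochner_Integration.integral_cong) (auto simp: space_restrict_space)
  also have "\<dots> = F 1" using F(2) F(4)[rule_format, of 1] LINT_leb01[of 1 G'] by simp
  finally have zero: "(\<integral>y. G' y \<partial>leb01) = 0" using F(3) by simp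
  have "inner w v = (\<integral>x. W x * F x \<partial>leb01)" using inner_abs_L2[OF sq(1,2)] sq(3,4) by simp
  also have "\<dots> = (\<integral>x. W x * (\<integral>y. (if y < x then G' y else 0) \<partial>leb01) \<partial>leb01)"
  proof (rule Bochner_Integration.integral_cong)
    fix x assume "x \<in> space leb01"
    then have x: "x \<in> {0..1}" by (auto simp: space_restrict_space)
    show "W x * F x = W x * (\<integral>y. (if y < x then G' y else 0) \<partial>leb01)"
      using F(2) F(4)[rule_format, OF x] LINT_leb01[OF x, of G'] by simp
  qed simp
  also have "\<dots> = (\<integral>y. G' y * ((\<integral>x. W x \<partial>leb01) - (\<integral>x. (if x < y then W x else 0) \<partial>leb01)) \<partial>leb01)"
    by (rule leb01_triangle_fubini[OF iW iG'])
  also have "\<dots> = (\<integral>y. ((\<integral>x. W x \<partial>leb01) + G 0) * G' y - G' y * G y \<partial>leb01)"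
  proof (rule Bochner_Integration.integral_cong)
    fix y assume "y \<in> space leb01"
    then have y: "y \<in> {0..1}" by (auto simp: space_restrict_space)
    have "G y = G 0 + (\<integral>x. (if x < y then W x else 0) \<partial>leb01)"
      using G[rule_format, OF y] LINT_leb01[OF y, of W] by simp
    then show "G' y * ((\<integral>x. W x \<partial>leb01) - (\<integral>x. (if x < y then W x else 0) \<partial>leb01)) =
        ((\<integral>x. W x \<partial>leb01) + G 0) * G' y - G' y * G y" by (simp add: algebra_simps)
  qed simp
  also have "\<dots> = - (\<integral>x. G' x * G x \<partial>leb01)" using iG' iGG zero by simp
  finally show ?thesis .
qed

text \<open>Expresses all three pairings by the same first derivatives, so that symmetry and
  dissipativity can be read off from one bilinear form.\<close>

lemma dirichlet_laplacian_form:
  assumes "(u, w) \<in> dirichlet_laplacian" "(v, z) \<in> dirichlet_laplacian"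
  obtains G G' :: "real \<Rightarrow> real" where
    "inner w v = - (\<integral>x. G' x * G x \<partial>leb01)" "inner z u = - (\<integral>x. G x * G' x \<partial>leb01)"
    "inner w u = - (\<integral>x. G x * G x \<partial>leb01)"
proof -
  obtain F G W where 1: "represents F u" "represents W w" "F 0 = 0" "F 1 = 0"
    "\<forall>x\<in>{0..1}. F x = F 0 + (LINT y:{0<..<x}|lebesgue. G y)"
    "\<forall>x\<in>{0..1}. G x = G 0 + (LINT y:{0<..<x}|lebesgue. W y)"
    using assms(1) unfolding dirichlet_laplacian_def mem_Collect_eq prod.case by blast
  obtain F' G' W' where 2: "represents F' v" "represents W' z" "F' 0 = 0" "F' 1 = 0"
    "\<forall>x\<in>{0..1}. F' x = F' 0 + (LINT y:{0<..<x}|lebesgue. G' y)"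
    "\<forall>x\<in>{0..1}. G' x = G' 0 + (LINT y:{0<..<x}|lebesgue. W' y)"
    using assms(2) unfolding dirichlet_laplacian_def mem_Collect_eq prod.case by blast
  have i: "integrable leb01 W" "integrable leb01 W'"
    using 1(2) 2(2) by (auto simp: represents_def intro: square_integrable01_integrable)
  note G = primitive_props[OF i(1) 1(6)] and G' = primitive_props[OF i(2) 2(6)]
  show ?thesis
    by (rule that[OF dirichlet_green[OF 2(1,3,4,5) G' 1(2,6)] dirichlet_green[OF 1(1,3,4,5) G 2(2,6)]
          dirichlet_green[OF 1(1,3,4,5) G 1(2,6)]])
qed

lemma dirichlet_laplacian_symmetric:
  assumes "(u, w) \<in> dirichlet_laplacian" "(v, z) \<in> dirichlet_laplacian"
  shows "inner w v = inner u z"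
  by (rule dirichlet_laplacian_form[OF assms]) (simp add: inner_commute[of u] mult.commute)

lemma dirichlet_laplacian_dissipative:
  assumes "(u, w) \<in> dirichlet_laplacian"
  shows "inner w u \<le> 0"
proof -
  obtain G :: "real \<Rightarrow> real" where "inner w u = - (\<integral>x. G x * G x \<partial>leb01)"
    using dirichlet_laplacian_form[OF assms assms] by blast
  moreover have "0 \<le> (\<integral>x. G x * G x \<partial>leb01)" by (rule integral_nonneg_AE) simp
  ultimately show ?thesis by linarith
qed

theorem theorem5p6:
  fixes c s :: real
    and S :: "real \<Rightarrow> L2 \<Rightarrow>\<^sub>L L2"
    and \<mu> :: "real \<Rightarrow> L2 measure"
    and L :: "(L2 \<Rightarrow>\<^sub>C real) operator"
  assumes "c \<ge> 0" and "0 < s" and "s < 1"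
    and "C0_semigroup S" and "infinitesimal_generator S = dirichlet_laplacian"
    and "OU_measures c s S \<mu>"
    and "OU_generator S \<mu> L"
  shows "(\<forall>lam>0. \<forall>f. \<exists>!u. solves L lam f u) \<and>
    (\<forall>lam>0. \<exists>C>0. \<forall>f u. solves L lam f u \<longrightarrow>
        u \<in> Zb2 \<and> norm_Zb2 u \<le> ennreal C * ennreal (norm f)) \<and>
    (\<forall>lam>0. \<forall>\<alpha>. 0 < \<alpha> \<and> \<alpha> < 1 \<longrightarrow> (\<exists>C>0. \<forall>f u. f \<in> Cb_hoelder \<alpha> \<longrightarrow> solves L lam f u \<longrightarrow>
        u \<in> Cb2_hoelder \<alpha> \<and> norm_Cb2_hoelder \<alpha> u \<le> ennreal C * norm_Cb_hoelder \<alpha> f))"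
proof -
  interpret A: symmetric_dissipative_semigroup S dirichlet_laplacian
    by unfold_locales (use assms dirichlet_laplacian_symmetric dirichlet_laplacian_dissipative in auto)
  interpret ou_semigroup c s S \<mu>
    by unfold_locales
       (use assms A.S_add A.contraction A.selfadjoint A.S_continuous in auto)
  show ?thesis by (rule schauder_estimates) fact
qed

end
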